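(* If $-\infty<\mathbb E X_1<0$ and $0<\mathbb E X_1'<\infty$, then $\mu/\mu(\mathcal Z)$ is the unique probability measure on $\mathcal Z$ that is invariant for $P$.
   Context: Setting. $X_1,X_1'$ are real random variables and $\alpha\in[0,1]$. $(X_n)_{n\ge1}$ and $(X_n')_{n\ge1}$ are sequences of i.i.d. random variables, jointly independent; $S_n:=X_1+\dots+X_n$, $S_n':=X_1'+\dots+X_n'$. The switching random walk is the time-homogeneous Markov chain with transition kernel $P$: $P(x,dy)=\mathbb P(x+X_1\in dy)$ if $x>0$; $P(x,dy)=\mathbb P(x+X_1'\in dy)$ if $x<0$; $P(0,dy)=\alpha\,\mathbb P(X_1\in dy)+(1-\alpha)\,\mathbb P(X_1'\in dy)$. State space. $\mathcal Z_0:=\mathbb R$, $\mathcal Z_u:=u\mathbb Z$ for $u>0$; $d:=\max\{u\ge0:\mathbb P(X_1\in\mathcal Z_u)\,\mathbb P(X_1'\in\mathcal Z_u)=1\}$; $\mathcal Z:=\mathcal Z_d$ is the state space. $\lambda$ is the Haar measure on $\mathcal Z$ normalized so that $\lambda([0,x)\cap\mathcal Z)=x$ for positive $x\in\mathcal Z$ (Lebesgue measure if $d=0$, $d$ times counting measure if $d>0$). Measures are Borel; $*$ is convolution. Ladder heights. $D:=S_{\gamma_-}$ with $\gamma_-:=\inf\{k\ge1:S_k\le0\}$; $A':=S'_{\gamma_+'}$ with $\gamma_+':=\inf\{k\ge1:S_k'\ge0\}$; $A_s$ is the value of $S$ at the first $k\ge1$ with $S_k>0$ (if any), $D_s'$ is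 the value of $S'$ at the first $k\ge1$ with $S_k'<0$ (if any), both possibly defective; $\mathcal L(\cdot)$ denotes (sub-probability) distribution. $U_+:=\delta_0+\sum_{n\ge1}\mathcal L(A_s)^{*n}$, $U_-':=\delta_0+\sum_{n\ge1}\mathcal L(D_s')^{*n}$. For a measure $\varphi$ on $\mathcal Z$: $\varphi_\alpha^+(dx):=[\mathbf 1(x>0)+\alpha\mathbf 1(x=0)]\varphi(dx)$, $\varphi_\alpha^-(dx):=[\mathbf 1(x<0)+(1-\alpha)\mathbf 1(x=0)]\varphi(dx)$. With $p:=\mathbb P(D<0)$, $p':=\mathbb P(A'>0)$, $a:=\frac{p\alpha}{p\alpha+p'(1-\alpha)}$, $$\nu(dx):=\big[\mathbb P(D<x)+\mathbb P(A'>x)-1+a\mathbb P(D=x)+(1-a)\mathbb P(A'=x)\big]\lambda(dx),\qquad \mu:=U_+*\nu_\alpha^++U_-'*\nu_\alpha^-.$$ *)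

theory Defs
  imports "HOL-Probability.Probability"
begin

(* All measures on a state space Z are represented as Borel measures on the real line that are
   concentrated on Z. *)

definition grid :: "real \<Rightarrow> real set" where
  "grid u = (if u = 0 then UNIV else range (\<lambda>k::int. u * of_int k))"

definition grid_span :: "real measure \<Rightarrow> real measure \<Rightarrow> real" where
  "grid_span L L' = (GREATEST u. 0 \<le> u \<and> measure L (grid u) * measure L' (grid u) = 1)"

definition grid_haar :: "real \<Rightarrow> real measure" where
  "grid_haar d =
    (if d = 0 then lborel
     else scale_measure (ennreal d) (distr (count_space UNIV) borel (\<lambda>k::int. d * of_int k)))"

definition add_measure :: "'a measure \<Rightarrow> 'a measure \<Rightarrow> 'a measure" where
  "add_measure M N = measure_of (space M) (sets M) (\<lambda>B. emeasure M B + emeasure N B)"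

definition suminf_measure :: "(nat \<Rightarrow> 'a measure) \<Rightarrow> 'a measure" where
  "suminf_measure N = measure_of (space (N 0)) (sets (N 0)) (\<lambda>B. \<Sum>n. emeasure (N n) B)"

definition switching_kernel :: "real measure \<Rightarrow> real measure \<Rightarrow> real \<Rightarrow> real \<Rightarrow> real measure" where
  "switching_kernel L L' \<alpha> x =
    (if x > 0 then distr L borel (\<lambda>y. x + y)
     else if x < 0 then distr L' borel (\<lambda>y. x + y)
     else add_measure (scale_measure (ennreal \<alpha>) L) (scale_measure (ennreal (1 - \<alpha>)) L'))"

definition prob_measure_on :: "real set \<Rightarrow> real measure \<Rightarrow> bool" where
  "prob_measure_on Z Q \<longleftrightarrow> sets Q = sets borel \<and> prob_space Q \<and> emeasure Q Z = 1"

definition invariant_for :: "(real \<Rightarrow> real measure) \<Rightarrow> real measure \<Rightarrow> bool" where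
  "invariant_for P Q \<longleftrightarrow> (\<forall>B\<in>sets borel. (\<integral>\<^sup>+ x. emeasure (P x) B \<partial>Q) = emeasure Q B)"

definition walk :: "(nat \<Rightarrow> 'a \<Rightarrow> real) \<Rightarrow> nat \<Rightarrow> 'a \<Rightarrow> real" where
  "walk X n \<omega> = (\<Sum>k=1..n. X k \<omega>)"

(* The law of the walk at its first entrance into I after time 0. It is restricted to the event
   that I is entered at all, hence in general only a sub-probability measure. *)
definition ladder_law :: "'a measure \<Rightarrow> (nat \<Rightarrow> 'a \<Rightarrow> real) \<Rightarrow> real set \<Rightarrow> real measure" where
  "ladder_law M X I =
    distr (restrict_space M {\<omega> \<in> space M. \<exists>k\<ge>1. walk X k \<omega> \<in> I}) borel
      (\<lambda>\<omega>. walk X (Inf {k. 1 \<le> k \<and> walk X k \<omega> \<in> I}) \<omega>)"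

primrec conv_power :: "real measure \<Rightarrow> nat \<Rightarrow> real measure" where
  "conv_power F 0 = return borel 0"
| "conv_power F (Suc n) = convolution F (conv_power F n)"

definition renewal_measure :: "real measure \<Rightarrow> real measure" where
  "renewal_measure F = suminf_measure (conv_power F)"

definition pos_part :: "real \<Rightarrow> real measure \<Rightarrow> real measure" where
  "pos_part \<alpha> \<phi> = density \<phi> (\<lambda>x. ennreal (indicator {0<..} x + \<alpha> * indicator {0} x))"

definition neg_part :: "real \<Rightarrow> real measure \<Rightarrow> real measure" where
  "neg_part \<alpha> \<phi> = density \<phi> (\<lambda>x. ennreal (indicator {..<0} x + (1 - \<alpha>) * indicator {0} x))"

(* F and F' are the laws of D and A'. As D \<le> 0 \<le> A' almost surely, the real density below
   is nonnegative, so that ennreal does not truncate. *)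
definition nu_measure :: "real measure \<Rightarrow> real measure \<Rightarrow> real \<Rightarrow> real \<Rightarrow> real measure" where
  "nu_measure F F' \<alpha> d =
    (let p = measure F {..<0}; p' = measure F' {0<..};
         a = p * \<alpha> / (p * \<alpha> + p' * (1 - \<alpha>))
     in density (grid_haar d)
          (\<lambda>x. ennreal (measure F {..<x} + measure F' {x<..} - 1
                        + a * measure F {x} + (1 - a) * measure F' {x})))"

definition mu_measure ::
    "'a measure \<Rightarrow> (nat \<Rightarrow> 'a \<Rightarrow> real) \<Rightarrow> (nat \<Rightarrow> 'a \<Rightarrow> real) \<Rightarrow> real \<Rightarrow> real \<Rightarrow> real measure" where
  "mu_measure M X X' \<alpha> d =
    (let \<nu> = nu_measure (ladder_law M X {..0}) (ladder_law M X' {0..}) \<alpha> d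
     in add_measure
          (convolution (renewal_measure (ladder_law M X {0<..})) (pos_part \<alpha> \<nu>))
          (convolution (renewal_measure (ladder_law M X' {..<0})) (neg_part \<alpha> \<nu>)))"

end

theory Submission
  imports Defs
begin

text \<open>
  Write \<open>Q\<^sup>+\<close> and \<open>Q\<^sup>-\<close> for \<open>Q\<^sub>\<alpha>\<^sup>+\<close> and \<open>Q\<^sub>\<alpha>\<^sup>-\<close>. Invariance of \<open>Q\<close> means
  \<open>Q\<^sup>+ * (\<delta> - L) = Q\<^sup>- * (L' - \<delta>)\<close>, and the Wiener--Hopf duality \<open>U\<^sub>+ * (\<delta> - L) = \<delta> - D\<close> reduces this, for
  \<open>Q\<^sup>+ = U\<^sub>+ * N\<^sup>+\<close> and \<open>Q\<^sup>- = U'\<^sub>- * N\<^sup>-\<close>, to \<open>N\<^sup>+ * (\<delta> - D) = N\<^sup>- * (A' - \<delta>)\<close>. Splitting Haar measure at \<open>0\<close>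
  into \<open>w\<^sup>+ + w\<^sup>-\<close> gives the solution \<open>N\<^sup>+ = w\<^sup>+ * (\<delta> - A')\<close>, \<open>N\<^sup>- = w\<^sup>- * (\<delta> - D)\<close>, which is \<open>\<nu>\<close>; it is finite
  because \<open>D\<close> and \<open>A'\<close> are integrable.

  For uniqueness, let \<open>W\<close> be the sum of \<open>Q\<^sup>+\<close> convolved with the Green measure of \<open>L'\<close> and \<open>Q\<^sup>-\<close> convolved with that
  of \<open>L\<close>. It is locally finite, and invariance of \<open>Q\<close> makes it harmonic for both \<open>L\<close> and \<open>L'\<close>, so by Choquet and Deny
  its periods form a closed subgroup carrying \<open>L\<close> and \<open>L'\<close>. Hence \<open>W\<close> is a multiple of Haar measure. Finally \<open>W\<close>
  determines \<open>Q\<close>: after deconvolving the strict ladder heights, the contribution of \<open>Q\<^sup>+\<close> lives on \<open>[0, \<infinity>)\<close> and that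
  of \<open>Q\<^sup>-\<close> on \<open>(- \<infinity>, 0]\<close>, and the atom at \<open>0\<close> is shared in the proportion \<open>\<alpha> : 1 - \<alpha>\<close>.
\<close>

section \<open>Sums of measures\<close>

text \<open>The identities in the overview are signed, while Haar measure, \<open>W\<close> and the
  Green measures of the unrestricted walks may have infinite mass. Every identity is therefore
  tested on nonnegative functions, with its negative terms moved to the other side, and a common
  term is cancelled only once it is known to be finite. This dictates the classes of test functions:
  bounded ones against \<open>U\<close> and \<nu>, ones of finite Haar integral in the balance
  equation for \<nu>, ones with bounded potentials against \<open>W\<close>. The crosswise pairing
  in \<open>W\<close> comes from invariance. Let G and G' be the Green measures of \<open>L\<close>
  and \<open>L'\<close>. Since
  \<open>Q\<^sup>+ * (\<delta> - L) = - Q\<^sup>- * (\<delta> - L')\<close>, formally \<open>W *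
  (\<delta> - L) = Q\<^sup>+ * (\<delta> - L) * G' + Q\<^sup>- = - Q\<^sup>- + Q\<^sup>- =
  0\<close>, and likewise for \<open>L'\<close>. Both G and G' are used in factored form, as a
  finite renewal measure of strict ladder heights against the drift times a locally bounded one of
  weak ladder heights along the drift. The factors are one-sided, which is what later separates
  \<open>Q\<^sup>+\<close> from \<open>Q\<^sup>-\<close>.\<close>

lemma emeasure_suminf_measure:
  assumes s: "\<And>n. sets (N n) = sets (N 0)" and B: "B \<in> sets (N 0)"
  shows "emeasure (suminf_measure N) B = (\<Sum>n. emeasure (N n) B)"
proof (rule emeasure_measure_of[OF suminf_measure_def])
  show "sets (N 0) \<subseteq> Pow (space (N 0))" by (rule sets.space_closed)
  have "sets (suminf_measure N) = sets (N 0)"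
    unfolding suminf_measure_def by simp
  then show "B \<in> sets (suminf_measure N)" "positive (sets (suminf_measure N)) (\<lambda>B. \<Sum>n. emeasure (N n) B)"
    using B by (auto simp: positive_def)
  show "countably_additive (sets (suminf_measure N)) (\<lambda>B. \<Sum>n. emeasure (N n) B)"
    unfolding \<open>sets (suminf_measure N) = sets (N 0)\<close>
  proof (rule countably_additiveI)
    fix A :: "nat \<Rightarrow> 'a set" assume A: "range A \<subseteq> sets (N 0)" "disjoint_family A" "\<Union> (range A) \<in> sets (N 0)"
    \<comment> \<open>Two series are exchanged by reading the outer one as an integral over counting
      measure.\<close>
    have "(\<Sum>i. \<Sum>n. emeasure (N n) (A i)) = (\<integral>\<^sup>+i. (\<Sum>n. emeasure (N n) (A i)) \<partial>count_space UNIV)"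
      by (simp add: nn_integral_count_space_nat)
    also have "\<dots> = (\<Sum>n. \<integral>\<^sup>+i. emeasure (N n) (A i) \<partial>count_space UNIV)"
      by (rule nn_integral_suminf) auto
    also have "\<dots> = (\<Sum>n. emeasure (N n) (\<Union> (range A)))"
    proof (rule suminf_cong)
      fix n
      have "range A \<subseteq> sets (N n)" using A(1) s[of n] by simp
      then show "(\<integral>\<^sup>+i. emeasure (N n) (A i) \<partial>count_space UNIV) = emeasure (N n) (\<Union> (range A))"
        using suminf_emeasure[OF _ A(2)] by (simp add: nn_integral_count_space_nat)
    qed
    finally show "(\<Sum>i. \<Sum>n. emeasure (N n) (A i)) = (\<Sum>n. emeasure (N n) (\<Union> (range A)))" .
  qed
qed

lemma sets_suminf_measure [simp]: "sets (suminf_measure N) = sets (N 0)"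
  unfolding suminf_measure_def by simp

lemma space_suminf_measure [simp]: "space (suminf_measure N) = space (N 0)"
  by (rule sets_eq_imp_space_eq) simp

lemma nn_integral_suminf_measure:
  assumes s: "\<And>n. sets (N n) = sets (N 0)" and f: "f \<in> borel_measurable (N 0)"
  shows "(\<integral>\<^sup>+x. f x \<partial>suminf_measure N) = (\<Sum>n. \<integral>\<^sup>+x. f x \<partial>N n)"
  using f
proof (induction rule: borel_measurable_induct)
  case (cong f g)
  have "space (N n) = space (N 0)" for n
    using s by (rule sets_eq_imp_space_eq)
  then have "(\<integral>\<^sup>+x. f x \<partial>N n) = (\<integral>\<^sup>+x. g x \<partial>N n)" for n
    using cong by (intro nn_integral_cong) auto
  moreover have "(\<integral>\<^sup>+x. f x \<partial>suminf_measure N) = (\<integral>\<^sup>+x. g x \<partial>suminf_measure N)"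
    using cong by (intro nn_integral_cong) auto
  ultimately show ?case using cong by simp
next
  case (set A)
  have "A \<in> sets (N n)" for n using set s[of n] by simp
  then show ?case by (simp add: emeasure_suminf_measure[of N, OF s])
next
  case (mult u c)
  have [measurable]: "u \<in> borel_measurable (N n)" for n using mult s[of n] by (simp cong: measurable_cong_sets)
  have [measurable]: "u \<in> borel_measurable (suminf_measure N)" using mult by (simp cong: measurable_cong_sets)
  show ?case using mult by (simp add: nn_integral_cmult)
next
  case (add u v)
  have [measurable]: "u \<in> borel_measurable (N n)" for n using add s[of n] by (simp cong: measurable_cong_sets)
  have [measurable]: "v \<in> borel_measurable (N n)" for n using add s[of n] by (simp cong: measurable_cong_sets)
  have [measurable]: "u \<in> borel_measurable (suminf_measure N)" using add by (simp cong: measurable_cong_sets)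
  have [measurable]: "v \<in> borel_measurable (suminf_measure N)" using add by (simp cong: measurable_cong_sets)
  show ?case using add by (simp add: nn_integral_add suminf_add[OF summableI summableI])
next
  case (seq U)
  have [measurable]: "U i \<in> borel_measurable (N n)" for n i using seq s[of n] by (simp cong: measurable_cong_sets)
  have [measurable]: "U i \<in> borel_measurable (suminf_measure N)" for i using seq by (simp cong: measurable_cong_sets)
  have *: "(\<integral>\<^sup>+x. (SUP i. U i) x \<partial>M) = (SUP i. \<integral>\<^sup>+x. U i x \<partial>M)" if "\<And>i. U i \<in> borel_measurable M" for M
    using nn_integral_monotone_convergence_SUP[OF seq(3), of M] that by (simp add: SUP_apply image_comp)
  have "(\<integral>\<^sup>+x. (SUP i. U i) x \<partial>suminf_measure N) = (SUP i. \<Sum>n. \<integral>\<^sup>+x. U i x \<partial>N n)"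
    using seq by (subst *) auto
  also have "\<dots> = (\<Sum>n. SUP i. \<integral>\<^sup>+x. U i x \<partial>N n)"
    using seq(3) by (intro ennreal_suminf_SUP_eq[symmetric])
      (auto simp: incseq_def le_fun_def intro!: nn_integral_mono)
  also have "\<dots> = (\<Sum>n. \<integral>\<^sup>+x. (SUP i. U i) x \<partial>N n)"
    by (subst *) auto
  finally show ?case .
qed

lemma suminf_eq_two:
  fixes f :: "nat \<Rightarrow> ennreal"
  assumes "\<And>n. f (Suc (Suc n)) = 0"
  shows "suminf f = f 0 + f 1"
proof -
  have "f n = 0" if "n \<notin> {0, 1}" for n
    using that by (cases n rule: nat.exhaust; cases "n - 1" rule: nat.exhaust) (auto simp: assms)
  then show ?thesis by (subst suminf_finite[of "{0, 1}"]) auto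
qed

text \<open>Padding with null measures makes a binary sum a series, so its integration formula is
  inherited from the series.\<close>

lemma add_measure_eq_suminf_measure:
  "add_measure M N = suminf_measure (case_nat M (case_nat N (\<lambda>_. null_measure M)))"
proof -
  have "(\<Sum>n. emeasure (case_nat M (case_nat N (\<lambda>_. null_measure M)) n) B) = emeasure M B + emeasure N B" for B
    by (subst suminf_eq_two) simp_all
  then show ?thesis unfolding add_measure_def suminf_measure_def by simp
qed

lemma sets_add_measure [simp]: "sets (add_measure M N) = sets M"
  by (simp add: add_measure_eq_suminf_measure)

lemma nn_integral_add_measure:
  assumes s: "sets N = sets M" and f: "f \<in> borel_measurable M"
  shows "(\<integral>\<^sup>+x. f x \<partial>add_measure M N) = (\<integral>\<^sup>+x. f x \<partial>M) + (\<integral>\<^sup>+x. f x \<partial>N)"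
proof -
  let ?K = "case_nat M (case_nat N (\<lambda>_. null_measure M))"
  have "sets (?K n) = sets (?K 0)" for n
    by (auto simp: s split: nat.split)
  moreover have "f \<in> borel_measurable (?K 0)" using f by simp
  ultimately have "(\<integral>\<^sup>+x. f x \<partial>suminf_measure ?K) = (\<Sum>n. \<integral>\<^sup>+x. f x \<partial>?K n)"
    by (rule nn_integral_suminf_measure)
  also have "\<dots> = (\<integral>\<^sup>+x. f x \<partial>?K 0) + (\<integral>\<^sup>+x. f x \<partial>?K 1)"
    by (rule suminf_eq_two) simp
  finally show ?thesis by (simp add: add_measure_eq_suminf_measure)
qed

lemma emeasure_add_measure:
  assumes "sets N = sets M" "B \<in> sets M"
  shows "emeasure (add_measure M N) B = emeasure M B + emeasure N B"
proof -
  have "(\<integral>\<^sup>+x. indicator B x \<partial>add_measure M N) = (\<integral>\<^sup>+x. indicator B x \<partial>M) + (\<integral>\<^sup>+x. indicator B x \<partial>N)"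
    using assms by (intro nn_integral_add_measure) auto
  then show ?thesis using assms by simp
qed

section \<open>Translation operators\<close>

definition finite_borel :: "real measure \<Rightarrow> bool" where
  "finite_borel A \<longleftrightarrow> finite_measure A \<and> sets A = sets borel"

text \<open>For a probability measure \<open>A\<close> this is the one-step operator of the walk
  with step law \<open>A\<close>. Convolution of finite measures turns into composition of these
  operators, and they commute, so the convolution algebra of the proof becomes an algebra of
  operators on nonnegative functions.\<close>

definition transl :: "real measure \<Rightarrow> (real \<Rightarrow> ennreal) \<Rightarrow> real \<Rightarrow> ennreal" where
  "transl A f x = (\<integral>\<^sup>+y. f (x + y) \<partial>A)"

lemma finite_borelD:
  assumes "finite_borel A"
  shows finite_borel_finite_measure: "finite_measure A"
    and finite_borel_sigma_finite: "sigma_finite_measure A"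
    and finite_borel_sets: "sets A = sets borel"
    and finite_borel_space: "space A = UNIV"
    and finite_borel_emeasure: "emeasure A B \<noteq> \<infinity>"
proof -
  show *: "finite_measure A" "sets A = sets borel" using assms by (auto simp: finite_borel_def)
  show "sigma_finite_measure A" using *(1) by (rule finite_measure.sigma_finite_measure)
  show "space A = UNIV" using sets_eq_imp_space_eq[OF *(2)] by simp
  show "emeasure A B \<noteq> \<infinity>" using *(1) finite_measure.emeasure_finite by auto
qed

lemma measurable_transl [measurable]:
  assumes A: "finite_borel A" and [measurable]: "f \<in> borel_measurable borel"
  shows "transl A f \<in> borel_measurable borel"
proof -
  interpret sigma_finite_measure A using A by (rule finite_borel_sigma_finite)
  note [measurable_cong] = finite_borel_sets[OF A]
  show ?thesis unfolding transl_def by measurable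
qed

lemma transl_cong: "(\<And>x. f x = g x) \<Longrightarrow> transl A f = transl A g"
  by (rule arg_cong[where f="transl A"]) (rule ext, simp)

lemma transl_mono: "(\<And>x. f x \<le> g x) \<Longrightarrow> transl A f x \<le> transl A g x"
  unfolding transl_def by (intro nn_integral_mono) auto

lemma transl_add:
  assumes A: "finite_borel A" and [measurable]: "f \<in> borel_measurable borel" "g \<in> borel_measurable borel"
  shows "transl A (\<lambda>x. f x + g x) = (\<lambda>x. transl A f x + transl A g x)"
proof -
  note [measurable_cong] = finite_borel_sets[OF A]
  show ?thesis unfolding transl_def by (intro ext nn_integral_add) measurable
qed

lemma transl_suminf:
  assumes A: "finite_borel A" and [measurable]: "\<And>n. f n \<in> borel_measurable borel"
  shows "transl A (\<lambda>x. \<Sum>n. f n x) = (\<lambda>x. \<Sum>n. transl A (f n) x)"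
proof -
  note [measurable_cong] = finite_borel_sets[OF A]
  show ?thesis unfolding transl_def by (intro ext nn_integral_suminf) measurable
qed

lemma transl_cmult:
  assumes A: "finite_borel A" and [measurable]: "f \<in> borel_measurable borel"
  shows "transl A (\<lambda>x. c * f x) = (\<lambda>x. c * transl A f x)"
proof -
  note [measurable_cong] = finite_borel_sets[OF A]
  show ?thesis unfolding transl_def by (intro ext nn_integral_cmult) measurable
qed

lemma transl_commute:
  assumes A: "finite_borel A" and B: "finite_borel B" and [measurable]: "f \<in> borel_measurable borel"
  shows "transl A (transl B f) = transl B (transl A f)"
proof
  fix x
  interpret A: sigma_finite_measure A using A by (rule finite_borel_sigma_finite)
  interpret B: sigma_finite_measure B using B by (rule finite_borel_sigma_finite)
  interpret pair_sigma_finite A B ..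
  note [measurable_cong] = finite_borel_sets[OF A] finite_borel_sets[OF B]
  have "(\<integral>\<^sup>+y. \<integral>\<^sup>+z. f (x + y + z) \<partial>B \<partial>A) = (\<integral>\<^sup>+z. \<integral>\<^sup>+y. f (x + y + z) \<partial>A \<partial>B)"
    by (rule Fubini'[symmetric]) measurable
  then show "transl A (transl B f) x = transl B (transl A f) x"
    by (simp add: transl_def ac_simps)
qed

lemma nn_integral_transl_0: "(\<integral>\<^sup>+y. f y \<partial>A) = transl A f 0"
  by (simp add: transl_def)

lemma finite_borel_convolution:
  assumes "finite_borel A" "finite_borel B"
  shows "finite_borel (convolution A B)"
  using assms convolution_finite[of A B] by (simp add: finite_borel_def)

lemma nn_integral_convolution_transl:
  assumes A: "finite_borel A" and B: "finite_borel B" and [measurable]: "f \<in> borel_measurable borel"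
  shows "(\<integral>\<^sup>+x. f x \<partial>convolution A B) = (\<integral>\<^sup>+x. transl B f x \<partial>A)"
  using assms unfolding transl_def finite_borel_def by (intro nn_integral_convolution) auto

lemma transl_convolution:
  assumes A: "finite_borel A" and B: "finite_borel B" and [measurable]: "f \<in> borel_measurable borel"
  shows "transl (convolution A B) f = transl A (transl B f)"
proof
  fix x
  have "(\<integral>\<^sup>+y. f (x + y) \<partial>convolution A B) = (\<integral>\<^sup>+y. transl B (\<lambda>y. f (x + y)) y \<partial>A)"
    by (rule nn_integral_convolution_transl[OF A B]) measurable
  then show "transl (convolution A B) f x = transl A (transl B f) x"
    by (simp add: transl_def add.assoc)
qed

lemma transl_return [simp]:
  assumes [measurable]: "f \<in> borel_measurable borel"
  shows "transl (return borel 0) f = f"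
  by (rule ext) (simp add: transl_def nn_integral_return)

lemma finite_borel_return [simp]: "finite_borel (return borel x)"
  unfolding finite_borel_def
  using prob_space.finite_measure[OF prob_space_return[of x borel]] by simp

lemma nn_integral_density_indicator:
  assumes A: "finite_borel A" and [measurable]: "C \<in> sets borel" "f \<in> borel_measurable borel"
  shows "(\<integral>\<^sup>+x. f x \<partial>density A (indicator C)) = (\<integral>\<^sup>+x. indicator C x * f x \<partial>A)"
proof -
  note [measurable_cong] = finite_borel_sets[OF A]
  show ?thesis by (rule nn_integral_density) measurable
qed

lemma finite_borel_density_indicator:
  assumes A: "finite_borel A" and [measurable]: "C \<in> sets borel"
  shows "finite_borel (density A (indicator C))"
proof -
  have C: "C \<in> sets A" using finite_borel_sets[OF A] by simp
  have "emeasure (density A (indicator C)) (space A) = emeasure A C"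
    using nn_integral_density_indicator[OF A, of C "\<lambda>_. 1"] C by simp
  then have "finite_measure (density A (indicator C))"
    using finite_borel_emeasure[OF A] by (intro finite_measureI) simp
  then show ?thesis using finite_borel_sets[OF A] by (simp add: finite_borel_def)
qed

lemma finite_borel_conv_power:
  assumes "finite_borel F"
  shows "finite_borel (conv_power F n)"
  by (induction n) (simp_all add: finite_borel_convolution assms)

lemma transl_conv_power:
  assumes F: "finite_borel F" and [measurable]: "f \<in> borel_measurable borel"
  shows "transl (conv_power F n) f = (transl F ^^ n) f"
  by (induction n) (simp_all add: transl_convolution F finite_borel_conv_power)

lemma measurable_transl_power [measurable]:
  assumes F: "finite_borel F" and [measurable]: "f \<in> borel_measurable borel"
  shows "(transl F ^^ n) f \<in> borel_measurable borel"
  by (induction n) (simp_all add: measurable_transl[OF F])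

lemma transl_le_mult:
  assumes A: "finite_borel A" and "\<And>x. f x \<le> c"
  shows "transl A f x \<le> c * emeasure A UNIV"
proof -
  have "transl A f x \<le> (\<integral>\<^sup>+y. c \<partial>A)" unfolding transl_def using assms by (intro nn_integral_mono) auto
  then show ?thesis using finite_borel_space[OF A] by simp
qed

lemma finite_borel_eqI:
  assumes A: "finite_borel A" and B: "sets B = sets borel"
    and eq: "\<And>f. f \<in> borel_measurable borel \<Longrightarrow> (\<And>x. f x \<le> (1::ennreal)) \<Longrightarrow> (\<integral>\<^sup>+x. f x \<partial>A) = (\<integral>\<^sup>+x. f x \<partial>B)"
  shows "A = B"
proof (rule measure_eqI)
  show "sets A = sets B" using finite_borel_sets[OF A] B by simp
  fix X assume "X \<in> sets A"
  then have [measurable]: "X \<in> sets borel" using finite_borel_sets[OF A] by simp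
  then show "emeasure A X = emeasure B X"
    using eq[of "indicator X"] finite_borel_sets[OF A] B by (simp add: indicator_def flip: nn_integral_indicator)
qed

section \<open>Walks killed on leaving a half-line\<close>

text \<open>Law of the walk at time \<open>n\<close>, restricted to the event that it is in
  \<open>C\<close> at the times 1 to \<open>n\<close>. The starting point 0 is not tested, so
  \<open>C\<close> may be an open half-line as well as a closed one.\<close>

primrec killed :: "real measure \<Rightarrow> real set \<Rightarrow> nat \<Rightarrow> real measure" where
  "killed L C 0 = return borel 0"
| "killed L C (Suc n) = density (convolution (killed L C n) L) (indicator C)"

text \<open>The index \<open>n\<close> counts the steps survived; the exit itself takes place at
  time \<open>n + 1\<close>.\<close>

definition exit_at :: "real measure \<Rightarrow> real set \<Rightarrow> nat \<Rightarrow> real measure" where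
  "exit_at L C n = density (convolution (killed L C n) L) (indicator (- C))"

definition green :: "real measure \<Rightarrow> real set \<Rightarrow> real measure" where
  "green L C = suminf_measure (killed L C)"

text \<open>For \<open>C = {0<..}\<close> this is the law of the first weakly descending ladder
  height, for \<open>C = {..0}\<close> that of the first strictly ascending one. It is defective if
  the walk can stay in \<open>C\<close> for ever.\<close>

definition exit_law :: "real measure \<Rightarrow> real set \<Rightarrow> real measure" where
  "exit_law L C = suminf_measure (exit_at L C)"

lemma finite_borel_killed:
  assumes L: "finite_borel L" and C: "C \<in> sets borel"
  shows "finite_borel (killed L C n)"
  by (induction n) (simp_all add: finite_borel_density_indicator finite_borel_convolution L C)

lemma finite_borel_exit_at:
  assumes L: "finite_borel L" and C: "C \<in> sets borel"
  shows "finite_borel (exit_at L C n)"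
  unfolding exit_at_def using C
  by (intro finite_borel_density_indicator finite_borel_convolution L finite_borel_killed) auto

lemma nn_integral_killed_Suc:
  assumes L: "finite_borel L" and C: "C \<in> sets borel" and [measurable]: "f \<in> borel_measurable borel"
  shows "(\<integral>\<^sup>+x. f x \<partial>killed L C (Suc n)) = (\<integral>\<^sup>+x. transl L (\<lambda>x. indicator C x * f x) x \<partial>killed L C n)"
proof -
  note [measurable] = C
  show ?thesis
    using L C by (simp add: nn_integral_density_indicator finite_borel_convolution finite_borel_killed nn_integral_convolution_transl)
qed

lemma nn_integral_exit_at:
  assumes L: "finite_borel L" and C: "C \<in> sets borel" and [measurable]: "f \<in> borel_measurable borel"
  shows "(\<integral>\<^sup>+x. f x \<partial>exit_at L C n) = (\<integral>\<^sup>+x. transl L (\<lambda>x. indicator (- C) x * f x) x \<partial>killed L C n)"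
proof -
  note [measurable] = C
  show ?thesis
    unfolding exit_at_def
    using L C by (simp add: nn_integral_density_indicator finite_borel_convolution finite_borel_killed nn_integral_convolution_transl)
qed

text \<open>A free step from a surviving position either survives or exits. The relations between
  Green measures and exit laws all rest on this conservation law.\<close>

lemma nn_integral_killed_exit:
  assumes L: "finite_borel L" and C: "C \<in> sets borel" and f[measurable]: "f \<in> borel_measurable borel"
  shows "(\<integral>\<^sup>+x. f x \<partial>killed L C (Suc n)) + (\<integral>\<^sup>+x. f x \<partial>exit_at L C n) = (\<integral>\<^sup>+x. transl L f x \<partial>killed L C n)"
proof -
  note [measurable] = C
  note [measurable_cong] = finite_borel_sets[OF finite_borel_killed[OF L C]]
  have "transl L f = transl L (\<lambda>x. indicator C x * f x + indicator (- C) x * f x)"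
    by (rule transl_cong) (simp split: split_indicator)
  also have "\<dots> = (\<lambda>x. transl L (\<lambda>x. indicator C x * f x) x + transl L (\<lambda>x. indicator (- C) x * f x) x)"
    by (rule transl_add[OF L]) measurable
  finally have *: "transl L f = \<dots>" .
  have 1: "transl L (\<lambda>x. indicator C x * f x) \<in> borel_measurable borel"
    by (rule measurable_transl[OF L]) measurable
  have 2: "transl L (\<lambda>x. indicator (- C) x * f x) \<in> borel_measurable borel"
    by (rule measurable_transl[OF L]) measurable
  show ?thesis
    unfolding nn_integral_killed_Suc[OF L C f] nn_integral_exit_at[OF L C f] *
    using 1 2 by (intro nn_integral_add[symmetric]) (simp_all cong: measurable_cong_sets add: finite_borel_sets[OF finite_borel_killed[OF L C]])
qed

lemma AE_killed:
  assumes L: "finite_borel L" and C: "C \<in> sets borel"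
  shows "AE x in killed L C (Suc n). x \<in> C"
proof -
  have "indicator C \<in> borel_measurable (convolution (killed L C n) L)" using C by simp
  then show ?thesis
    unfolding killed.simps by (subst AE_density) (auto split: split_indicator)
qed

lemma AE_killed_0: "AE x in killed L C 0. x = 0"
proof -
  have "Measurable.pred (borel :: real measure) (\<lambda>x. x = 0)" by measurable
  then show ?thesis unfolding killed.simps by (subst AE_return) auto
qed

lemma AE_killed':
  assumes L: "finite_borel L" and C: "C \<in> sets borel"
  shows "AE x in killed L C n. x \<in> C \<or> x = 0"
proof (cases n)
  case 0
  then show ?thesis using AE_killed_0[of L C] by auto
next
  case (Suc m)
  then show ?thesis using AE_killed[OF assms, of m] by auto
qed

lemma AE_exit_at:
  assumes L: "finite_borel L" and C: "C \<in> sets borel"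
  shows "AE x in exit_at L C n. x \<notin> C"
proof -
  have "indicator (- C) \<in> borel_measurable (convolution (killed L C n) L)" using C by simp
  then show ?thesis unfolding exit_at_def by (subst AE_density) (auto split: split_indicator)
qed

lemma sets_green [simp]: "sets (green L C) = sets borel"
  by (simp add: green_def)

lemma sets_exit_law [simp]: "sets (exit_law L C) = sets borel"
  by (simp add: exit_law_def exit_at_def)

lemma nn_integral_green:
  assumes L: "finite_borel L" and C: "C \<in> sets borel" and f: "f \<in> borel_measurable borel"
  shows "(\<integral>\<^sup>+x. f x \<partial>green L C) = (\<Sum>n. \<integral>\<^sup>+x. f x \<partial>killed L C n)"
  unfolding green_def
proof (rule nn_integral_suminf_measure)
  show "sets (killed L C n) = sets (killed L C 0)" for n
    using finite_borel_sets[OF finite_borel_killed[OF L C]] by simp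
  show "f \<in> borel_measurable (killed L C 0)" using f by simp
qed

lemma nn_integral_exit_law:
  assumes L: "finite_borel L" and C: "C \<in> sets borel" and f: "f \<in> borel_measurable borel"
  shows "(\<integral>\<^sup>+x. f x \<partial>exit_law L C) = (\<Sum>n. \<integral>\<^sup>+x. f x \<partial>exit_at L C n)"
  unfolding exit_law_def
proof (rule nn_integral_suminf_measure)
  show "sets (exit_at L C n) = sets (exit_at L C 0)" for n
    by (simp add: exit_at_def)
  show "f \<in> borel_measurable (exit_at L C 0)" using f by (simp add: exit_at_def)
qed

lemma nn_integral_1_UNIV: "sets A = sets borel \<Longrightarrow> (\<integral>\<^sup>+x. 1 \<partial>A) = emeasure A (UNIV :: real set)"
  using sets_eq_imp_space_eq[of A borel] by simp

lemma exit_law_mass_partial: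
  assumes L: "finite_borel L" and L1: "emeasure L UNIV = 1" and C: "C \<in> sets borel"
  shows "(\<Sum>i<n. emeasure (exit_at L C i) UNIV) + emeasure (killed L C n) UNIV = 1"
proof (induction n)
  case 0
  then show ?case by simp
next
  case (Suc n)
  have "transl L (\<lambda>_. 1) = (\<lambda>_. 1)"
    using L1 finite_borel_space[OF L] by (auto simp: transl_def)
  then have "emeasure (killed L C (Suc n)) UNIV + emeasure (exit_at L C n) UNIV = emeasure (killed L C n) UNIV"
    using nn_integral_killed_exit[OF L C, of "\<lambda>_. 1" n]
    by (simp only: nn_integral_1_UNIV finite_borel_sets finite_borel_killed finite_borel_exit_at L C) simp
  then show ?case using Suc by (simp add: add.assoc add.commute[of "emeasure (killed L C (Suc n)) UNIV"] del: killed.simps)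
qed

lemma emeasure_exit_law_le:
  assumes L: "finite_borel L" and L1: "emeasure L UNIV = 1" and C: "C \<in> sets borel"
  shows "emeasure (exit_law L C) UNIV \<le> 1"
proof -
  have "emeasure (exit_law L C) UNIV = (\<Sum>n. emeasure (exit_at L C n) UNIV)"
    using nn_integral_exit_law[OF L C, of "\<lambda>_. 1"] finite_borel_sets[OF finite_borel_exit_at[OF L C]]
    by (simp only: nn_integral_1_UNIV sets_exit_law) simp
  also have "\<dots> \<le> 1"
  proof (rule suminf_le_const[OF summableI])
    show "(\<Sum>i<n. emeasure (exit_at L C i) UNIV) \<le> 1" for n
      unfolding exit_law_mass_partial[OF assms, of n, symmetric] by simp
  qed
  finally show ?thesis .
qed

lemma finite_borel_exit_law:
  assumes "finite_borel L" and "emeasure L UNIV = 1" and "C \<in> sets borel"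
  shows "finite_borel (exit_law L C)"
proof -
  have "space (exit_law L C) = UNIV" using sets_eq_imp_space_eq[OF sets_exit_law] by simp
  then have "finite_measure (exit_law L C)"
    using emeasure_exit_law_le[OF assms] by (intro finite_measureI) (auto simp: top_unique)
  then show ?thesis by (simp add: finite_borel_def)
qed

lemma nn_integral_eq_0I:
  assumes "AE x in A. f x = (0::ennreal)" shows "(\<integral>\<^sup>+x. f x \<partial>A) = 0"
  using nn_integral_cong_AE[OF assms] by simp

lemma AE_exit_law:
  assumes L: "finite_borel L" and C[measurable]: "C \<in> sets borel"
  shows "AE x in exit_law L C. x \<notin> C"
proof -
  have "(\<integral>\<^sup>+x. indicator C x \<partial>exit_at L C n) = 0" for n
    by (rule nn_integral_eq_0I, rule eventually_mono[OF AE_exit_at[OF L C, of n]]) simp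
  then have "(\<integral>\<^sup>+x. indicator C x \<partial>exit_law L C) = 0"
    by (subst nn_integral_exit_law[OF L C]) simp_all
  then have "emeasure (exit_law L C) C = 0" by simp
  then show ?thesis
    using C by (intro AE_I[of _ _ C]) auto
qed

text \<open>The conservation law summed over time: with G for the Green measure and D for the exit
  law it reads G + D = \<delta> + G * L. Without subtraction it is valid even when the Green terms
  are infinite.\<close>

lemma nn_integral_green_exit:
  assumes L: "finite_borel L" and C: "C \<in> sets borel" and f: "f \<in> borel_measurable borel"
  shows "(\<integral>\<^sup>+x. f x \<partial>green L C) + (\<integral>\<^sup>+x. f x \<partial>exit_law L C) = f 0 + (\<integral>\<^sup>+x. transl L f x \<partial>green L C)"
proof -
  have "(\<integral>\<^sup>+x. f x \<partial>green L C) = f 0 + (\<Sum>n. \<integral>\<^sup>+x. f x \<partial>killed L C (Suc n))"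
    using suminf_offset[of "\<lambda>n. \<integral>\<^sup>+x. f x \<partial>killed L C n" 1] f
    by (simp add: nn_integral_green[OF L C f] nn_integral_return add.commute)
  then have "(\<integral>\<^sup>+x. f x \<partial>green L C) + (\<integral>\<^sup>+x. f x \<partial>exit_law L C) =
     f 0 + ((\<Sum>n. \<integral>\<^sup>+x. f x \<partial>killed L C (Suc n)) + (\<Sum>n. \<integral>\<^sup>+x. f x \<partial>exit_at L C n))"
    using nn_integral_exit_law[OF L C f] by (simp add: add.assoc)
  also have "(\<Sum>n. \<integral>\<^sup>+x. f x \<partial>killed L C (Suc n)) + (\<Sum>n. \<integral>\<^sup>+x. f x \<partial>exit_at L C n) =
      (\<Sum>n. (\<integral>\<^sup>+x. f x \<partial>killed L C (Suc n)) + (\<integral>\<^sup>+x. f x \<partial>exit_at L C n))"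
    by (rule suminf_add[OF summableI summableI])
  also have "\<dots> = (\<integral>\<^sup>+x. transl L f x \<partial>green L C)"
    unfolding nn_integral_killed_exit[OF L C f]
    by (rule nn_integral_green[OF L C, symmetric]) (rule measurable_transl[OF L f])
  finally show ?thesis .
qed

section \<open>Wiener--Hopf duality\<close>

text \<open>Tonelli for a double series, summed along the diagonals n = i + j.\<close>

lemma suminf_cauchy_product_ennreal:
  fixes F :: "nat \<Rightarrow> nat \<Rightarrow> ennreal"
  shows "(\<Sum>n. \<Sum>i\<le>n. F i (n - i)) = (\<Sum>i. \<Sum>j. F i j)"
proof -
  have "(\<Sum>n. \<Sum>i\<le>n. F i (n - i)) = (\<Sum>n. \<Sum>i. if i \<le> n then F i (n - i) else 0)"
    by (rule suminf_cong, subst suminf_finite[of "{..n}" for n]) auto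
  also have "\<dots> = (\<integral>\<^sup>+n. (\<Sum>i. if i \<le> n then F i (n - i) else 0) \<partial>count_space UNIV)"
    by (simp add: nn_integral_count_space_nat)
  also have "\<dots> = (\<Sum>i. \<integral>\<^sup>+n. (if i \<le> n then F i (n - i) else 0) \<partial>count_space UNIV)"
    by (rule nn_integral_suminf) simp
  also have "\<dots> = (\<Sum>i. \<Sum>n. if i \<le> n then F i (n - i) else 0)"
    by (simp add: nn_integral_count_space_nat)
  also have "\<dots> = (\<Sum>i. \<Sum>j. F i j)"
  proof (rule suminf_cong)
    fix i
    show "(\<Sum>n. if i \<le> n then F i (n - i) else 0) = (\<Sum>j. F i j)"
      by (subst suminf_offset[OF summableI, of _ i]) simp
  qed
  finally show ?thesis .
qed

lemma measurable_finite_borel: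
  assumes "finite_borel A" "f \<in> borel_measurable borel"
  shows "f \<in> borel_measurable A"
  using assms(2) measurable_cong_sets[OF finite_borel_sets[OF assms(1)] refl] by blast

lemma nn_integral_transl_commute:
  assumes A: "finite_borel A" and B: "finite_borel B" and f: "f \<in> borel_measurable borel"
  shows "(\<integral>\<^sup>+x. transl A f x \<partial>B) = (\<integral>\<^sup>+x. transl B f x \<partial>A)"
  using fun_cong[OF transl_commute[OF A B f], of 0] by (simp add: nn_integral_transl_0)

lemma mult_emeasure_finite:
  assumes A: "finite_borel A" and "c < \<infinity>"
  shows "c * emeasure A UNIV < \<infinity>"
  using assms(2) finite_borel_emeasure[OF A, of UNIV] by (metis ennreal_mult_less_top infinity_ennreal_def less_top)

lemma nn_integral_finite:
  assumes A: "finite_borel A" and "\<And>x. f x \<le> c" "c < \<infinity>"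
  shows "(\<integral>\<^sup>+x. f x \<partial>A) < \<infinity>"
proof -
  have "transl A f 0 \<le> c * emeasure A UNIV" by (rule transl_le_mult[OF A assms(2)])
  also have "\<dots> < \<infinity>" by (rule mult_emeasure_finite[OF A assms(3)])
  finally show ?thesis by (simp only: nn_integral_transl_0)
qed

text \<open>Compare the coefficients of \<open>t\<^sup>n\<close> in two expansions of
  \<open>G\<^sub>t * (\<delta> - t L) * H\<^sub>t\<close>, where \<open>G\<^sub>t\<close> and \<open>H\<^sub>t\<close> are the generating functions of the walks
  killed outside of \<open>C\<close> and of its complement: \<open>(\<delta> - D\<^sub>t) * H\<^sub>t = G\<^sub>t * (\<delta> - A\<^sub>t)\<close>.\<close>
lemma killed_duality_aux:
  assumes L: "finite_borel L" and C: "C \<in> sets borel"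
    and f: "f \<in> borel_measurable borel" and fc: "\<And>x. f x \<le> c" "c < \<infinity>"
  shows "(\<Sum>i\<le>n. \<integral>\<^sup>+x. transl (killed L (- C) (n - i)) f x \<partial>exit_at L C i) + (\<integral>\<^sup>+x. f x \<partial>killed L C (Suc n))
    = (\<Sum>i\<le>n. \<integral>\<^sup>+x. transl (exit_at L (- C) (n - i)) f x \<partial>killed L C i) + (\<integral>\<^sup>+x. f x \<partial>killed L (- C) (Suc n))"
proof -
  let ?G = "killed L C" and ?H = "killed L (- C)" and ?D = "exit_at L C" and ?A = "exit_at L (- C)"
  have C': "- C \<in> sets borel" using C by auto
  have G: "finite_borel (?G n)" "finite_borel (?D n)" "finite_borel (?H n)" "finite_borel (?A n)" for n
    using L C C' by (simp_all add: finite_borel_killed finite_borel_exit_at)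
  have Hf: "transl (?H n) f \<in> borel_measurable borel" for n using G f by (intro measurable_transl)
  have Af: "transl (?A n) f \<in> borel_measurable borel" for n using G f by (intro measurable_transl)
  \<comment> \<open>First expansion: the middle step is absorbed by the walk killed outside
    \<open>C\<close>.\<close>
  have 1: "(\<integral>\<^sup>+x. transl L (transl (?H j) f) x \<partial>?G i) =
      (\<integral>\<^sup>+x. transl (?H j) f x \<partial>?G (Suc i)) + (\<integral>\<^sup>+x. transl (?H j) f x \<partial>?D i)" for i j
    using nn_integral_killed_exit[OF L C Hf] by simp
  \<comment> \<open>Second expansion: since the operators commute, the same step can be absorbed by
    the walk killed outside the complement.\<close>
  have H2: "transl L (transl (?H j) f) x = transl (?H (Suc j)) f x + transl (?A j) f x" for j x
  proof -
    have "transl L (transl (?H j) f) x = (\<integral>\<^sup>+y. transl L (\<lambda>z. f (x + z)) y \<partial>?H j)"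
      using L G f by (simp add: transl_commute[of L]) (simp add: transl_def add.assoc)
    also have "\<dots> = transl (?H (Suc j)) f x + transl (?A j) f x"
      using f nn_integral_killed_exit[OF L C', of "\<lambda>z. f (x + z)" j]
      by (simp add: transl_def del: killed.simps)
    finally show ?thesis .
  qed
  have 2: "(\<integral>\<^sup>+x. transl L (transl (?H j) f) x \<partial>?G i) =
      (\<integral>\<^sup>+x. transl (?H (Suc j)) f x \<partial>?G i) + (\<integral>\<^sup>+x. transl (?A j) f x \<partial>?G i)" for i j
    unfolding H2 using Hf Af by (intro nn_integral_add measurable_finite_borel[OF G(1)])
  let ?P = "\<lambda>i j. \<integral>\<^sup>+x. transl (?H j) f x \<partial>?G i"
  \<comment> \<open>The coefficient of order n + 1 in the product of the two generating functions.
    It occurs in both expansions and is cancelled at the end, which is why \<open>f\<close> has to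
    be bounded.\<close>
  define S where "S = (\<Sum>i\<le>Suc n. ?P i (Suc n - i))"
  have P0: "?P 0 j = (\<integral>\<^sup>+x. f x \<partial>?H j)" for j
    using Hf[of j] by (simp add: nn_integral_return nn_integral_transl_0)
  have P1: "?P j 0 = (\<integral>\<^sup>+x. f x \<partial>?G j)" for j
    using f by simp
  have S1: "S = (\<integral>\<^sup>+x. f x \<partial>?H (Suc n)) + (\<Sum>i\<le>n. ?P (Suc i) (n - i))"
    unfolding S_def sum.atMost_Suc_shift P0[symmetric] by simp
  have S2: "S = (\<Sum>i\<le>n. ?P i (Suc (n - i))) + (\<integral>\<^sup>+x. f x \<partial>?G (Suc n))"
    unfolding S_def P1[symmetric] by (simp add: Suc_diff_le del: killed.simps)
  have "S < \<infinity>"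
    unfolding S_def
  proof -
    have "?P i j < \<infinity>" for i j
      by (rule nn_integral_finite[OF G(1) transl_le_mult[OF G(3) fc(1)] mult_emeasure_finite[OF G(3) fc(2)]])
    then show "(\<Sum>i\<le>Suc n. ?P i (Suc n - i)) < \<infinity>" unfolding infinity_ennreal_def by (subst ennreal_sum_less_top) (simp_all only: finite_atMost ball_simps infinity_ennreal_def, blast)
  qed
  let ?T = "\<Sum>i\<le>n. \<integral>\<^sup>+x. transl L (transl (?H (n - i)) f) x \<partial>?G i"
  have e1: "S + (\<Sum>i\<le>n. \<integral>\<^sup>+x. transl (?H (n - i)) f x \<partial>?D i) + (\<integral>\<^sup>+x. f x \<partial>?G (Suc n)) =
      ?T + (\<integral>\<^sup>+x. f x \<partial>?H (Suc n)) + (\<integral>\<^sup>+x. f x \<partial>?G (Suc n))"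
    unfolding 1 S1 by (simp add: sum.distrib ac_simps del: killed.simps)
  have e2: "?T + (\<integral>\<^sup>+x. f x \<partial>?H (Suc n)) + (\<integral>\<^sup>+x. f x \<partial>?G (Suc n)) =
      S + (\<Sum>i\<le>n. \<integral>\<^sup>+x. transl (?A (n - i)) f x \<partial>?G i) + (\<integral>\<^sup>+x. f x \<partial>?H (Suc n))"
    unfolding 2 S2 by (simp add: sum.distrib ac_simps del: killed.simps)
  have "S \<noteq> \<top>" using \<open>S < \<infinity>\<close> by simp
  then show ?thesis
    using trans[OF e1 e2] unfolding add.assoc ennreal_add_left_cancel by (simp only: simp_thms infinity_ennreal_def)
qed

text \<open>What the duality requires of an open half-line: \<open>C\<close> and its complement are
  both semigroups and 0 lies in the complement, so the side on which a sum of two positions falls is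
  known.\<close>

definition half_line :: "real set \<Rightarrow> bool" where
  "half_line C \<longleftrightarrow> C \<in> sets borel \<and> 0 \<notin> C \<and> (\<forall>x\<in>C. \<forall>y\<in>C. x + y \<in> C) \<and> (\<forall>x\<in>-C. \<forall>y\<in>-C. x + y \<notin> C)"

text \<open>Localising \<open>f\<close> to \<open>C\<close> annihilates the terms in which both
  summands lie in the complement and leaves those supported in \<open>C\<close> unchanged. What
  remains is a renewal recursion: the walk staying in \<open>C\<close> up to time n + 1 has the same
  law as the walk being at a strict ladder point at that time, a fact otherwise seen by reversing
  time.\<close>

lemma killed_duality:
  assumes L: "finite_borel L" and C: "half_line C"
    and f: "f \<in> borel_measurable borel" and fc: "\<And>x. f x \<le> c" "c < \<infinity>"
  shows "(\<integral>\<^sup>+x. f x \<partial>killed L C (Suc n)) = (\<Sum>i\<le>n. \<integral>\<^sup>+x. transl (exit_at L (- C) (n - i)) f x \<partial>killed L C i)"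
proof -
  have Cb[measurable]: "C \<in> sets borel" "- C \<in> sets borel" using C by (auto simp: half_line_def)
  define g where "g x = indicator C x * f x" for x
  have g[measurable]: "g \<in> borel_measurable borel" unfolding g_def using f by measurable
  have gc: "g x \<le> c" for x using fc(1)[of x] by (auto simp: g_def split: split_indicator)
  note AE = AE_killed[OF L Cb(1)] AE_killed'[OF L Cb(1)] AE_exit_at[OF L Cb(1)]
    AE_killed[OF L Cb(2)] AE_killed'[OF L Cb(2)] AE_exit_at[OF L Cb(2)]
  have "(\<integral>\<^sup>+x. transl (killed L (- C) j) g x \<partial>exit_at L C i) = 0" for i j
  proof (rule nn_integral_eq_0I, rule eventually_mono[OF AE(3)[of i]])
    fix x assume "x \<notin> C"
    show "transl (killed L (- C) j) g x = 0"
      unfolding transl_def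
      by (rule nn_integral_eq_0I, rule eventually_mono[OF AE(5)[of j]])
         (use \<open>x \<notin> C\<close> C in \<open>auto simp: g_def half_line_def\<close>)
  qed
  moreover have "(\<integral>\<^sup>+x. g x \<partial>killed L (- C) (Suc n)) = 0"
    by (rule nn_integral_eq_0I, rule eventually_mono[OF AE(4)[of n]]) (auto simp: g_def)
  ultimately have "(\<integral>\<^sup>+x. g x \<partial>killed L C (Suc n)) = (\<Sum>i\<le>n. \<integral>\<^sup>+x. transl (exit_at L (- C) (n - i)) g x \<partial>killed L C i)"
    using killed_duality_aux[OF L Cb(1) g gc fc(2), of n] by (simp del: killed.simps)
  moreover have "(\<integral>\<^sup>+x. g x \<partial>killed L C (Suc n)) = (\<integral>\<^sup>+x. f x \<partial>killed L C (Suc n))"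
    by (rule nn_integral_cong_AE, rule eventually_mono[OF AE(1)[of n]]) (auto simp: g_def)
  moreover have "(\<integral>\<^sup>+x. transl (exit_at L (- C) j) g x \<partial>killed L C i) = (\<integral>\<^sup>+x. transl (exit_at L (- C) j) f x \<partial>killed L C i)" for i j
  proof (rule nn_integral_cong_AE, rule eventually_mono[OF AE(2)[of i]])
    fix x assume x: "x \<in> C \<or> x = 0"
    show "transl (exit_at L (- C) j) g x = transl (exit_at L (- C) j) f x"
      unfolding transl_def
      by (rule nn_integral_cong_AE, rule eventually_mono[OF AE(6)[of j]])
         (use x C in \<open>auto simp: g_def half_line_def\<close>)
  qed
  ultimately show ?thesis by (simp del: killed.simps)
qed

lemma nn_integral_green_renewal:
  assumes L: "finite_borel L" and C: "half_line C"
    and f: "f \<in> borel_measurable borel" and fc: "\<And>x. f x \<le> c" "c < \<infinity>"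
  shows "(\<integral>\<^sup>+x. f x \<partial>green L C) = f 0 + (\<integral>\<^sup>+x. transl (exit_law L (- C)) f x \<partial>green L C)"
proof -
  have Cb: "C \<in> sets borel" "- C \<in> sets borel" using C by (auto simp: half_line_def)
  let ?A = "exit_at L (- C)"
  have Af[measurable]: "transl (?A n) f \<in> borel_measurable borel" for n
    using f finite_borel_exit_at[OF L Cb(2)] by (intro measurable_transl)
  have exit: "transl (exit_law L (- C)) f x = (\<Sum>j. transl (?A j) f x)" for x
    using nn_integral_exit_law[OF L Cb(2), of "\<lambda>y. f (x + y)"] f by (simp add: transl_def)
  have "(\<integral>\<^sup>+x. f x \<partial>green L C) = f 0 + (\<Sum>n. \<integral>\<^sup>+x. f x \<partial>killed L C (Suc n))"
    using suminf_offset[of "\<lambda>n. \<integral>\<^sup>+x. f x \<partial>killed L C n" 1] f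
    by (simp add: nn_integral_green[OF L Cb(1) f] nn_integral_return add.commute)
  also have "(\<Sum>n. \<integral>\<^sup>+x. f x \<partial>killed L C (Suc n)) = (\<Sum>i. \<Sum>j. \<integral>\<^sup>+x. transl (?A j) f x \<partial>killed L C i)"
    unfolding killed_duality[OF assms]
    by (rule suminf_cauchy_product_ennreal)
  also have "\<dots> = (\<Sum>j. \<integral>\<^sup>+x. transl (?A j) f x \<partial>green L C)"
  proof -
    have "(\<Sum>i. \<Sum>j. F i j) = (\<Sum>j. \<Sum>i. F i j)" for F :: "nat \<Rightarrow> nat \<Rightarrow> ennreal"
      using nn_integral_suminf[of "\<lambda>j i. F i j" "count_space UNIV"] by (simp add: nn_integral_count_space_nat)
    then show ?thesis by (simp add: nn_integral_green[OF L Cb(1)])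
  qed
  also have "\<dots> = (\<integral>\<^sup>+x. transl (exit_law L (- C)) f x \<partial>green L C)"
    unfolding exit using Af by (intro nn_integral_suminf[symmetric]) (simp cong: measurable_cong_sets)
  finally show ?thesis .
qed

lemma sets_renewal_measure [simp]: "sets (renewal_measure F) = sets borel"
  by (simp add: renewal_measure_def)

lemma nn_integral_renewal:
  assumes F: "finite_borel F" and f: "f \<in> borel_measurable borel"
  shows "(\<integral>\<^sup>+x. f x \<partial>renewal_measure F) = (\<Sum>k. (transl F ^^ k) f 0)"
proof -
  have "(\<integral>\<^sup>+x. f x \<partial>renewal_measure F) = (\<Sum>k. \<integral>\<^sup>+x. f x \<partial>conv_power F k)"
    unfolding renewal_measure_def
  proof (rule nn_integral_suminf_measure)
    show "sets (conv_power F n) = sets (conv_power F 0)" for n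
      using finite_borel_sets[OF finite_borel_conv_power[OF F]] by simp
    show "f \<in> borel_measurable (conv_power F 0)" using f by simp
  qed
  then show ?thesis by (simp add: nn_integral_transl_0 transl_conv_power[OF F f])
qed

text \<open>If g is the finite mass of the Green measure G and a that of the exit law A from the
  complement, then g = 1 + a g forces a < 1. Iterating G = \<delta> + A * G leaves a remainder of at
  most \<open>a ^ n\<close> times g, so G is the renewal series of A.\<close>

lemma green_eq_renewal:
  assumes L: "finite_borel L" and L1: "emeasure L UNIV = 1" and C: "half_line C"
    and fin: "emeasure (green L C) UNIV < \<infinity>"
  shows "finite_borel (green L C)" "emeasure (exit_law L (- C)) UNIV < 1"
    "green L C = renewal_measure (exit_law L (- C))"
proof -
  have C': "- C \<in> sets borel" using C by (auto simp: half_line_def)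
  let ?A = "exit_law L (- C)" and ?G = "green L C"
  have A: "finite_borel ?A" by (rule finite_borel_exit_law[OF L L1 C'])
  have "space ?G = UNIV" using sets_eq_imp_space_eq[OF sets_green] by simp
  then show G: "finite_borel ?G"
    using fin by (auto simp: finite_borel_def intro!: finite_measureI)
  let ?a = "emeasure ?A UNIV"
  have eq: "emeasure ?G UNIV = 1 + ?a * emeasure ?G UNIV"
    using nn_integral_green_renewal[OF L C, of "\<lambda>_. 1" 1] finite_borel_space[OF A] finite_borel_space[OF G]
    by (simp add: transl_def)
  show a1: "?a < 1"
  proof (rule ccontr)
    assume "\<not> ?a < 1"
    then have "?a = 1" using emeasure_exit_law_le[OF L L1 C'] by simp
    then have "emeasure ?G UNIV + 0 = emeasure ?G UNIV + 1" using eq by (simp add: add.commute)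
    then show False using fin unfolding ennreal_add_left_cancel by simp
  qed
  show "?G = renewal_measure ?A"
  proof (rule finite_borel_eqI[OF G])
    fix f :: "real \<Rightarrow> ennreal" assume f: "f \<in> borel_measurable borel" "\<And>x. f x \<le> 1"
    have m: "(transl ?A ^^ n) f \<in> borel_measurable borel" for n
      using A f(1) by (rule measurable_transl_power)
    have b: "(transl ?A ^^ n) f x \<le> ?a ^ n" for n x
    proof (induction n arbitrary: x)
      case (Suc n)
      have "transl ?A ((transl ?A ^^ n) f) x \<le> ?a ^ n * ?a" by (rule transl_le_mult[OF A Suc])
      then show ?case by (simp add: mult.commute)
    qed (use f in simp)
    have fin': "?a ^ n < \<infinity>" for n
      using a1 by (auto simp: less_top[symmetric] power_eq_top_ennreal)
    have iter: "(\<integral>\<^sup>+x. f x \<partial>?G) = (\<Sum>k<n. (transl ?A ^^ k) f 0) + (\<integral>\<^sup>+x. (transl ?A ^^ n) f x \<partial>?G)" for n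
    proof (induction n)
      case (Suc n)
      then show ?case
        using nn_integral_green_renewal[OF L C m b fin', of n] by (simp add: add.assoc)
    qed simp
    have "(\<lambda>n. \<Sum>k<n. (transl ?A ^^ k) f 0) \<longlonglongrightarrow> (\<Sum>k. (transl ?A ^^ k) f 0)"
      by (rule summable_LIMSEQ[OF summableI])
    moreover have "(\<lambda>n. \<integral>\<^sup>+x. (transl ?A ^^ n) f x \<partial>?G) \<longlonglongrightarrow> 0"
    proof (rule tendsto_sandwich[where f="\<lambda>_. 0" and h="\<lambda>n. ?a ^ n * emeasure ?G UNIV"])
      show "\<forall>\<^sub>F n in sequentially. (\<integral>\<^sup>+x. (transl ?A ^^ n) f x \<partial>?G) \<le> ?a ^ n * emeasure ?G UNIV"
        using transl_le_mult[OF G b, where x = 0] by (simp add: nn_integral_transl_0)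
      obtain r where r: "?a = ennreal r" "0 \<le> r" "r < 1"
        using a1 by (cases ?a) (auto simp: ennreal_less_one_iff)
      have "(\<lambda>n. ennreal (r ^ n)) \<longlonglongrightarrow> ennreal 0"
        using r by (intro tendsto_ennrealI LIMSEQ_realpow_zero)
      then have "(\<lambda>n. ennreal (r ^ n) * emeasure ?G UNIV) \<longlonglongrightarrow> ennreal 0 * emeasure ?G UNIV"
        using fin by (intro tendsto_mult_ennreal tendsto_const) auto
      then show "(\<lambda>n. ?a ^ n * emeasure ?G UNIV) \<longlonglongrightarrow> 0"
        using r by (simp add: ennreal_power)
    qed auto
    ultimately have "(\<lambda>n. (\<Sum>k<n. (transl ?A ^^ k) f 0) + (\<integral>\<^sup>+x. (transl ?A ^^ n) f x \<partial>?G)) \<longlonglongrightarrow> (\<Sum>k. (transl ?A ^^ k) f 0) + 0"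
      by (rule tendsto_add)
    then have "(\<integral>\<^sup>+x. f x \<partial>?G) = (\<Sum>k. (transl ?A ^^ k) f 0)"
      unfolding iter[symmetric] by (simp add: LIMSEQ_const_iff)
    then show "(\<integral>\<^sup>+x. f x \<partial>?G) = (\<integral>\<^sup>+x. f x \<partial>renewal_measure ?A)"
      by (simp add: nn_integral_renewal[OF A f(1)])
  qed simp
qed

section \<open>Walks with drift\<close>

lemma transl_green_exit:
  assumes L: "finite_borel L" and C: "C \<in> sets borel" and f: "f \<in> borel_measurable borel"
    and G: "finite_borel (green L C)"
  shows "transl (green L C) f x + transl (exit_law L C) f x = f x + transl (green L C) (transl L f) x"
  using nn_integral_green_exit[OF L C, of "\<lambda>y. f (x + y)"] f by (simp add: transl_def add.assoc)

lemma transl_renewal: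
  assumes F: "finite_borel F" and f: "f \<in> borel_measurable borel"
  shows "transl (renewal_measure F) f x = (\<Sum>k. (transl F ^^ k) f x)"
proof -
  have "(transl F ^^ k) (\<lambda>y. f (x + y)) z = (transl F ^^ k) f (x + z)" for k z
  proof (induction k arbitrary: z)
    case (Suc k)
    then show ?case by (simp add: transl_def add.assoc)
  qed simp
  then show ?thesis
    using nn_integral_renewal[OF F, of "\<lambda>y. f (x + y)"] f by (simp add: transl_def)
qed

lemma suminf_transl_power:
  assumes F: "finite_borel F" and f: "f \<in> borel_measurable borel"
  shows "(\<Sum>k. (transl F ^^ k) f x) = f x + transl F (\<lambda>x. \<Sum>k. (transl F ^^ k) f x) x"
    and "(\<Sum>k. (transl F ^^ k) f x) = f x + (\<Sum>k. (transl F ^^ k) (transl F f) x)"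
proof -
  have 1: "(\<Sum>k. (transl F ^^ k) f x) = f x + (\<Sum>k. (transl F ^^ Suc k) f x)"
    using suminf_offset[OF summableI, of "\<lambda>k. (transl F ^^ k) f x" 1] by (simp add: add.commute)
  have "transl F (\<lambda>x. \<Sum>k. (transl F ^^ k) f x) x = (\<Sum>k. (transl F ^^ Suc k) f x)"
    using transl_suminf[OF F measurable_transl_power[OF F f]] by simp
  with 1 show "(\<Sum>k. (transl F ^^ k) f x) = f x + transl F (\<lambda>x. \<Sum>k. (transl F ^^ k) f x) x" by simp
  have "(transl F ^^ Suc k) f = (transl F ^^ k) (transl F f)" for k
    by (simp only: funpow_Suc_right comp_apply)
  with 1 show "(\<Sum>k. (transl F ^^ k) f x) = f x + (\<Sum>k. (transl F ^^ k) (transl F f) x)" by simp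
qed

text \<open>The sign \<open>s\<close> lets one development serve both walks: \<open>s * x\<close> is
  the coordinate that drifts downwards, with \<open>s = 1\<close> for the walk of negative drift and
  \<open>s = -1\<close> for that of positive drift. \<open>D\<close> is the law of the weak ladder
  height along the drift, \<open>A\<close> that of the strict ladder height against it.\<close>

locale drifting_walk =
  fixes L :: "real measure" and s :: real
  assumes L_prob: "prob_space L" and L_sets: "sets L = sets borel"
    and s_sign: "s = 1 \<or> s = -1"
    and L_integrable: "integrable L (\<lambda>x. x)" and drift: "s * (\<integral>x. x \<partial>L) < 0"
begin

definition C where "C = {x. 0 < s * x}"
definition A where "A = exit_law L (- C)"
definition D where "D = exit_law L C"
definition U where "U = renewal_measure A"

lemma L: "finite_borel L"
  using L_sets prob_space.finite_measure[OF L_prob] by (simp add: finite_borel_def)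

lemma L1: "emeasure L UNIV = 1"
  using prob_space.emeasure_space_1[OF L_prob] finite_borel_space[OF L] by simp

lemma half_line_C: "half_line C"
proof -
  have "{x. 0 < s * x} \<in> sets borel" by measurable
  then show ?thesis unfolding half_line_def C_def
    by (auto simp: distrib_left not_less)
qed

lemma C_borel [measurable]: "C \<in> sets borel" "- C \<in> sets borel"
  using half_line_C by (auto simp: half_line_def)

text \<open>Truncating the steps from below prepares a nonnegative Lyapunov function. By dominated
  convergence the truncated mean tends to the drift, so for a large cutoff at least half of the
  drift survives.\<close>

lemma truncated_drift: "\<exists>K>0. \<exists>c>0. (\<integral>x. max (s * x) (- K) \<partial>L) \<le> - c"
proof -
  note [measurable_cong] = L_sets
  have "(\<lambda>n. \<integral>x. max (s * x) (- real n) \<partial>L) \<longlonglongrightarrow> (\<integral>x. s * x \<partial>L)"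
  proof (rule integral_dominated_convergence[where w="\<lambda>x. \<bar>x\<bar>"])
    show "integrable L (\<lambda>x. \<bar>x\<bar>)" using L_integrable by (rule integrable_abs)
    show "AE x in L. (\<lambda>n. max (s * x) (- real n)) \<longlonglongrightarrow> s * x"
    proof (rule AE_I2)
      fix x
      obtain N where N: "\<bar>s * x\<bar> \<le> real N" using real_arch_simple by blast
      have "\<forall>n\<ge>N. max (s * x) (- real n) = s * x" using N by (auto simp: max_def)
      then show "(\<lambda>n. max (s * x) (- real n)) \<longlonglongrightarrow> s * x"
        by (intro tendsto_eventually) (auto simp: eventually_sequentially)
    qed
    show "AE x in L. norm (max (s * x) (- real n)) \<le> \<bar>x\<bar>" for n
      using s_sign by (auto simp: max_def)
  qed measurable
  moreover have "(\<integral>x. s * x \<partial>L) < 0" using drift by simp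
  ultimately have "\<forall>\<^sub>F n in sequentially. (\<integral>x. max (s * x) (- real n) \<partial>L) < (\<integral>x. s * x \<partial>L) / 2"
    by (intro order_tendstoD(2)) auto
  then obtain N where N: "\<And>n. n \<ge> N \<Longrightarrow> (\<integral>x. max (s * x) (- real n) \<partial>L) < (\<integral>x. s * x \<partial>L) / 2"
    by (auto simp: eventually_sequentially)
  show ?thesis
    using N[of "Suc N"] \<open>(\<integral>x. s * x \<partial>L) < 0\<close>
    by (intro exI[of _ "real (Suc N)"] conjI exI[of _ "- (\<integral>x. s * x \<partial>L) / 2"]) auto
qed

text \<open>Foster--Lyapunov bound with the function \<open>max (s x) (- K) + K\<close>.\<close>
lemma emeasure_green_finite: "emeasure (green L C) UNIV < \<infinity>"
proof -
  note [measurable_cong] = L_sets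
  obtain K c where K: "K > 0" "c > 0" "(\<integral>x. max (s * x) (- K) \<partial>L) \<le> - c" using truncated_drift by auto
  define h where "h x = ennreal (max (s * x) (- K) + K)" for x
  have h[measurable]: "h \<in> borel_measurable borel" unfolding h_def by measurable
  have fin: "integrable L (\<lambda>y. max (s * y) (- K))"
    using L_integrable K(1) s_sign by (intro integrable_max integrable_mult_right) (auto intro: finite_measure.integrable_const[OF finite_borel_finite_measure[OF L]])
  have drift_h: "transl L h x + ennreal c \<le> h x" if "0 \<le> s * x" for x
  proof -
    \<comment> \<open>As \<open>s * x\<close> is nonnegative, cutting off after the step gives at
      most \<open>s * x\<close> plus the step cut off at the same level.\<close>
    have "transl L h x \<le> (\<integral>\<^sup>+y. ennreal (s * x + K + max (s * y) (- K)) \<partial>L)"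
      unfolding transl_def h_def using that by (intro nn_integral_mono ennreal_leI) (auto simp: distrib_left max_def)
    also have "\<dots> = ennreal (\<integral>y. s * x + K + max (s * y) (- K) \<partial>L)"
      using fin that by (intro nn_integral_eq_integral) (auto intro!: Bochner_Integration.integrable_add finite_measure.integrable_const[OF finite_borel_finite_measure[OF L]])
    also have "(\<integral>y. s * x + K + max (s * y) (- K) \<partial>L) = s * x + K + (\<integral>y. max (s * y) (- K) \<partial>L)"
      using fin prob_space.prob_space[OF L_prob]
      by (subst Bochner_Integration.integral_add) (auto intro!: finite_measure.integrable_const[OF finite_borel_finite_measure[OF L]])
    finally have 1: "transl L h x \<le> ennreal (s * x + K + (\<integral>y. max (s * y) (- K) \<partial>L))" .
    have "0 \<le> (\<integral>y. s * x + K + max (s * y) (- K) \<partial>L)"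
      using that by (intro integral_nonneg_AE) auto
    then have nn: "0 \<le> s * x + K + (\<integral>y. max (s * y) (- K) \<partial>L)"
      using fin prob_space.prob_space[OF L_prob]
      by (subst (asm) Bochner_Integration.integral_add) (auto intro!: finite_measure.integrable_const[OF finite_borel_finite_measure[OF L]])
    have "transl L h x + ennreal c \<le> ennreal (s * x + K + (\<integral>y. max (s * y) (- K) \<partial>L)) + ennreal c"
      using 1 by (rule add_right_mono)
    also have "\<dots> = ennreal (s * x + K + (\<integral>y. max (s * y) (- K) \<partial>L) + c)"
      using nn K by (subst ennreal_plus) auto
    also have "\<dots> \<le> h x"
      unfolding h_def using that K by (intro ennreal_leI) auto
    finally show ?thesis .
  qed
  have step: "(\<integral>\<^sup>+x. h x \<partial>killed L C (Suc n)) + ennreal c * emeasure (killed L C n) UNIV \<le> (\<integral>\<^sup>+x. h x \<partial>killed L C n)" for n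
  proof -
    have G: "finite_borel (killed L C n)" using L C_borel(1) by (rule finite_borel_killed)
    have m: "transl L h \<in> borel_measurable (killed L C n)" by (rule measurable_finite_borel[OF G measurable_transl[OF L h]])
    have "(\<integral>\<^sup>+x. h x \<partial>killed L C (Suc n)) \<le> (\<integral>\<^sup>+x. transl L h x \<partial>killed L C n)"
      unfolding nn_integral_killed_exit[OF L C_borel(1) h, of n, symmetric] by simp
    then have "(\<integral>\<^sup>+x. h x \<partial>killed L C (Suc n)) + ennreal c * emeasure (killed L C n) UNIV
       \<le> (\<integral>\<^sup>+x. transl L h x \<partial>killed L C n) + ennreal c * emeasure (killed L C n) UNIV"
      by (rule add_right_mono)
    also have "\<dots> = (\<integral>\<^sup>+x. transl L h x + ennreal c \<partial>killed L C n)"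
      using m finite_borel_space[OF G] by (subst nn_integral_add) auto
    also have "\<dots> \<le> (\<integral>\<^sup>+x. h x \<partial>killed L C n)"
      by (rule nn_integral_mono_AE, rule eventually_mono[OF AE_killed'[OF L C_borel(1)]])
         (auto simp: C_def intro!: drift_h)
    finally show ?thesis .
  qed
  have bound: "(\<integral>\<^sup>+x. h x \<partial>killed L C n) + ennreal c * (\<Sum>i<n. emeasure (killed L C i) UNIV) \<le> h 0" for n
  proof (induction n)
    case 0
    then show ?case by (simp add: nn_integral_return)
  next
    case (Suc n)
    have "(\<integral>\<^sup>+x. h x \<partial>killed L C (Suc n)) + ennreal c * (\<Sum>i<Suc n. emeasure (killed L C i) UNIV) =
      ((\<integral>\<^sup>+x. h x \<partial>killed L C (Suc n)) + ennreal c * emeasure (killed L C n) UNIV) + ennreal c * (\<Sum>i<n. emeasure (killed L C i) UNIV)"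
      by (simp add: distrib_left ac_simps del: killed.simps)
    also have "\<dots> \<le> (\<integral>\<^sup>+x. h x \<partial>killed L C n) + ennreal c * (\<Sum>i<n. emeasure (killed L C i) UNIV)"
      using step by (rule add_right_mono)
    finally show ?case using Suc by (rule order_trans)
  qed
  \<comment> \<open>Dropping the nonnegative integral of \<open>h\<close> bounds the expected
    lifetime of the killed walk by h(0) / c.\<close>
  have "ennreal c * (\<Sum>i<n. emeasure (killed L C i) UNIV) \<le> h 0" for n
    by (rule order_trans[OF _ bound[of n]]) simp
  then have "(\<Sum>i<n. ennreal c * emeasure (killed L C i) UNIV) \<le> h 0" for n
    by (simp add: sum_distrib_left)
  then have "(\<Sum>i. ennreal c * emeasure (killed L C i) UNIV) \<le> h 0"
    by (rule suminf_le_const[OF summableI])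
  moreover have "(\<Sum>i. emeasure (killed L C i) UNIV) = emeasure (green L C) UNIV"
    using nn_integral_green[OF L C_borel(1), of "\<lambda>_. 1"] nn_integral_1_UNIV[OF sets_green]
      nn_integral_1_UNIV[OF finite_borel_sets[OF finite_borel_killed[OF L C_borel(1)]]] by simp
  ultimately have "ennreal c * emeasure (green L C) UNIV < \<infinity>"
    unfolding ennreal_suminf_cmult by (auto simp: h_def intro: le_less_trans)
  then show ?thesis using K(2) by (auto simp: ennreal_mult_less_top)
qed

lemma U_eq: "U = green L C" and U: "finite_borel U" and A_defective: "emeasure A UNIV < 1"
  unfolding U_def A_def
  using green_eq_renewal[OF L L1 half_line_C emeasure_green_finite] by simp_all

lemma A: "finite_borel A"
  unfolding A_def by (rule finite_borel_exit_law[OF L L1 C_borel(2)])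

lemma D: "finite_borel D"
  unfolding D_def by (rule finite_borel_exit_law[OF L L1 C_borel(1)])

lemma AE_A: "AE x in A. 0 < s * x"
  unfolding A_def by (rule eventually_mono[OF AE_exit_law[OF L C_borel(2)]]) (simp add: C_def)

lemma AE_D: "AE x in D. s * x \<le> 0"
  unfolding D_def by (rule eventually_mono[OF AE_exit_law[OF L C_borel(1)]]) (simp add: C_def not_less)

lemma AE_U: "AE x in U. 0 \<le> s * x"
proof -
  have "(\<integral>\<^sup>+x. indicator {x. s * x < 0} x \<partial>killed L C n) = 0" for n
    by (rule nn_integral_eq_0I, rule eventually_mono[OF AE_killed'[OF L C_borel(1)]]) (auto simp: C_def)
  then have "(\<integral>\<^sup>+x. indicator {x. s * x < 0} x \<partial>U) = 0"
    unfolding U_eq by (subst nn_integral_green[OF L C_borel(1)]) simp_all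
  then have "emeasure U {x. s * x < 0} = 0" using finite_borel_sets[OF U] by simp
  then show ?thesis
    using finite_borel_sets[OF U] by (intro AE_I[of _ _ "{x. s * x < 0}"]) auto
qed

lemma U_L:
  assumes f: "f \<in> borel_measurable borel"
  shows "transl U f x + transl D f x = f x + transl U (transl L f) x"
  using transl_green_exit[OF L C_borel(1) f] U by (simp add: U_eq D_def)

lemma U_A:
  assumes f: "f \<in> borel_measurable borel"
  shows "transl U f x = f x + transl A (transl U f) x"
proof -
  have "transl U f = (\<lambda>x. \<Sum>k. (transl A ^^ k) f x)"
    unfolding U_def using transl_renewal[OF A f] by (rule ext)
  then show ?thesis using suminf_transl_power(1)[OF A f, of x] by (simp only:)
qed

text \<open>Total masses in U + D = \<delta> + U * L: the mass of \<open>U\<close> is finite and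
  cancels, so the walk leaves the half-line almost surely.\<close>

lemma D1: "emeasure D UNIV = 1"
proof -
  have "transl L (\<lambda>_. 1) = (\<lambda>_. 1)"
    using L1 finite_borel_space[OF L] by (auto simp: transl_def)
  then have "emeasure U UNIV + emeasure D UNIV = emeasure U UNIV + 1"
    using U_L[of "\<lambda>_. 1" 0] finite_borel_space[OF U] finite_borel_space[OF D]
    by (simp add: transl_def add.commute)
  then show ?thesis using finite_borel_emeasure[OF U] unfolding ennreal_add_left_cancel by simp
qed

lemma D_prob: "prob_space D"
  using D1 finite_borel_space[OF D] by (intro prob_spaceI) simp

text \<open>A step that leaves \<open>C\<close> overshoots the origin by at most its own length. The
  mean overshoot is therefore at most the mean step length times the expected number of steps taken
  before the exit, which is the mass of \<open>U\<close>.\<close>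

lemma D_mean: "(\<integral>\<^sup>+x. ennreal \<bar>x\<bar> \<partial>D) < \<infinity>"
proof -
  let ?m = "\<integral>\<^sup>+y. ennreal \<bar>y\<bar> \<partial>L"
  have m: "?m < \<infinity>"
    using L_integrable by (simp add: integrable_iff_bounded)
  have "(\<integral>\<^sup>+x. ennreal \<bar>x\<bar> \<partial>exit_at L C n) \<le> ?m * emeasure (killed L C n) UNIV" for n
  proof -
    have G: "finite_borel (killed L C n)" using L C_borel(1) by (rule finite_borel_killed)
    have "(\<integral>\<^sup>+x. ennreal \<bar>x\<bar> \<partial>exit_at L C n) = (\<integral>\<^sup>+x. transl L (\<lambda>x. indicator (- C) x * ennreal \<bar>x\<bar>) x \<partial>killed L C n)"
      by (rule nn_integral_exit_at[OF L C_borel(1)]) simp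
    also have "\<dots> \<le> (\<integral>\<^sup>+x. ?m \<partial>killed L C n)"
    proof (rule nn_integral_mono_AE, rule eventually_mono[OF AE_killed'[OF L C_borel(1)]])
      fix x assume x: "x \<in> C \<or> x = 0"
      show "transl L (\<lambda>x. indicator (- C) x * ennreal \<bar>x\<bar>) x \<le> ?m"
        unfolding transl_def
        using x s_sign by (intro nn_integral_mono) (auto simp: C_def not_less split: split_indicator intro!: ennreal_leI)
    qed
    finally show ?thesis using finite_borel_space[OF G] by simp
  qed
  then have "(\<integral>\<^sup>+x. ennreal \<bar>x\<bar> \<partial>D) \<le> (\<Sum>n. ?m * emeasure (killed L C n) UNIV)"
    unfolding D_def by (subst nn_integral_exit_law[OF L C_borel(1)]) (simp, rule suminf_le[OF _ summableI summableI])
  also have "\<dots> = ?m * emeasure U UNIV"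
    using nn_integral_green[OF L C_borel(1), of "\<lambda>_. 1"] nn_integral_1_UNIV[OF sets_green]
      nn_integral_1_UNIV[OF finite_borel_sets[OF finite_borel_killed[OF L C_borel(1)]]] by (simp add: U_eq)
  also have "\<dots> < \<infinity>" by (rule mult_emeasure_finite[OF U m])
  finally show ?thesis .
qed

text \<open>The mean is nonzero in the direction of the drift, so already the first step exits
  strictly with positive probability. This is what makes \<open>p\<close> and \<open>p'\<close>
  positive.\<close>

lemma D_strict: "0 < emeasure D {x. s * x < 0}"
proof -
  note [measurable_cong] = L_sets
  have "0 < emeasure L {x. s * x < 0}"
  proof (rule ccontr)
    assume "\<not> 0 < emeasure L {x. s * x < 0}"
    then have "emeasure L {x. s * x < 0} = 0" by simp
    then have "AE x in L. 0 \<le> s * x"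
      using L_sets by (intro AE_I[of _ _ "{x. s * x < 0}"]) auto
    then have "0 \<le> (\<integral>x. s * x \<partial>L)" by (rule integral_nonneg_AE)
    then show False using drift by simp
  qed
  also have "emeasure L {x. s * x < 0} = (\<integral>\<^sup>+x. indicator {x. s * x < 0} x \<partial>exit_at L C 0)"
  proof -
    have "(\<integral>\<^sup>+x. indicator {x. s * x < 0} x \<partial>exit_at L C 0) = (\<integral>\<^sup>+x. transl L (\<lambda>x. indicator (- C) x * indicator {x. s * x < 0} x) x \<partial>return borel 0)"
      using nn_integral_exit_at[OF L C_borel(1), of "indicator {x. s * x < 0}" 0] by simp
    also have "(\<lambda>x. indicator (- C) x * indicator {x. s * x < 0} x :: ennreal) = indicator {x. s * x < 0}"
      by (auto simp: C_def split: split_indicator)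
    finally show ?thesis
      using L_sets measurable_transl[OF L, of "indicator {x. s * x < 0}"]
      by (simp add: nn_integral_return transl_def[of _ _ 0])
  qed
  also have "\<dots> \<le> (\<Sum>n. \<integral>\<^sup>+x. indicator {x. s * x < 0} x \<partial>exit_at L C n)"
    using sum_le_suminf[OF summableI, of "{0}" "\<lambda>n. \<integral>\<^sup>+x. indicator {x. s * x < 0} x \<partial>exit_at L C n"] by simp
  also have "\<dots> = emeasure D {x. s * x < 0}"
    unfolding D_def by (subst nn_integral_exit_law[OF L C_borel(1), symmetric]) simp_all
  finally show ?thesis .
qed

end

section \<open>Ladder heights\<close>

lemma (in prob_space) nn_integral_indep:
  assumes ind: "indep_var N Y K Z" and h: "h \<in> borel_measurable (N \<Otimes>\<^sub>M K)"
  shows "(\<integral>\<^sup>+\<omega>. h (Y \<omega>, Z \<omega>) \<partial>M) = (\<integral>\<^sup>+\<omega>. \<integral>\<^sup>+\<omega>'. h (Y \<omega>, Z \<omega>') \<partial>M \<partial>M)"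
proof -
  have rv: "random_variable N Y" "random_variable K Z"
    and eq: "distr M N Y \<Otimes>\<^sub>M distr M K Z = distr M (N \<Otimes>\<^sub>M K) (\<lambda>\<omega>. (Y \<omega>, Z \<omega>))"
    using ind by (auto simp: indep_var_distribution_eq)
  note [measurable] = rv h
  interpret Z: prob_space "distr M K Z" using rv(2) by (rule prob_space_distr)
  have "(\<integral>\<^sup>+\<omega>. h (Y \<omega>, Z \<omega>) \<partial>M) = (\<integral>\<^sup>+p. h p \<partial>distr M (N \<Otimes>\<^sub>M K) (\<lambda>\<omega>. (Y \<omega>, Z \<omega>)))"
    by (subst nn_integral_distr) measurable
  also have "\<dots> = (\<integral>\<^sup>+y. \<integral>\<^sup>+z. h (y, z) \<partial>distr M K Z \<partial>distr M N Y)"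
    unfolding eq[symmetric] by (rule Z.nn_integral_fst[symmetric]) measurable
  also have "\<dots> = (\<integral>\<^sup>+\<omega>. \<integral>\<^sup>+z. h (Y \<omega>, z) \<partial>distr M K Z \<partial>M)"
    by (rule nn_integral_distr) measurable
  also have "\<dots> = (\<integral>\<^sup>+\<omega>. \<integral>\<^sup>+\<omega>'. h (Y \<omega>, Z \<omega>') \<partial>M \<partial>M)"
    using rv by (intro nn_integral_cong nn_integral_distr) measurable
  finally show ?thesis .
qed

text \<open>Reindexing along \<open>Inl\<close> and \<open>Inr\<close> extracts the independence of
  either sequence from that of the joint family.\<close>

lemma (in prob_space) indep_vars_comp_inj:
  assumes ind: "indep_vars (\<lambda>_. N) Y (f ` I)" and inj: "inj_on f I"
  shows "indep_vars (\<lambda>_. N) (\<lambda>i. Y (f i)) I"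
proof -
  have rv: "\<And>i. i \<in> I \<Longrightarrow> random_variable N (Y (f i))"
    and sets: "indep_sets (\<lambda>i. {Y i -` A \<inter> space M | A. A \<in> sets N}) (f ` I)"
    using ind unfolding indep_vars_def2 by auto
  have "prob (\<Inter>j\<in>J. A j) = (\<Prod>j\<in>J. prob (A j))"
    if J: "J \<subseteq> I" "J \<noteq> {}" "finite J" and A: "A \<in> Pi J (\<lambda>i. {Y (f i) -` A \<inter> space M | A. A \<in> sets N})" for J A
  proof -
    have injJ: "inj_on f J" using inj J(1) by (rule inj_on_subset)
    let ?A = "\<lambda>k. A (the_inv_into J f k)"
    have inv: "the_inv_into J f (f j) = j" if "j \<in> J" for j using the_inv_into_f_f[OF injJ that] .
    have "?A \<in> Pi (f ` J) (\<lambda>i. {Y i -` A \<inter> space M | A. A \<in> sets N})"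
      using A inv by (auto simp: Pi_iff)
    moreover have "f ` J \<subseteq> f ` I" "f ` J \<noteq> {}" "finite (f ` J)" using J by auto
    ultimately have "prob (\<Inter>j\<in>f ` J. ?A j) = (\<Prod>j\<in>f ` J. prob (?A j))"
      using sets unfolding indep_sets_def by blast
    then show ?thesis using inv by (simp add: prod.reindex[OF injJ] cong: INF_cong prod.cong)
  qed
  moreover have "{Y (f i) -` A \<inter> space M | A. A \<in> sets N} \<subseteq> events" if "i \<in> I" for i
    using measurable_sets[OF rv[OF that]] by blast
  ultimately show ?thesis
    unfolding indep_vars_def2 indep_sets_def by (intro conjI ballI allI impI rv) simp_all
qed

lemma walk_0 [simp]: "walk X 0 \<omega> = 0"
  by (simp add: walk_def)

locale iid_walk = prob_space M for M :: "'a measure" +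
  fixes X :: "nat \<Rightarrow> 'a \<Rightarrow> real" and L :: "real measure"
  assumes indep: "indep_vars (\<lambda>_. borel) X {1..}"
    and ident: "\<And>n. n \<ge> 1 \<Longrightarrow> distr M borel (X n) = L"
begin

lemma X_measurable: "n \<ge> 1 \<Longrightarrow> X n \<in> borel_measurable M"
  using indep by (simp add: indep_vars_def)

lemma walk_measurable [measurable]: "walk X n \<in> borel_measurable M"
  unfolding walk_def using X_measurable by (intro borel_measurable_sum) auto

lemma L_prob: "prob_space L"
  using prob_space_distr[OF X_measurable[of 1]] ident[of 1] by simp

lemma L_sets: "sets L = sets borel"
  using ident[of 1] by auto

lemma L: "finite_borel L"
  using L_sets prob_space.finite_measure[OF L_prob] by (simp add: finite_borel_def)

text \<open>Markov property at time \<open>n\<close>: the event depends on the first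
  \<open>n\<close> increments only, so the next one can be integrated out.\<close>

lemma nn_integral_walk_step:
  assumes I[measurable]: "I \<in> sets borel" and g[measurable]: "g \<in> borel_measurable borel"
  shows "(\<integral>\<^sup>+\<omega>. indicator {\<omega>. \<forall>k\<in>{1..n}. walk X k \<omega> \<notin> I} \<omega> * g (walk X (Suc n) \<omega>) \<partial>M)
    = (\<integral>\<^sup>+\<omega>. indicator {\<omega>. \<forall>k\<in>{1..n}. walk X k \<omega> \<notin> I} \<omega> * transl L g (walk X n \<omega>) \<partial>M)"
proof -
  define h :: "(nat \<Rightarrow> real) \<times> (nat \<Rightarrow> real) \<Rightarrow> ennreal" where
    "h p = indicator {w. \<forall>k\<in>{1..n}. (\<Sum>j=1..k. w j) \<notin> I} (fst p) * g ((\<Sum>j=1..n. fst p j) + snd p (Suc n))" for p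
  let ?Y = "\<lambda>\<omega>. restrict (\<lambda>i. X i \<omega>) {1..n}"
  let ?N = "PiM {1..n} (\<lambda>_. borel :: real measure)"
  let ?K = "PiM {Suc n} (\<lambda>_. borel :: real measure)" and ?Z = "\<lambda>\<omega>. restrict (\<lambda>i. X i \<omega>) {Suc n}"
  have ind: "indep_var ?N ?Y ?K ?Z"
    by (rule indep_var_restrict[OF indep]) auto
  have transl: "transl L g x = (\<integral>\<^sup>+\<omega>. g (x + X (Suc n) \<omega>) \<partial>M)" for x
    unfolding transl_def ident[of "Suc n", simplified, symmetric]
    using X_measurable[of "Suc n"] by (subst nn_integral_distr) auto
  have sum_meas: "(\<lambda>w. \<Sum>j=1..k. w j) \<in> borel_measurable ?N" if "k \<le> n" for k
    using that by (intro borel_measurable_sum measurable_component_singleton) auto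
  have [measurable]: "(\<lambda>w. \<Sum>j=1..n. w j) \<in> borel_measurable ?N" by (rule sum_meas) simp
  have "Measurable.pred ?N (\<lambda>w. (\<Sum>j=1..k. w j) \<notin> I)" if "k \<in> {1..n}" for k
  proof -
    have [measurable]: "(\<lambda>w. \<Sum>j=1..k. w j) \<in> borel_measurable ?N" using that by (intro sum_meas) simp
    show ?thesis by measurable
  qed
  then have [measurable]: "Measurable.pred ?N (\<lambda>w. \<forall>k\<in>{1..n}. (\<Sum>j=1..k. w j) \<notin> I)"
    by (intro pred_intros_finite) auto
  have [measurable]: "(\<lambda>w. w (Suc n)) \<in> borel_measurable ?K" by (rule measurable_component_singleton) simp
  have "h \<in> borel_measurable (?N \<Otimes>\<^sub>M ?K)"
    unfolding h_def indicator_def by measurable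
  then have "(\<integral>\<^sup>+\<omega>. h (?Y \<omega>, ?Z \<omega>) \<partial>M) = (\<integral>\<^sup>+\<omega>. \<integral>\<^sup>+\<omega>'. h (?Y \<omega>, ?Z \<omega>') \<partial>M \<partial>M)"
    by (rule nn_integral_indep[OF ind])
  also have "(\<lambda>\<omega>. h (?Y \<omega>, ?Z \<omega>)) = (\<lambda>\<omega>. indicator {\<omega>. \<forall>k\<in>{1..n}. walk X k \<omega> \<notin> I} \<omega> * g (walk X (Suc n) \<omega>))"
    by (auto simp: h_def walk_def fun_eq_iff split: split_indicator)
  also have "(\<lambda>\<omega>. \<integral>\<^sup>+\<omega>'. h (?Y \<omega>, ?Z \<omega>') \<partial>M) = (\<lambda>\<omega>. indicator {\<omega>. \<forall>k\<in>{1..n}. walk X k \<omega> \<notin> I} \<omega> * transl L g (walk X n \<omega>))"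
    by (auto simp: h_def walk_def fun_eq_iff transl split: split_indicator)
  finally show ?thesis .
qed

lemma nn_integral_walk_killed:
  assumes I: "I \<in> sets borel" and f: "f \<in> borel_measurable borel"
  shows "(\<integral>\<^sup>+\<omega>. indicator {\<omega>. \<forall>k\<in>{1..n}. walk X k \<omega> \<notin> I} \<omega> * f (walk X n \<omega>) \<partial>M) = (\<integral>\<^sup>+x. f x \<partial>killed L (- I) n)"
  using f
proof (induction n arbitrary: f)
  case 0
  then show ?case by (simp add: nn_integral_return emeasure_space_1)
next
  case (Suc n)
  note [measurable] = I Suc.prems
  have I': "- I \<in> sets borel" using I by auto
  have g: "(\<lambda>x. indicator (- I) x * f x) \<in> borel_measurable borel" using I' by measurable
  have "(\<integral>\<^sup>+\<omega>. indicator {\<omega>. \<forall>k\<in>{1..Suc n}. walk X k \<omega> \<notin> I} \<omega> * f (walk X (Suc n) \<omega>) \<partial>M) =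
    (\<integral>\<^sup>+\<omega>. indicator {\<omega>. \<forall>k\<in>{1..n}. walk X k \<omega> \<notin> I} \<omega> * (indicator (- I) (walk X (Suc n) \<omega>) * f (walk X (Suc n) \<omega>)) \<partial>M)"
    by (intro nn_integral_cong) (auto simp: atLeastAtMostSuc_conv split: split_indicator)
  also have "\<dots> = (\<integral>\<^sup>+x. transl L (\<lambda>x. indicator (- I) x * f x) x \<partial>killed L (- I) n)"
    using nn_integral_walk_step[OF I g, of n] Suc.IH[OF measurable_transl[OF L g]] by simp
  also have "\<dots> = (\<integral>\<^sup>+x. f x \<partial>killed L (- I) (Suc n))"
    by (rule nn_integral_killed_Suc[OF L I' Suc.prems, symmetric])
  finally show ?case .
qed

text \<open>The event of entering \<open>I\<close> is split according to the first entrance time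
  \<open>n + 1\<close>; the piece for \<open>n\<close> carries the law
  \<open>exit_at L (- I) n\<close>.\<close>

lemma ladder_law_eq_exit_law:
  assumes I[measurable]: "I \<in> sets borel"
  shows "ladder_law M X I = exit_law L (- I)"
proof -
  define E where "E = {\<omega> \<in> space M. \<exists>k\<ge>1. walk X k \<omega> \<in> I}"
  define S where "S \<omega> = walk X (Inf {k. 1 \<le> k \<and> walk X k \<omega> \<in> I}) \<omega>" for \<omega>
  define F where "F n B = {\<omega> \<in> space M. (\<forall>k\<in>{1..n}. walk X k \<omega> \<notin> I) \<and> walk X (Suc n) \<omega> \<in> I \<and> walk X (Suc n) \<omega> \<in> B}" for n B
  have I': "- I \<in> sets borel" using I by auto
  have E[measurable]: "E \<in> sets M" unfolding E_def by measurable
  have F[measurable]: "F n B \<in> sets M" if [measurable]: "B \<in> sets borel" for n B unfolding F_def by measurable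
  have first: "Inf {k. 1 \<le> k \<and> walk X k \<omega> \<in> I} = Suc n"
    if "\<forall>k\<in>{1..n}. walk X k \<omega> \<notin> I" "walk X (Suc n) \<omega> \<in> I" for n \<omega>
    using that by (intro cInf_eq_minimum) (auto simp: not_less_eq_eq[symmetric])
  \<comment> \<open>This decomposition also supplies the measurability of \<open>S\<close> on the
    event \<open>E\<close>, where alone the infimum is taken over a nonempty set.\<close>
  have union: "{\<omega> \<in> E. S \<omega> \<in> B} = (\<Union>n. F n B)" for B
  proof (intro set_eqI iffI)
    fix \<omega> assume w: "\<omega> \<in> {\<omega> \<in> E. S \<omega> \<in> B}"
    define m where "m = (LEAST k. 1 \<le> k \<and> walk X k \<omega> \<in> I)"
    have m: "1 \<le> m" "walk X m \<omega> \<in> I" "\<And>k. 1 \<le> k \<Longrightarrow> k < m \<Longrightarrow> walk X k \<omega> \<notin> I"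
      using w LeastI_ex[of "\<lambda>k. 1 \<le> k \<and> walk X k \<omega> \<in> I"] not_less_Least[of _ "\<lambda>k. 1 \<le> k \<and> walk X k \<omega> \<in> I"]
      by (auto simp: E_def m_def)
    then obtain n where n: "m = Suc n" by (cases m) auto
    have "S \<omega> = walk X (Suc n) \<omega>" unfolding S_def using m n by (subst first[of n]) auto
    then show "\<omega> \<in> (\<Union>n. F n B)" using w m n by (auto simp: F_def E_def intro!: exI[of _ n])
  next
    fix \<omega> assume "\<omega> \<in> (\<Union>n. F n B)"
    then obtain n where n: "\<omega> \<in> F n B" by auto
    then have "S \<omega> = walk X (Suc n) \<omega>" unfolding S_def F_def by (subst first[of n]) auto
    then show "\<omega> \<in> {\<omega> \<in> E. S \<omega> \<in> B}" using n by (auto simp: E_def F_def intro!: exI[of _ "Suc n"])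
  qed
  have disj: "disjoint_family (\<lambda>n. F n B)" for B
    unfolding disjoint_family_on_def F_def using first by auto
  have S: "S \<in> borel_measurable (restrict_space M E)"
  proof (rule measurableI)
    fix B :: "real set" assume B: "B \<in> sets borel"
    have "S -` B \<inter> space (restrict_space M E) = {\<omega> \<in> E. S \<omega> \<in> B}"
      by (auto simp: space_restrict_space E_def)
    then show "S -` B \<inter> space (restrict_space M E) \<in> sets (restrict_space M E)"
      using B by (subst sets_restrict_space_iff) (auto simp: union E_def[symmetric] E)
  qed simp
  show ?thesis
  proof (rule measure_eqI)
    show "sets (ladder_law M X I) = sets (exit_law L (- I))" by (simp add: ladder_law_def)
    fix B assume "B \<in> sets (ladder_law M X I)"
    then have B[measurable]: "B \<in> sets borel" by (simp add: ladder_law_def)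
    have "emeasure (ladder_law M X I) B = emeasure (restrict_space M E) (S -` B \<inter> space (restrict_space M E))"
      unfolding ladder_law_def E_def[symmetric] S_def[abs_def, symmetric]
      by (rule emeasure_distr[OF S[unfolded S_def[abs_def]] B, folded S_def])
    also have "S -` B \<inter> space (restrict_space M E) = (\<Union>n. F n B)"
      by (auto simp: space_restrict_space E_def union[symmetric])
    also have "emeasure (restrict_space M E) (\<Union>n. F n B) = emeasure M (\<Union>n. F n B)"
      using E by (intro emeasure_restrict_space) (auto simp: union[symmetric])
    also have "\<dots> = (\<Sum>n. emeasure M (F n B))"
      using disj by (intro suminf_emeasure[symmetric]) auto
    also have "\<dots> = (\<Sum>n. \<integral>\<^sup>+x. indicator B x \<partial>exit_at L (- I) n)"
    proof (rule suminf_cong)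
      fix n
      have "emeasure M (F n B) = (\<integral>\<^sup>+\<omega>. indicator {\<omega>. \<forall>k\<in>{1..n}. walk X k \<omega> \<notin> I} \<omega> * (indicator I (walk X (Suc n) \<omega>) * indicator B (walk X (Suc n) \<omega>)) \<partial>M)"
        unfolding nn_integral_indicator[OF F[OF B], symmetric]
        by (intro nn_integral_cong) (auto simp: F_def split: split_indicator)
      also have "\<dots> = (\<integral>\<^sup>+x. transl L (\<lambda>x. indicator I x * indicator B x) x \<partial>killed L (- I) n)"
        using nn_integral_walk_step[OF I, of "\<lambda>x. indicator I x * indicator B x" n]
          nn_integral_walk_killed[OF I measurable_transl[OF L], of "\<lambda>x. indicator I x * indicator B x" n] by simp
      also have "\<dots> = (\<integral>\<^sup>+x. indicator B x \<partial>exit_at L (- I) n)"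
        using nn_integral_exit_at[OF L I', of "indicator B" n] by simp
      finally show "emeasure M (F n B) = \<dots>" .
    qed
    also have "\<dots> = (\<integral>\<^sup>+x. indicator B x \<partial>exit_law L (- I))"
      by (rule nn_integral_exit_law[OF L I', symmetric]) simp
    also have "\<dots> = emeasure (exit_law L (- I)) B" by simp
    finally show "emeasure (ladder_law M X I) B = emeasure (exit_law L (- I)) B" .
  qed
qed

end

section \<open>Grids and their Haar measures\<close>

lemma grid_0 [simp]: "grid 0 = UNIV"
  by (simp add: grid_def)

lemma grid_pos: "u > 0 \<Longrightarrow> grid u = range (\<lambda>k::int. u * of_int k)"
  by (simp add: grid_def)

lemma zero_in_grid: "0 \<in> grid u"
  by (auto simp: grid_def intro: image_eqI[of _ _ 0])

lemma grid_add: "x \<in> grid u \<Longrightarrow> y \<in> grid u \<Longrightarrow> x + y \<in> grid u"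
  by (auto simp: grid_def simp flip: distrib_left of_int_add)

lemma grid_minus: "x \<in> grid u \<Longrightarrow> - x \<in> grid u"
proof -
  have "- (u * of_int k) = u * of_int (- k)" for k :: int by simp
  then have "- (u * of_int k) \<in> range (\<lambda>k. u * of_int k)" for k :: int
    by (rule range_eqI)
  then show "x \<in> grid u \<Longrightarrow> - x \<in> grid u"
    unfolding grid_def by (auto split: if_splits)
qed

lemma grid_diff: "x \<in> grid u \<Longrightarrow> y \<in> grid u \<Longrightarrow> x - y \<in> grid u"
  using grid_add[of x u "- y"] grid_minus[of y u] by simp

lemma grid_borel [measurable]: "grid u \<in> sets borel"
proof (cases "u = 0")
  case False
  then have "countable (grid u)" by (simp add: grid_def)
  then show ?thesis by (rule sets.countable[rotated]) simp
qed simp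

lemma closed_grid: "closed (grid u)"
proof (cases "u = 0")
  case False
  have "closed ((\<lambda>x. u * x) ` (\<int> :: real set))"
    using closed_scaling[OF closed_Ints[where 'a=real], of u] by (simp add: image_def)
  then show ?thesis using False by (simp add: grid_def Ints_def image_image)
qed simp

section \<open>Closed subgroups of the reals and the common span of two laws\<close>

lemma subgroup_of_int_mult:
  fixes T :: "real set"
  assumes diff: "\<And>x y. x \<in> T \<Longrightarrow> y \<in> T \<Longrightarrow> x - y \<in> T" and t: "t \<in> T"
  shows "of_int k * t \<in> T"
proof -
  have 0: "0 \<in> T" using diff[OF t t] by simp
  have neg: "- x \<in> T" if "x \<in> T" for x using diff[OF 0 that] by simp
  have nat: "of_nat n * t \<in> T" for n
  proof (induction n)
    case (Suc n)
    have "of_nat n * t - - t \<in> T" by (rule diff[OF Suc neg[OF t]])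
    then show ?case by (simp add: algebra_simps)
  qed (simp add: 0)
  show ?thesis
    using nat[of "nat k"] neg[OF nat[of "nat (- k)"]] by (cases "0 \<le> k") simp_all
qed

text \<open>Let u be the infimum of the positive elements. If u = 0, division with remainder by
  small elements makes the subgroup dense, hence everything. If u > 0, closedness puts u into the
  subgroup, and a remainder modulo u, being smaller than u, must vanish.\<close>

lemma closed_subgroup_real:
  fixes T :: "real set"
  assumes "closed T" and diff: "\<And>x y. x \<in> T \<Longrightarrow> y \<in> T \<Longrightarrow> x - y \<in> T" and t: "t \<in> T" "t \<noteq> 0"
  shows "T = UNIV \<or> (\<exists>u>0. T = grid u)"
proof -
  have mult: "of_int k * x \<in> T" if "x \<in> T" for k x
    by (rule subgroup_of_int_mult[OF diff that])
  define P where "P = {x \<in> T. 0 < x}"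
  have "\<bar>t\<bar> \<in> P" using t mult[OF t(1), of "-1"] by (auto simp: P_def abs_if)
  then have P: "P \<noteq> {}" "bdd_below P" by (auto simp: P_def intro: bdd_belowI[of _ 0])
  define u where "u = Inf P"
  have u0: "0 \<le> u" unfolding u_def using P by (intro cInf_greatest) (auto simp: P_def)
  have step: "x - of_int \<lfloor>x / v\<rfloor> * v \<in> {0..<v}" if "v > 0" for x v :: real
    using that floor_correct[of "x / v"] floor_divide_lower[of v x] floor_divide_upper[of v x] by (auto simp: algebra_simps)
  show ?thesis
  proof (cases "u = 0")
    case True
    have "x \<in> T" for x
    proof -
      have "\<exists>y\<in>T. dist y x < e" if "e > 0" for e
      proof -
        have "Inf P < e" using that True by (simp add: u_def)
        then obtain v where v: "v \<in> P" "v < e" using cInf_lessD[OF P(1)] by blast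
        then have "of_int \<lfloor>x / v\<rfloor> * v \<in> T" by (intro mult) (auto simp: P_def)
        then show ?thesis using step[of v x] v by (intro bexI) (auto simp: P_def dist_real_def)
      qed
      then show ?thesis using closure_approachable[of x T] \<open>closed T\<close> by (simp add: closure_closed)
    qed
    then show ?thesis by auto
  next
    case False
    then have u: "u > 0" using u0 by simp
    have "u \<in> closure P" unfolding u_def using P by (intro closure_contains_Inf)
    also have "closure P \<subseteq> T" using \<open>closed T\<close> by (intro closure_minimal) (auto simp: P_def)
    finally have uT: "u \<in> T" .
    have "x \<in> grid u" if "x \<in> T" for x
    proof -
      let ?r = "x - of_int \<lfloor>x / u\<rfloor> * u"
      have "?r \<in> T" using that uT by (intro diff mult)
      then have "?r \<in> P \<or> ?r = 0" using step[OF u, of x] by (auto simp: P_def)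
      moreover have "?r \<notin> P" using step[OF u, of x] cInf_lower[OF _ P(2), of ?r] by (auto simp: u_def)
      ultimately have "x = u * of_int \<lfloor>x / u\<rfloor>" by (simp add: mult.commute)
      then show ?thesis using u by (auto simp: grid_pos)
    qed
    moreover have "grid u \<subseteq> T" using u mult[OF uT] by (auto simp: grid_pos mult.commute)
    ultimately show ?thesis using u by blast
  qed
qed

lemma AE_iff_measure_1:
  assumes "prob_space L" "B \<in> sets L"
  shows "measure L B = 1 \<longleftrightarrow> (AE x in L. x \<in> B)"
  using prob_space.prob_eq_1[OF assms] by simp

text \<open>The point is that the maximum behind \<open>GREATEST\<close> exists. If some u0 > 0 is
  admissible, then \<open>L\<close> lives on a countable grid and is not concentrated at 0, so it
  has an atom x0 other than 0. Every positive admissible u has the form \<bar>x0\<bar> / n, and only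
  finitely many of these are at least u0.\<close>

lemma grid_span_props:
  assumes L: "prob_space L" "sets L = sets borel" and L': "prob_space L'" "sets L' = sets borel"
    and nz: "\<not> (AE x in L. x = 0)"
  defines "d \<equiv> grid_span L L'"
  shows "0 \<le> d" "AE x in L. x \<in> grid d" "AE x in L'. x \<in> grid d"
    "\<And>u. 0 \<le> u \<Longrightarrow> (AE x in L. x \<in> grid u) \<Longrightarrow> (AE x in L'. x \<in> grid u) \<Longrightarrow> u \<le> d"
proof -
  define V where "V u \<longleftrightarrow> 0 \<le> u \<and> measure L (grid u) * measure L' (grid u) = 1" for u
  have V: "V u \<longleftrightarrow> 0 \<le> u \<and> (AE x in L. x \<in> grid u) \<and> (AE x in L'. x \<in> grid u)" for u
  proof -
    have a: "0 \<le> measure L (grid u)" "measure L (grid u) \<le> 1" "0 \<le> measure L' (grid u)" "measure L' (grid u) \<le> 1"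
      using L L' by (auto intro: prob_space.prob_le_1)
    have "measure L (grid u) * measure L' (grid u) = 1 \<longleftrightarrow> measure L (grid u) = 1 \<and> measure L' (grid u) = 1"
      using a mult_left_le[of "measure L' (grid u)" "measure L (grid u)"] mult_right_le_one_le[of "measure L' (grid u)" "measure L (grid u)"]
      by (auto simp: mult.commute)
    then show ?thesis unfolding V_def using AE_iff_measure_1[OF L(1), of "grid u"] AE_iff_measure_1[OF L'(1), of "grid u"] L L' by simp
  qed
  have "\<exists>m. V m \<and> (\<forall>u. V u \<longrightarrow> u \<le> m)"
  proof (cases "\<exists>u>0. V u")
    case False
    then show ?thesis using V[of 0] by (intro exI[of _ 0]) (auto simp: not_less)
  next
    case True
    then obtain u0 where u0: "u0 > 0" "V u0" by auto
    have "\<exists>x. x \<noteq> 0 \<and> measure L {x} > 0"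
    proof (rule ccontr)
      assume "\<not> ?thesis"
      then have z: "emeasure L {x} = 0" if "x \<noteq> 0" for x
        using that prob_space.finite_measure[OF L(1)] by (auto simp: finite_measure.emeasure_eq_measure not_less measure_le_0_iff)
      have "(\<Union>x\<in>grid u0 - {0}. {x}) \<in> null_sets L"
        using u0 z L(2) by (intro null_sets_UN') (auto simp: grid_pos null_sets_def)
      then have "AE x in L. x \<notin> grid u0 - {0}" by (intro AE_not_in) simp
      moreover have "AE x in L. x \<in> grid u0" using u0 V by auto
      ultimately have "AE x in L. x = 0" by eventually_elim auto
      then show False using nz by simp
    qed
    then obtain x0 where x0: "x0 \<noteq> 0" "measure L {x0} > 0" by auto
    have div: "\<exists>n\<ge>1. u = \<bar>x0\<bar> / real n" if "V u" and u_pos: "u > 0" for u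
    proof -
      have "x0 \<in> grid u"
      proof (rule ccontr)
        assume "x0 \<notin> grid u"
        then have "AE x in L. x \<notin> {x0}" using that V by (auto elim!: eventually_mono)
        then have "emeasure L {x0} = 0" using L(2) by (subst (asm) AE_iff_null_sets[symmetric]) auto
        then show False using x0 by (simp add: measure_def)
      qed
      then obtain k where k: "x0 = u * of_int k" unfolding grid_pos[OF u_pos] by auto
      have "\<bar>x0\<bar> = u * real (nat \<bar>k\<bar>)" using k u_pos by (simp add: abs_mult)
      then show ?thesis using x0 k by (intro exI[of _ "nat \<bar>k\<bar>"]) (auto simp: field_simps)
    qed
    let ?W = "{u. V u \<and> u0 \<le> u}"
    have "?W \<subseteq> (\<lambda>n. \<bar>x0\<bar> / real n) ` {1..nat \<lceil>\<bar>x0\<bar> / u0\<rceil>}"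
    proof
      fix u assume u: "u \<in> ?W"
      then obtain n where n: "n \<ge> 1" "u = \<bar>x0\<bar> / real n" using div[of u] u0 by auto
      have "u0 * real n \<le> u * real n" using u by (intro mult_right_mono) auto
      then have "real n \<le> \<bar>x0\<bar> / u0" using n u0 by (simp add: pos_le_divide_eq mult.commute)
      then have "n \<le> nat \<lceil>\<bar>x0\<bar> / u0\<rceil>" by linarith
      then show "u \<in> (\<lambda>n. \<bar>x0\<bar> / real n) ` {1..nat \<lceil>\<bar>x0\<bar> / u0\<rceil>}" using n by auto
    qed
    then have fin: "finite ?W" by (rule finite_subset) simp
    have "?W \<noteq> {}" using u0 by auto
    then have "Max ?W \<in> ?W" using fin by (intro Max_in)
    moreover have "u \<le> Max ?W" if "V u" for u
    proof (cases "u0 \<le> u")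
      case True then show ?thesis using that fin by (intro Max_ge) auto
    next
      case False then show ?thesis using \<open>Max ?W \<in> ?W\<close> by auto
    qed
    ultimately show ?thesis by auto
  qed
  then obtain m where m: "V m" "\<And>u. V u \<Longrightarrow> u \<le> m" by auto
  have "d = m"
    unfolding d_def grid_span_def using m by (intro Greatest_equality) (auto simp: V_def)
  then show "0 \<le> d" "AE x in L. x \<in> grid d" "AE x in L'. x \<in> grid d"
    "\<And>u. 0 \<le> u \<Longrightarrow> (AE x in L. x \<in> grid u) \<Longrightarrow> (AE x in L'. x \<in> grid u) \<Longrightarrow> u \<le> d"
    using m V by auto
qed

section \<open>Haar measure on a grid\<close>

lemma sets_grid_haar [simp]: "sets (grid_haar d) = sets borel"
  by (simp add: grid_haar_def)

lemma space_grid_haar [simp]: "space (grid_haar d) = UNIV"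
  using sets_eq_imp_space_eq[OF sets_grid_haar] by simp

lemma nn_integral_grid_haar:
  assumes d: "d > 0" and f: "f \<in> borel_measurable borel"
  shows "(\<integral>\<^sup>+x. f x \<partial>grid_haar d) = ennreal d * (\<integral>\<^sup>+k. f (d * of_int k) \<partial>count_space UNIV)"
  using d f by (simp add: grid_haar_def nn_integral_scale_measure nn_integral_distr)

lemma nn_integral_grid_haar_shift:
  assumes d: "d \<ge> 0" and f[measurable]: "f \<in> borel_measurable borel" and t: "t \<in> grid d"
  shows "(\<integral>\<^sup>+x. f (x + t) \<partial>grid_haar d) = (\<integral>\<^sup>+x. f x \<partial>grid_haar d)"
proof (cases "d = 0")
  case True
  have "(\<integral>\<^sup>+x. f x \<partial>lborel) = (\<integral>\<^sup>+x. f x \<partial>distr lborel borel ((+) t))"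
    by (simp add: lborel_distr_plus)
  also have "\<dots> = (\<integral>\<^sup>+x. f (x + t) \<partial>lborel)"
    by (subst nn_integral_distr) (auto simp: add.commute)
  finally show ?thesis using True by (simp add: grid_haar_def)
next
  case False
  then have d: "d > 0" using d by simp
  then obtain m where m: "t = d * of_int m" using t by (auto simp: grid_pos)
  have "(\<integral>\<^sup>+k. f (d * of_int (k + m)) \<partial>count_space UNIV) = (\<integral>\<^sup>+k. f (d * of_int k) \<partial>count_space UNIV)"
    by (rule nn_integral_bij_count_space[of "\<lambda>k. k + m" UNIV UNIV "\<lambda>k. f (d * of_int k)"])
       (auto simp: bij_betw_def inj_on_def intro: image_eqI[of _ _ "k - m" for k])
  then show ?thesis
    using d by (simp add: nn_integral_grid_haar m distrib_left)
qed

lemma nn_integral_grid_haar_uminus: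
  assumes d: "d \<ge> 0" and f[measurable]: "f \<in> borel_measurable borel"
  shows "(\<integral>\<^sup>+x. f (- x) \<partial>grid_haar d) = (\<integral>\<^sup>+x. f x \<partial>grid_haar d)"
proof (cases "d = 0")
  case True
  have "(\<integral>\<^sup>+x. f x \<partial>lborel) = (\<integral>\<^sup>+x. f x \<partial>distr lborel borel uminus)"
    by (simp add: lborel_distr_uminus)
  also have "\<dots> = (\<integral>\<^sup>+x. f (- x) \<partial>lborel)"
    by (rule nn_integral_distr) auto
  finally show ?thesis using True by (simp add: grid_haar_def)
next
  case False
  then have d: "d > 0" using d by simp
  have "(\<integral>\<^sup>+k. f (d * of_int (- k)) \<partial>count_space UNIV) = (\<integral>\<^sup>+k. f (d * of_int k) \<partial>count_space UNIV)"
    by (rule nn_integral_bij_count_space[of uminus UNIV UNIV "\<lambda>k. f (d * of_int k)"]) (rule bij_uminus)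
  then show ?thesis
    using d by (simp add: nn_integral_grid_haar)
qed

lemma AE_grid_haar:
  assumes d: "d \<ge> 0" shows "AE x in grid_haar d. x \<in> grid d"
proof (cases "d = 0")
  case False
  then have d: "d > 0" using d by simp
  have "(\<integral>\<^sup>+x. indicator (- grid d) x \<partial>grid_haar d) = 0"
  proof (subst nn_integral_grid_haar[OF d])
    show "indicator (- grid d) \<in> borel_measurable borel" by (rule borel_measurable_indicator) measurable
    have "d * of_int k \<in> grid d" for k using d by (auto simp: grid_pos)
    then show "ennreal d * (\<integral>\<^sup>+k. indicator (- grid d) (d * of_int k) \<partial>count_space UNIV) = 0" by simp
  qed
  then have "emeasure (grid_haar d) (- grid d) = 0" by simp
  then show ?thesis by (intro AE_I[of _ _ "- grid d"]) auto
qed simp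

text \<open>For d > 0 the interval contains \<lfloor>y / d\<rfloor> grid points of weight d. Leaving
  out the origin keeps the total below y.\<close>

lemma emeasure_grid_haar_Ioc:
  assumes d: "d \<ge> 0" and y: "y \<ge> 0"
  shows "emeasure (grid_haar d) {0<..y} \<le> ennreal y"
proof (cases "d = 0")
  case True
  then show ?thesis using y by (simp add: grid_haar_def)
next
  case False
  then have d: "d > 0" using d by simp
  have "emeasure (grid_haar d) {0<..y} = (\<integral>\<^sup>+x. indicator {0<..y} x \<partial>grid_haar d)" by simp
  also have "\<dots> = ennreal d * (\<integral>\<^sup>+k. indicator {1..\<lfloor>y / d\<rfloor>} k \<partial>count_space UNIV)"
  proof (subst nn_integral_grid_haar[OF d], simp)
    have "indicator {0<..y} (d * of_int k) = (indicator {1..\<lfloor>y / d\<rfloor>} k :: ennreal)" for k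
      using d by (auto split: split_indicator simp: le_floor_iff field_simps zero_less_mult_iff)
    then show "ennreal d * (\<integral>\<^sup>+k. indicator {0<..y} (d * of_int k) \<partial>count_space UNIV) =
        ennreal d * (\<integral>\<^sup>+k. indicator {1..\<lfloor>y / d\<rfloor>} k \<partial>count_space UNIV)"
      by (simp only:)
  qed
  also have "\<dots> = ennreal d * of_nat (nat \<lfloor>y / d\<rfloor>)"
    by (simp add: emeasure_count_space)
  also have "\<dots> = ennreal (d * real (nat \<lfloor>y / d\<rfloor>))"
    using d by (simp add: ennreal_mult ennreal_of_nat_eq_real_of_nat)
  also have "\<dots> \<le> ennreal y"
  proof (rule ennreal_leI)
    have "real (nat \<lfloor>y / d\<rfloor>) = of_int \<lfloor>y / d\<rfloor>" using d y by simp
    also have "\<dots> \<le> y / d" by (rule of_int_floor_le)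
    finally show "d * real (nat \<lfloor>y / d\<rfloor>) \<le> y" using d by (simp add: field_simps)
  qed
  finally show ?thesis .
qed

lemma emeasure_grid_haar_Icc:
  assumes d: "d \<ge> 0"
  shows "emeasure (grid_haar d) {-r..r} < \<infinity>"
proof (cases "d = 0")
  case True
  then show ?thesis by (cases "r \<ge> 0") (simp_all add: grid_haar_def)
next
  case False
  then have d: "d > 0" using d by simp
  have "{k::int. \<bar>d * of_int k\<bar> \<le> r} \<subseteq> {-\<lceil>r / d\<rceil>..\<lceil>r / d\<rceil>}"
  proof
    fix k :: int assume "k \<in> {k. \<bar>d * of_int k\<bar> \<le> r}"
    then have "\<bar>of_int k :: real\<bar> \<le> r / d" using d by (simp add: abs_mult field_simps)
    then show "k \<in> {-\<lceil>r / d\<rceil>..\<lceil>r / d\<rceil>}" by simp linarith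
  qed
  then have fin: "finite {k::int. \<bar>d * of_int k\<bar> \<le> r}" by (rule finite_subset) simp
  have "emeasure (grid_haar d) {-r..r} = (\<integral>\<^sup>+x. indicator {-r..r} x \<partial>grid_haar d)" by simp
  also have "\<dots> = ennreal d * (\<integral>\<^sup>+k. indicator {k::int. \<bar>d * of_int k\<bar> \<le> r} k \<partial>count_space UNIV)"
  proof (subst nn_integral_grid_haar[OF d], simp)
    have "indicator {-r..r} (d * of_int k) = (indicator {k::int. \<bar>d * of_int k\<bar> \<le> r} k :: ennreal)" for k
      by (auto split: split_indicator)
    then show "ennreal d * (\<integral>\<^sup>+k. indicator {-r..r} (d * of_int k) \<partial>count_space UNIV) =
        ennreal d * (\<integral>\<^sup>+k. indicator {k::int. \<bar>d * of_int k\<bar> \<le> r} k \<partial>count_space UNIV)"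
      by (simp only:)
  qed
  also have "\<dots> < \<infinity>" using fin by (simp add: emeasure_count_space ennreal_mult_less_top of_nat_less_top)
  finally show ?thesis .
qed

lemma emeasure_grid_haar_Icc_pos:
  assumes d: "d \<ge> 0" and r: "r > 0"
  shows "0 < emeasure (grid_haar d) {-r..r}"
proof (cases "d = 0")
  case True
  then show ?thesis using r by (simp add: grid_haar_def)
next
  case False
  then have d: "d > 0" using d by simp
  have "ennreal d * (\<integral>\<^sup>+k. indicator {0} (k::int) \<partial>count_space UNIV) \<le> ennreal d * (\<integral>\<^sup>+k. indicator {-r..r} (d * of_int k) \<partial>count_space UNIV)"
    using r by (intro mult_left_mono nn_integral_mono) (auto split: split_indicator)
  also have "\<dots> = emeasure (grid_haar d) {-r..r}"
    using d nn_integral_grid_haar[of d "indicator {-r..r}"] by simp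
  finally show ?thesis using d by (auto intro: less_le_trans[of _ "ennreal d"])
qed

lemma sigma_finite_locally_finite:
  fixes N :: "real measure"
  assumes "sets N = sets borel" "\<And>r::real. emeasure N {-r..r} < \<infinity>"
  shows "sigma_finite_measure N"
proof
  have "x \<in> (\<Union>n. {- real n..real n})" for x :: real
  proof -
    obtain n where "\<bar>x\<bar> \<le> real n" using real_arch_simple by blast
    then show ?thesis by (intro UN_I[of n]) auto
  qed
  then show "\<exists>A. countable A \<and> A \<subseteq> sets N \<and> \<Union>A = space N \<and> (\<forall>a\<in>A. emeasure N a \<noteq> \<infinity>)"
    using assms sets_eq_imp_space_eq[OF assms(1)]
    by (intro exI[of _ "range (\<lambda>n::nat. {- real n..real n})"]) (auto simp: less_top)
qed

lemma sigma_finite_grid_haar: "d \<ge> 0 \<Longrightarrow> sigma_finite_measure (grid_haar d)"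
  by (intro sigma_finite_locally_finite emeasure_grid_haar_Icc) simp

text \<open>Restricting to bounded sets keeps Haar integrals and potentials of the test functions
  finite, as the cancellations demand.\<close>

lemma measure_eqI_bounded:
  fixes M N :: "real measure"
  assumes s: "sets M = sets borel" "sets N = sets borel"
    and eq: "\<And>B r. B \<in> sets borel \<Longrightarrow> emeasure M (B \<inter> {-r..r}) = emeasure N (B \<inter> {-r..r})"
  shows "M = N"
proof (rule measure_eqI)
  show "sets M = sets N" using s by simp
  fix B assume "B \<in> sets M"
  then have B: "B \<in> sets borel" using s by simp
  let ?B = "\<lambda>n::nat. B \<inter> {-real n..real n}"
  have un: "(\<Union>n. ?B n) = B"
  proof (intro equalityI subsetI)
    fix x assume "x \<in> B"
    obtain n where "\<bar>x\<bar> \<le> real n" using real_arch_simple by blast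
    then show "x \<in> (\<Union>n. ?B n)" using \<open>x \<in> B\<close> by (intro UN_I[of n]) auto
  qed auto
  have inc: "incseq ?B" by (auto simp: incseq_def)
  have "emeasure K B = (SUP n. emeasure K (?B n))" if "sets K = sets borel" for K :: "real measure"
  proof -
    have "range ?B \<subseteq> sets K" unfolding that using B by (intro image_subsetI sets.Int) simp_all
    then have "(SUP n. emeasure K (?B n)) = emeasure K (\<Union>n. ?B n)" by (rule SUP_emeasure_incseq[OF _ inc])
    then show ?thesis unfolding un by (rule sym)
  qed
  from this[OF s(1)] this[OF s(2)] show "emeasure M B = emeasure N B" by (simp only: eq[OF B])
qed

section \<open>The switching walk\<close>

lemma AE_exit_law_closed:
  assumes L: "finite_borel L" and C: "C \<in> sets borel" and S[measurable]: "S \<in> sets borel"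
    and LS: "AE x in L. x \<in> S" and S0: "0 \<in> S" and Sadd: "\<And>x y. x \<in> S \<Longrightarrow> y \<in> S \<Longrightarrow> x + y \<in> S"
  shows "AE x in green L C. x \<in> S" "AE x in exit_law L C. x \<in> S"
proof -
  have step: "transl L (\<lambda>x. indicator B x * indicator (- S) x) x = 0" if "x \<in> S" for x B
    unfolding transl_def
    by (rule nn_integral_eq_0I, rule eventually_mono[OF LS]) (auto simp: Sadd that)
  have killed: "AE x in killed L C n. x \<in> S" for n
  proof (induction n)
    case 0
    then show ?case using AE_killed_0[of L C] S0 by (auto elim!: eventually_mono)
  next
    case (Suc n)
    have G: "sets (killed L C (Suc n)) = sets borel" by (rule finite_borel_sets[OF finite_borel_killed[OF L C]])
    have "(\<integral>\<^sup>+x. indicator (- S) x \<partial>killed L C (Suc n)) = 0"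
      by (subst nn_integral_killed_Suc[OF L C], simp, rule nn_integral_eq_0I, rule eventually_mono[OF Suc step])
    then have "emeasure (killed L C (Suc n)) (- S) = 0" using G by (simp del: killed.simps)
    then show ?case using G by (intro AE_I[of _ _ "- S"]) (auto simp del: killed.simps)
  qed
  have "(\<integral>\<^sup>+x. indicator (- S) x \<partial>exit_at L C n) = 0" for n
    by (subst nn_integral_exit_at[OF L C], simp, rule nn_integral_eq_0I, rule eventually_mono[OF killed step])
  then have "(\<integral>\<^sup>+x. indicator (- S) x \<partial>exit_law L C) = 0"
    by (subst nn_integral_exit_law[OF L C]) simp_all
  then have "emeasure (exit_law L C) (- S) = 0" by simp
  then show "AE x in exit_law L C. x \<in> S" by (intro AE_I[of _ _ "- S"]) auto
  have "(\<integral>\<^sup>+x. indicator (- S) x \<partial>killed L C n) = 0" for n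
    by (rule nn_integral_eq_0I, rule eventually_mono[OF killed]) simp
  then have "(\<integral>\<^sup>+x. indicator (- S) x \<partial>green L C) = 0"
    by (subst nn_integral_green[OF L C]) simp_all
  then have "emeasure (green L C) (- S) = 0" by simp
  then show "AE x in green L C. x \<in> S" by (intro AE_I[of _ _ "- S"]) auto
qed

lemma measurable_emeasure_section:
  assumes F: "finite_borel F" and [measurable]: "Measurable.pred (borel \<Otimes>\<^sub>M borel) (\<lambda>p. P (fst p) (snd p))"
  shows "(\<lambda>x. measure F {y. P x y}) \<in> borel_measurable (borel :: real measure)"
proof -
  interpret sigma_finite_measure F using F by (rule finite_borel_sigma_finite)
  note [measurable_cong] = finite_borel_sets[OF F]
  have sec: "{y. P x y} \<in> sets F" for x
  proof -
    have "Measurable.pred borel (\<lambda>y. P (fst (x, y)) (snd (x, y)))" by measurable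
    then show ?thesis using finite_borel_sets[OF F] by (simp add: pred_def)
  qed
  have "(\<lambda>x. \<integral>\<^sup>+y. indicator {p. P (fst p) (snd p)} (x, y) \<partial>F) \<in> borel_measurable borel"
    unfolding indicator_def by measurable
  moreover have "(\<integral>\<^sup>+y. indicator {p. P (fst p) (snd p)} (x, y) \<partial>F) = emeasure F {y. P x y}" for x
  proof -
    have "(\<integral>\<^sup>+y. indicator {p. P (fst p) (snd p)} (x, y) \<partial>F) = (\<integral>\<^sup>+y. indicator {y. P x y} y \<partial>F)"
      by (intro nn_integral_cong) (simp split: split_indicator)
    then show ?thesis unfolding nn_integral_indicator[OF sec] .
  qed
  ultimately have "(\<lambda>x. emeasure F {y. P x y}) \<in> borel_measurable borel" by simp
  then show ?thesis unfolding measure_def by measurable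
qed

text \<open>Translation invariance moves \<open>F\<close> from the function to the weight:
  convolving Haar measure of density \<open>w\<close> with \<open>F\<close> again gives a density,
  the convolution of \<open>w\<close> with \<open>F\<close>.\<close>

lemma nn_integral_grid_haar_transl:
  assumes d: "d \<ge> 0" and F: "finite_borel F" and FZ: "AE y in F. y \<in> grid d"
    and w[measurable]: "w \<in> borel_measurable borel" and f[measurable]: "f \<in> borel_measurable borel"
  shows "(\<integral>\<^sup>+x. w x * transl F f x \<partial>grid_haar d) = (\<integral>\<^sup>+x. (\<integral>\<^sup>+y. w (x - y) \<partial>F) * f x \<partial>grid_haar d)"
proof -
  interpret F: sigma_finite_measure F using F by (rule finite_borel_sigma_finite)
  interpret H: sigma_finite_measure "grid_haar d" using d by (rule sigma_finite_grid_haar)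
  interpret pair_sigma_finite F "grid_haar d" ..
  note [measurable_cong] = finite_borel_sets[OF F] sets_grid_haar
  have "(\<integral>\<^sup>+x. w x * transl F f x \<partial>grid_haar d) = (\<integral>\<^sup>+x. \<integral>\<^sup>+y. w x * f (x + y) \<partial>F \<partial>grid_haar d)"
    unfolding transl_def by (intro nn_integral_cong nn_integral_cmult[symmetric]) measurable
  also have "\<dots> = (\<integral>\<^sup>+y. \<integral>\<^sup>+x. w x * f (x + y) \<partial>grid_haar d \<partial>F)"
    by (rule Fubini') measurable
  also have "\<dots> = (\<integral>\<^sup>+y. \<integral>\<^sup>+x. w (x - y) * f x \<partial>grid_haar d \<partial>F)"
  proof (rule nn_integral_cong_AE, rule eventually_mono[OF FZ])
    fix y assume "y \<in> grid d"
    from nn_integral_grid_haar_shift[OF d _ this, of "\<lambda>x. w (x - y) * f x"]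
    show "(\<integral>\<^sup>+x. w x * f (x + y) \<partial>grid_haar d) = (\<integral>\<^sup>+x. w (x - y) * f x \<partial>grid_haar d)"
      by simp
  qed
  also have "\<dots> = (\<integral>\<^sup>+x. \<integral>\<^sup>+y. w (x - y) * f x \<partial>F \<partial>grid_haar d)"
    by (rule Fubini'[symmetric]) measurable
  also have "\<dots> = (\<integral>\<^sup>+x. (\<integral>\<^sup>+y. w (x - y) \<partial>F) * f x \<partial>grid_haar d)"
    by (intro nn_integral_cong nn_integral_multc) measurable
  finally show ?thesis .
qed

lemma prob_trichotomy:
  fixes x :: real
  assumes N: "prob_space N" "sets N = sets borel"
  shows "measure N {..<x} + measure N {x} + measure N {x<..} = 1"
proof -
  interpret prob_space N by fact
  have s: "B \<in> sets borel \<Longrightarrow> B \<in> events" for B using N by simp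
  have "prob ({..<x} \<union> {x} \<union> {x<..}) = prob ({..<x} \<union> {x}) + prob {x<..}"
    by (rule finite_measure_Union) (auto intro!: s)
  also have "prob ({..<x} \<union> {x}) = prob {..<x} + prob {x}"
    by (rule finite_measure_Union) (auto intro!: s)
  also have "{..<x} \<union> {x} \<union> {x<..} = space N" using sets_eq_imp_space_eq[OF N(2)] by auto
  finally show ?thesis using prob_space by simp
qed

text \<open>In the notation of the statement, \<open>W.D\<close> and \<open>W.A\<close> are the laws
  of D and \<open>A\<^sub>s\<close>, while \<open>W'.D\<close> and \<open>W'.A\<close> are those of
  A' and D_s'. Accordingly \<open>W.U\<close> is U_+ and \<open>W'.U\<close> is U_-'.\<close>

locale switching_walk = W: drifting_walk L 1 + W': drifting_walk L' "- 1"
  for L L' :: "real measure" +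
  fixes \<alpha> :: real
  assumes \<alpha>: "0 \<le> \<alpha>" "\<alpha> \<le> 1"
begin

definition d where "d = grid_span L L'"
definition Z where "Z = grid d"
abbreviation haar where "haar \<equiv> grid_haar d"

lemma
  shows d_nonneg: "0 \<le> d" and L_grid: "AE x in L. x \<in> Z" and L'_grid: "AE x in L'. x \<in> Z"
    and d_max: "\<And>u. 0 \<le> u \<Longrightarrow> (AE x in L. x \<in> grid u) \<Longrightarrow> (AE x in L'. x \<in> grid u) \<Longrightarrow> u \<le> d"
    and L_nonzero: "\<not> (AE x in L. x = 0)"
proof -
  show nz: "\<not> (AE x in L. x = 0)"
  proof
    assume "AE x in L. x = 0"
    then have "(\<integral>x. x \<partial>L) = (\<integral>x. 0 \<partial>L)" using W.L_sets by (intro integral_cong_AE) (auto cong: measurable_cong_sets)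
    then show False using W.drift by simp
  qed
  from grid_span_props[OF W.L_prob W.L_sets W'.L_prob W'.L_sets nz]
  show "0 \<le> d" "AE x in L. x \<in> Z" "AE x in L'. x \<in> Z"
    "\<And>u. 0 \<le> u \<Longrightarrow> (AE x in L. x \<in> grid u) \<Longrightarrow> (AE x in L'. x \<in> grid u) \<Longrightarrow> u \<le> d"
    unfolding d_def Z_def by auto
qed

lemma Z_borel [measurable]: "Z \<in> sets borel"
  by (simp add: Z_def)

lemma Z_add: "x \<in> Z \<Longrightarrow> y \<in> Z \<Longrightarrow> x + y \<in> Z"
  by (simp add: Z_def grid_add)

lemma
  shows D_grid: "AE x in W.D. x \<in> Z" and D'_grid: "AE x in W'.D. x \<in> Z"
    and U_grid: "AE x in W.U. x \<in> Z" and U'_grid: "AE x in W'.U. x \<in> Z"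
proof -
  have 0: "0 \<in> Z" by (simp add: Z_def zero_in_grid)
  show "AE x in W.D. x \<in> Z" unfolding W.D_def by (rule AE_exit_law_closed(2)[OF W.L W.C_borel(1) Z_borel L_grid 0 Z_add])
  show "AE x in W'.D. x \<in> Z" unfolding W'.D_def by (rule AE_exit_law_closed(2)[OF W'.L W'.C_borel(1) Z_borel L'_grid 0 Z_add])
  show "AE x in W.U. x \<in> Z" unfolding W.U_eq by (rule AE_exit_law_closed(1)[OF W.L W.C_borel(1) Z_borel L_grid 0 Z_add])
  show "AE x in W'.U. x \<in> Z" unfolding W'.U_eq by (rule AE_exit_law_closed(1)[OF W'.L W'.C_borel(1) Z_borel L'_grid 0 Z_add])
qed

section \<open>The weight \<open>a\<close> and the density of \<nu>\<close>

definition p where "p = measure W.D {..<0}"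
definition p' where "p' = measure W'.D {0<..}"
text \<open>The share of the Haar atom at 0 that goes to \<open>w\<^sup>+\<close>. Relative to this
  atom, \<open>w\<^sup>+ * (\<delta> - A')\<close> has weight a p' at 0 and
  \<open>w\<^sup>- * (\<delta> - D)\<close> has (1 - a) p. They must stand in the proportion
  \<alpha> : 1 - \<alpha>, and (1 - \<alpha>) a p' = \<alpha> (1 - a) p has this solution.\<close>

definition a where "a = p * \<alpha> / (p * \<alpha> + p' * (1 - \<alpha>))"

lemma p_pos: "0 < p" and p'_pos: "0 < p'" and p_le: "p \<le> 1" and p'_le: "p' \<le> 1"
proof -
  have "0 < emeasure W.D {..<0}" using W.D_strict by (simp add: lessThan_def)
  then show "0 < p" unfolding p_def using finite_measure.emeasure_eq_measure[OF finite_borel_finite_measure[OF W.D]] by simp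
  have "0 < emeasure W'.D {0<..}" using W'.D_strict by (simp add: greaterThan_def)
  then show "0 < p'" unfolding p'_def using finite_measure.emeasure_eq_measure[OF finite_borel_finite_measure[OF W'.D]] by simp
  show "p \<le> 1" "p' \<le> 1" unfolding p_def p'_def using prob_space.prob_le_1 W.D_prob W'.D_prob by auto
qed

lemma denom_pos: "0 < p * \<alpha> + p' * (1 - \<alpha>)"
proof (cases "\<alpha> = 0")
  case False
  then show ?thesis using \<alpha> p_pos p'_pos by (intro add_pos_nonneg mult_pos_pos mult_nonneg_nonneg) auto
qed (use p'_pos in simp)

lemma a_bounds: "0 \<le> a" "a \<le> 1"
  using denom_pos \<alpha> p_pos p'_pos by (auto simp: a_def divide_le_eq_1)

definition dens where
  "dens x = measure W.D {..<x} + measure W'.D {x<..} - 1 + a * measure W.D {x} + (1 - a) * measure W'.D {x}"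

definition nu where "nu = nu_measure W.D W'.D \<alpha> d"

lemma nu_eq: "nu = density haar (\<lambda>x. ennreal (dens x))"
  by (simp add: nu_def nu_measure_def Let_def dens_def a_def p_def p'_def)

lemma dens_measurable [measurable]: "dens \<in> borel_measurable borel"
proof -
  have [measurable]: "(\<lambda>x. measure F {..<x}) \<in> borel_measurable borel" "(\<lambda>x. measure F {x<..}) \<in> borel_measurable borel"
    "(\<lambda>x. measure F {x}) \<in> borel_measurable borel" if F: "finite_borel F" for F
    using measurable_emeasure_section[OF F, of "\<lambda>x y. y < x"] measurable_emeasure_section[OF F, of "\<lambda>x y. x < y"]
      measurable_emeasure_section[OF F, of "\<lambda>x y. y = x"]
    by (simp_all add: lessThan_def greaterThan_def)
  show ?thesis unfolding dens_def using W.D W'.D by measurable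
qed

lemma D_measure:
  shows D_pos: "0 < x \<Longrightarrow> measure W.D {..<x} = 1" "0 < x \<Longrightarrow> measure W.D {x} = 0"
    and D_zero: "measure W.D {0} = 1 - p"
    and D_compl: "measure W.D {..<x} + measure W.D {x} + measure W.D {x<..} = 1"
proof -
  interpret D: prob_space W.D by (rule W.D_prob)
  have s: "B \<in> sets borel \<Longrightarrow> B \<in> D.events" for B using finite_borel_sets[OF W.D] by simp
  show compl: "measure W.D {..<x} + measure W.D {x} + measure W.D {x<..} = 1" for x
    using W.D_prob finite_borel_sets[OF W.D] by (rule prob_trichotomy)
  have "AE y in W.D. y \<notin> {0<..}" using W.AE_D by (auto elim!: eventually_mono)
  then have 0: "measure W.D {0<..} = 0"
    using s by (subst (asm) AE_iff_null_sets[symmetric]) (auto simp: measure_def)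
  have le: "measure W.D B = 0" if "B \<in> sets borel" "B \<subseteq> {0<..}" for B
    using D.finite_measure_mono[OF that(2)] s that 0 by (simp add: measure_le_0_iff)
  show "measure W.D {x} = 0" if "0 < x" using that by (intro le) auto
  with compl[of x] le[of "{x<..}"] show "measure W.D {..<x} = 1" if "0 < x" using that by (auto simp: subset_eq)
  show "measure W.D {0} = 1 - p" using compl[of 0] 0 by (simp add: p_def)
qed

lemma D'_measure:
  shows D'_neg: "x < 0 \<Longrightarrow> measure W'.D {x<..} = 1" "x < 0 \<Longrightarrow> measure W'.D {x} = 0"
    and D'_zero: "measure W'.D {0} = 1 - p'"
    and D'_compl: "measure W'.D {..<x} + measure W'.D {x} + measure W'.D {x<..} = 1"
proof -
  interpret D: prob_space W'.D by (rule W'.D_prob)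
  have s: "B \<in> sets borel \<Longrightarrow> B \<in> D.events" for B using finite_borel_sets[OF W'.D] by simp
  show compl: "measure W'.D {..<x} + measure W'.D {x} + measure W'.D {x<..} = 1" for x
    using W'.D_prob finite_borel_sets[OF W'.D] by (rule prob_trichotomy)
  have "AE y in W'.D. y \<notin> {..<0}" using W'.AE_D by (auto elim!: eventually_mono)
  then have 0: "measure W'.D {..<0} = 0"
    using s by (subst (asm) AE_iff_null_sets[symmetric]) (auto simp: measure_def)
  have le: "measure W'.D B = 0" if "B \<in> sets borel" "B \<subseteq> {..<0}" for B
    using D.finite_measure_mono[OF that(2)] s that 0 by (simp add: measure_le_0_iff)
  show "measure W'.D {x} = 0" if "x < 0" using that by (intro le) auto
  with compl[of x] le[of "{..<x}"] show "measure W'.D {x<..} = 1" if "x < 0" using that by (auto simp: subset_eq)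
  show "measure W'.D {0} = 1 - p'" using compl[of 0] 0 by (simp add: p'_def)
qed

lemma dens_zero: "\<alpha> * dens 0 = a * p'" "(1 - \<alpha>) * dens 0 = (1 - a) * p"
proof -
  have "dens 0 = p * (1 - a) + a * p'"
    unfolding dens_def D_zero D'_zero p_def[symmetric] p'_def[symmetric] by (simp add: algebra_simps)
  moreover have "p * (1 - a) = p * p' * (1 - \<alpha>) / (p * \<alpha> + p' * (1 - \<alpha>))"
    "a * p' = p * p' * \<alpha> / (p * \<alpha> + p' * (1 - \<alpha>))"
    using denom_pos by (simp_all add: a_def field_simps)
  moreover have "p * (1 - a) + a * p' = p * p' / (p * \<alpha> + p' * (1 - \<alpha>))"
    unfolding calculation(2,3) by (simp add: add_divide_distrib[symmetric] algebra_simps)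
  ultimately show "\<alpha> * dens 0 = a * p'" "(1 - \<alpha>) * dens 0 = (1 - a) * p"
    by (simp_all add: mult_ac)
qed

text \<open>Since D is nonpositive, only A' remains to the right of 0. The form is chosen to match
  \<open>w\<^sup>+ * (\<delta> - A')\<close>: 1 is the density of \<open>w\<^sup>+\<close>, and what
  is subtracted is that of \<open>w\<^sup>+ * A'\<close>.\<close>

lemma dens_pos: "0 < x \<Longrightarrow> dens x = 1 - measure W'.D {..<x} - a * measure W'.D {x}"
  using D'_compl[of x] by (simp add: dens_def D_pos algebra_simps)

lemma dens_neg: "x < 0 \<Longrightarrow> dens x = 1 - measure W.D {x<..} - (1 - a) * measure W.D {x}"
  using D_compl[of x] by (simp add: dens_def D'_neg algebra_simps)

lemma dens_nonneg: "0 \<le> dens x"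
proof -
  have u: "0 \<le> m \<Longrightarrow> b \<le> 1 \<Longrightarrow> b * m \<le> m" for b m :: real using mult_right_mono[of b 1 m] by simp
  consider "0 < x" | "x < 0" | "x = 0" by linarith
  then show ?thesis
  proof cases
    case 1
    then show ?thesis
      using u[OF measure_nonneg a_bounds(2), of W'.D "{x}"] D'_compl[of x] measure_nonneg[of W'.D "{x<..}"]
      unfolding dens_pos[OF 1] by linarith
  next
    case 2
    have "1 - a \<le> 1" using a_bounds by simp
    then show ?thesis
      using u[OF measure_nonneg, of "1 - a" W.D "{x}"] D_compl[of x] measure_nonneg[of W.D "{..<x}"]
      unfolding dens_neg[OF 2] by linarith
  next
    case 3
    have "dens 0 = a * p' + (1 - a) * p" using dens_zero by (simp add: algebra_simps)
    then show ?thesis using 3 a_bounds p_pos p'_pos by simp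
  qed
qed

text \<open>The half-line parts \<open>w\<^sup>+\<close>, \<open>w\<^sup>-\<close> of Haar measure and the weights of \<open>\<phi>\<^sub>\<alpha>\<^sup>+\<close>, \<open>\<phi>\<^sub>\<alpha>\<^sup>-\<close>.\<close>
definition wp :: "real \<Rightarrow> ennreal" where "wp x = ennreal (indicator {0<..} x + a * indicator {0} x)"
definition wm :: "real \<Rightarrow> ennreal" where "wm x = ennreal (indicator {..<0} x + (1 - a) * indicator {0} x)"
definition ip :: "real \<Rightarrow> ennreal" where "ip x = ennreal (indicator {0<..} x + \<alpha> * indicator {0} x)"
definition im :: "real \<Rightarrow> ennreal" where "im x = ennreal (indicator {..<0} x + (1 - \<alpha>) * indicator {0} x)"

lemma weights_measurable [measurable]:
  "wp \<in> borel_measurable borel" "wm \<in> borel_measurable borel"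
  "ip \<in> borel_measurable borel" "im \<in> borel_measurable borel"
  unfolding wp_def wm_def ip_def im_def by measurable

lemma weights_sum: "wp x + wm x = 1" "ip x + im x = 1"
  unfolding wp_def wm_def ip_def im_def using \<alpha> a_bounds
  by (subst ennreal_plus[symmetric]; auto split: split_indicator)+

text \<open>Densities of \<open>w\<^sup>+ * A'\<close> and \<open>w\<^sup>- * D\<close>. The atom
  terms stem from the weights a and 1 - a of the half-line parts at their common endpoint 0.\<close>

lemma nn_integral_wp:
  shows "(\<integral>\<^sup>+y. wp (x - y) \<partial>W'.D) = ennreal (measure W'.D {..<x} + a * measure W'.D {x})"
    and "(\<integral>\<^sup>+y. wm (x - y) \<partial>W.D) = ennreal (measure W.D {x<..} + (1 - a) * measure W.D {x})"
proof -
  note * = finite_measure.emeasure_eq_measure[OF finite_borel_finite_measure]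
  have "(\<integral>\<^sup>+y. wp (x - y) \<partial>W'.D) = (\<integral>\<^sup>+y. indicator {..<x} y + ennreal a * indicator {x} y \<partial>W'.D)"
    using a_bounds by (intro nn_integral_cong) (auto simp: wp_def split: split_indicator)
  also have "\<dots> = emeasure W'.D {..<x} + ennreal a * emeasure W'.D {x}"
    using finite_borel_sets[OF W'.D] by (subst nn_integral_add) (auto simp: nn_integral_cmult_indicator measurable_finite_borel[OF W'.D])
  finally show "(\<integral>\<^sup>+y. wp (x - y) \<partial>W'.D) = ennreal (measure W'.D {..<x} + a * measure W'.D {x})"
    using a_bounds by (simp add: *[OF W'.D] ennreal_mult)
  have "(\<integral>\<^sup>+y. wm (x - y) \<partial>W.D) = (\<integral>\<^sup>+y. indicator {x<..} y + ennreal (1 - a) * indicator {x} y \<partial>W.D)"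
    using a_bounds by (intro nn_integral_cong) (auto simp: wm_def split: split_indicator)
  also have "\<dots> = emeasure W.D {x<..} + ennreal (1 - a) * emeasure W.D {x}"
    using finite_borel_sets[OF W.D] by (subst nn_integral_add) (auto simp: nn_integral_cmult_indicator measurable_finite_borel[OF W.D])
  finally show "(\<integral>\<^sup>+y. wm (x - y) \<partial>W.D) = ennreal (measure W.D {x<..} + (1 - a) * measure W.D {x})"
    using a_bounds by (simp add: *[OF W.D] ennreal_mult)
qed

text \<open>Density form of \<open>N\<^sup>+ + w\<^sup>+ * A' = w\<^sup>+\<close> and
  \<open>N\<^sup>- + w\<^sup>- * D = w\<^sup>-\<close>. At 0 it holds by the choice of
  \<open>a\<close>; on the opposite half-line all terms vanish.\<close>

lemma dens_split:
  shows "ip x * ennreal (dens x) + ennreal (measure W'.D {..<x} + a * measure W'.D {x}) = wp x"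
    and "im x * ennreal (dens x) + ennreal (measure W.D {x<..} + (1 - a) * measure W.D {x}) = wm x"
proof -
  consider "0 < x" | "x < 0" | "x = 0" by linarith
  then show "ip x * ennreal (dens x) + ennreal (measure W'.D {..<x} + a * measure W'.D {x}) = wp x"
  proof cases
    case 1
    then show ?thesis using dens_nonneg[of x] a_bounds
      by (simp add: ip_def wp_def ennreal_plus[symmetric] dens_pos del: ennreal_plus)
  next
    case 2
    then show ?thesis using D'_compl[of x] by (simp add: ip_def wp_def D'_neg measure_nonneg add_nonneg_eq_0_iff)
  next
    case 3
    have "measure W'.D {..<0} = 0" using D'_compl[of 0] D'_zero by (simp add: p'_def)
    then show ?thesis using 3 dens_zero(1) dens_nonneg[of 0] a_bounds \<alpha> p'_le p'_pos
      by (simp add: ip_def wp_def D'_zero ennreal_mult[symmetric] ennreal_plus[symmetric] del: ennreal_plus) (simp add: algebra_simps)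
  qed
  consider "0 < x" | "x < 0" | "x = 0" by linarith
  then show "im x * ennreal (dens x) + ennreal (measure W.D {x<..} + (1 - a) * measure W.D {x}) = wm x"
  proof cases
    case 1
    then show ?thesis using D_compl[of x] by (simp add: im_def wm_def D_pos measure_nonneg add_nonneg_eq_0_iff)
  next
    case 2
    then show ?thesis using dens_nonneg[of x] a_bounds
      by (simp add: im_def wm_def ennreal_plus[symmetric] dens_neg del: ennreal_plus)
  next
    case 3
    have "measure W.D {0<..} = 0" using D_compl[of 0] D_zero by (simp add: p_def)
    then show ?thesis using 3 dens_zero(2) dens_nonneg[of 0] a_bounds \<alpha> p_le p_pos
      by (simp add: im_def wm_def D_zero ennreal_mult[symmetric] ennreal_plus[symmetric] del: ennreal_plus) (simp add: algebra_simps)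
  qed
qed

section \<open>The two parts of \<nu> and their balance equation\<close>

definition nu_plus where "nu_plus = pos_part \<alpha> nu"
definition nu_minus where "nu_minus = neg_part \<alpha> nu"

lemma sets_nu [simp]: "sets nu = sets borel" "sets nu_plus = sets borel" "sets nu_minus = sets borel"
  by (simp_all add: nu_eq nu_plus_def nu_minus_def pos_part_def neg_part_def)

lemma nn_integral_part:
  assumes s: "sets N = sets borel" and f: "f \<in> borel_measurable borel"
  shows "(\<integral>\<^sup>+x. f x \<partial>pos_part \<alpha> N) = (\<integral>\<^sup>+x. ip x * f x \<partial>N)"
    and "(\<integral>\<^sup>+x. f x \<partial>neg_part \<alpha> N) = (\<integral>\<^sup>+x. im x * f x \<partial>N)"
proof -
  have m: "g \<in> borel_measurable borel \<Longrightarrow> g \<in> borel_measurable N" for g :: "real \<Rightarrow> ennreal"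
    using measurable_cong_sets[OF s refl] by blast
  show "(\<integral>\<^sup>+x. f x \<partial>pos_part \<alpha> N) = (\<integral>\<^sup>+x. ip x * f x \<partial>N)"
    unfolding pos_part_def ip_def[symmetric] by (rule nn_integral_density) (auto intro: m f)
  show "(\<integral>\<^sup>+x. f x \<partial>neg_part \<alpha> N) = (\<integral>\<^sup>+x. im x * f x \<partial>N)"
    unfolding neg_part_def im_def[symmetric] by (rule nn_integral_density) (auto intro: m f)
qed

lemma nn_integral_nu_parts:
  assumes f[measurable]: "f \<in> borel_measurable borel"
  shows "(\<integral>\<^sup>+x. f x \<partial>nu_plus) = (\<integral>\<^sup>+x. ip x * ennreal (dens x) * f x \<partial>haar)"
    and "(\<integral>\<^sup>+x. f x \<partial>nu_minus) = (\<integral>\<^sup>+x. im x * ennreal (dens x) * f x \<partial>haar)"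
proof -
  note [measurable_cong] = sets_grid_haar
  show "(\<integral>\<^sup>+x. f x \<partial>nu_plus) = (\<integral>\<^sup>+x. ip x * ennreal (dens x) * f x \<partial>haar)"
  proof -
    have "(\<integral>\<^sup>+x. f x \<partial>nu_plus) = (\<integral>\<^sup>+x. ip x * f x \<partial>nu)"
      unfolding nu_plus_def by (rule nn_integral_part(1)[OF sets_nu(1) f])
    then show ?thesis
      unfolding nu_eq by (subst (asm) nn_integral_density) (simp_all add: mult_ac)
  qed
  show "(\<integral>\<^sup>+x. f x \<partial>nu_minus) = (\<integral>\<^sup>+x. im x * ennreal (dens x) * f x \<partial>haar)"
  proof -
    have "(\<integral>\<^sup>+x. f x \<partial>nu_minus) = (\<integral>\<^sup>+x. im x * f x \<partial>nu)"
      unfolding nu_minus_def by (rule nn_integral_part(2)[OF sets_nu(1) f])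
    then show ?thesis
      unfolding nu_eq by (subst (asm) nn_integral_density) (simp_all add: mult_ac)
  qed
qed

lemma nu_parts_haar:
  assumes f[measurable]: "f \<in> borel_measurable borel"
  shows "(\<integral>\<^sup>+x. f x \<partial>nu_plus) + (\<integral>\<^sup>+x. wp x * transl W'.D f x \<partial>haar) = (\<integral>\<^sup>+x. wp x * f x \<partial>haar)"
    and "(\<integral>\<^sup>+x. f x \<partial>nu_minus) + (\<integral>\<^sup>+x. wm x * transl W.D f x \<partial>haar) = (\<integral>\<^sup>+x. wm x * f x \<partial>haar)"
proof -
  note [measurable_cong] = sets_grid_haar
  have m: "(\<lambda>x. \<integral>\<^sup>+y. w (x - y) \<partial>F) \<in> borel_measurable haar"
    if [measurable]: "w \<in> borel_measurable borel" and F: "finite_borel F" for F w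
  proof -
    interpret sigma_finite_measure F using F by (rule finite_borel_sigma_finite)
    note [measurable_cong] = finite_borel_sets[OF F]
    show ?thesis by measurable
  qed
  note [measurable] = m[OF weights_measurable(1) W'.D, unfolded nn_integral_wp] m[OF weights_measurable(2) W.D, unfolded nn_integral_wp]
  show "(\<integral>\<^sup>+x. f x \<partial>nu_plus) + (\<integral>\<^sup>+x. wp x * transl W'.D f x \<partial>haar) = (\<integral>\<^sup>+x. wp x * f x \<partial>haar)"
    unfolding nn_integral_nu_parts[OF f] nn_integral_grid_haar_transl[OF d_nonneg W'.D D'_grid[unfolded Z_def] weights_measurable(1) f] nn_integral_wp
    by (subst nn_integral_add[symmetric]) (auto simp: distrib_right[symmetric] dens_split)
  show "(\<integral>\<^sup>+x. f x \<partial>nu_minus) + (\<integral>\<^sup>+x. wm x * transl W.D f x \<partial>haar) = (\<integral>\<^sup>+x. wm x * f x \<partial>haar)"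
    unfolding nn_integral_nu_parts[OF f] nn_integral_grid_haar_transl[OF d_nonneg W.D D_grid[unfolded Z_def] weights_measurable(2) f] nn_integral_wp
    by (subst nn_integral_add[symmetric]) (auto simp: distrib_right[symmetric] dens_split)
qed

lemma haar_transl:
  assumes f[measurable]: "f \<in> borel_measurable borel"
  shows "(\<integral>\<^sup>+x. transl W.D f x \<partial>haar) = (\<integral>\<^sup>+x. f x \<partial>haar)" "(\<integral>\<^sup>+x. transl W'.D f x \<partial>haar) = (\<integral>\<^sup>+x. f x \<partial>haar)"
  using nn_integral_grid_haar_transl[OF d_nonneg W.D D_grid[unfolded Z_def], of "\<lambda>_. 1" f] W.D1 finite_borel_space[OF W.D]
    nn_integral_grid_haar_transl[OF d_nonneg W'.D D'_grid[unfolded Z_def], of "\<lambda>_. 1" f] W'.D1 finite_borel_space[OF W'.D]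
  by simp_all

lemma haar_weights:
  assumes [measurable]: "f \<in> borel_measurable borel"
  shows "(\<integral>\<^sup>+x. wp x * f x \<partial>haar) + (\<integral>\<^sup>+x. wm x * f x \<partial>haar) = (\<integral>\<^sup>+x. f x \<partial>haar)"
proof -
  note [measurable_cong] = sets_grid_haar
  show ?thesis by (subst nn_integral_add[symmetric]) (auto simp: distrib_right[symmetric] weights_sum)
qed

text \<open>In signed form, \<open>N\<^sup>+ * (\<delta> - D) + N\<^sup>- * (\<delta> - A')\<close>
  equals \<open>(w\<^sup>+ + w\<^sup>-) * (\<delta> - A') * (\<delta> - D)\<close>, and this is 0
  because the two weights add up to Haar measure, which D and A' preserve.\<close>

lemma nu_balance:
  assumes f: "f \<in> borel_measurable borel" and fin: "(\<integral>\<^sup>+x. f x \<partial>haar) < \<infinity>"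
  shows "(\<integral>\<^sup>+x. transl W.D f x \<partial>nu_plus) + (\<integral>\<^sup>+x. transl W'.D f x \<partial>nu_minus) = (\<integral>\<^sup>+x. f x \<partial>nu_plus) + (\<integral>\<^sup>+x. f x \<partial>nu_minus)"
proof -
  let ?H = "\<lambda>g. \<integral>\<^sup>+x. g x \<partial>haar"
  have Df: "transl W.D f \<in> borel_measurable borel" "transl W'.D f \<in> borel_measurable borel"
    using W.D W'.D f by (auto intro: measurable_transl)
  define l where "l = ?H f"
  define w1 where "w1 = (\<integral>\<^sup>+x. wp x * transl W'.D (transl W.D f) x \<partial>haar)"
  define w2 where "w2 = (\<integral>\<^sup>+x. wm x * transl W'.D (transl W.D f) x \<partial>haar)"
  define w3 where "w3 = (\<integral>\<^sup>+x. wp x * transl W.D f x \<partial>haar)"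
  define w4 where "w4 = (\<integral>\<^sup>+x. wm x * transl W'.D f x \<partial>haar)"
  define w5 where "w5 = (\<integral>\<^sup>+x. wp x * transl W'.D f x \<partial>haar)"
  define w6 where "w6 = (\<integral>\<^sup>+x. wm x * transl W.D f x \<partial>haar)"
  define w7 where "w7 = (\<integral>\<^sup>+x. wp x * f x \<partial>haar)"
  define w8 where "w8 = (\<integral>\<^sup>+x. wm x * f x \<partial>haar)"
  define a1 where "a1 = (\<integral>\<^sup>+x. transl W.D f x \<partial>nu_plus)"
  define a2 where "a2 = (\<integral>\<^sup>+x. transl W'.D f x \<partial>nu_minus)"
  define b1 where "b1 = (\<integral>\<^sup>+x. f x \<partial>nu_plus)"
  define b2 where "b2 = (\<integral>\<^sup>+x. f x \<partial>nu_minus)"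
  note defs = w1_def w2_def w3_def w4_def w5_def w6_def w7_def w8_def a1_def a2_def b1_def b2_def l_def
  have e: "a1 + w1 = w3" "a2 + w2 = w4" "b1 + w5 = w7" "b2 + w6 = w8"
    unfolding defs using nu_parts_haar(1)[OF Df(1)] nu_parts_haar(2)[OF Df(2)] nu_parts_haar[OF f]
    by (simp_all add: transl_commute[OF W.D W'.D f])
  have s: "w1 + w2 = l" "w3 + w6 = l" "w5 + w4 = l" "w7 + w8 = l"
    unfolding defs using haar_weights[OF measurable_transl[OF W'.D Df(1)]] haar_weights[OF Df(1)] haar_weights[OF Df(2)] haar_weights[OF f]
    by (simp_all add: haar_transl f Df)
  \<comment> \<open>All that will be cancelled is dominated by the Haar integral of
    \<open>f\<close>, which is finite by assumption.\<close>
  have lfin: "l + w5 + w6 \<noteq> \<top>"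
  proof -
    have "w5 \<le> l" by (subst s(3)[symmetric]) simp
    moreover have "w6 \<le> l" by (subst s(2)[symmetric]) simp
    ultimately show ?thesis using fin unfolding l_def[symmetric] by (auto simp: top_unique)
  qed
  \<comment> \<open>Each mixed term is completed by its partner from the opposite half-line to a
    full Haar integral.\<close>
  have "(a1 + a2) + (l + w5 + w6) = (a1 + w1) + (a2 + w2) + (w5 + w6)"
    unfolding s(1)[symmetric] by (simp add: ac_simps)
  also have "\<dots> = (w3 + w6) + (w5 + w4)" unfolding e by (simp add: ac_simps)
  also have "\<dots> = (w7 + w8) + l" unfolding s by simp
  also have "\<dots> = (b1 + b2) + (l + w5 + w6)" unfolding e[symmetric] by (simp add: ac_simps)
  finally have "(l + w5 + w6) + (a1 + a2) = (l + w5 + w6) + (b1 + b2)" by (simp only: add.commute)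
  then have "a1 + a2 = b1 + b2" using lfin by (simp only: ennreal_add_left_cancel infinity_ennreal_def simp_thms)
  then show ?thesis unfolding defs .
qed

end

section \<open>Existence\<close>

lemma nn_integral_1_finite_borelI:
  assumes "sets N = sets borel" "(\<integral>\<^sup>+x. 1 \<partial>N) < \<infinity>"
  shows "finite_borel N"
  using assms sets_eq_imp_space_eq[OF assms(1)]
  by (auto simp: finite_borel_def intro!: finite_measureI)

text \<open>Layer-cake estimate: after exchanging the integrals, the point y contributes the Haar
  measure of \<open>{0<..y}\<close>, which is at most \<bar>y\<bar>.\<close>

lemma nn_integral_haar_tail:
  assumes d: "d \<ge> 0" and F: "finite_borel F"
  shows "(\<integral>\<^sup>+x. indicator {0<..} x * emeasure F {x..} \<partial>grid_haar d) \<le> (\<integral>\<^sup>+y. ennreal \<bar>y\<bar> \<partial>F)"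
proof -
  interpret F: sigma_finite_measure F using F by (rule finite_borel_sigma_finite)
  interpret H: sigma_finite_measure "grid_haar d" using d by (rule sigma_finite_grid_haar)
  interpret pair_sigma_finite F "grid_haar d" ..
  note [measurable_cong] = finite_borel_sets[OF F] sets_grid_haar
  define h :: "real \<Rightarrow> real \<Rightarrow> ennreal" where "h x y = (if 0 < x \<and> x \<le> y then 1 else 0)" for x y
  have [measurable]: "case_prod h \<in> borel_measurable (borel \<Otimes>\<^sub>M borel)" unfolding h_def by measurable
  have "indicator {0<..} x * emeasure F {x..} = (\<integral>\<^sup>+y. h x y \<partial>F)" for x
  proof (cases "0 < x")
    case True
    have "(\<integral>\<^sup>+y. h x y \<partial>F) = (\<integral>\<^sup>+y. indicator {x..} y \<partial>F)"
      using True by (intro nn_integral_cong) (auto simp: h_def)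
    then show ?thesis using True finite_borel_sets[OF F] by simp
  qed (simp add: h_def)
  then have "(\<integral>\<^sup>+x. indicator {0<..} x * emeasure F {x..} \<partial>grid_haar d) = (\<integral>\<^sup>+x. \<integral>\<^sup>+y. h x y \<partial>F \<partial>grid_haar d)"
    by simp
  also have "\<dots> = (\<integral>\<^sup>+y. \<integral>\<^sup>+x. h x y \<partial>grid_haar d \<partial>F)"
    by (rule Fubini') measurable
  also have "\<dots> \<le> (\<integral>\<^sup>+y. ennreal \<bar>y\<bar> \<partial>F)"
  proof (rule nn_integral_mono)
    fix y
    have "(\<integral>\<^sup>+x. h x y \<partial>grid_haar d) = (\<integral>\<^sup>+x. indicator {0<..y} x \<partial>grid_haar d)"
      by (intro nn_integral_cong) (auto simp: h_def)
    also have "\<dots> \<le> ennreal \<bar>y\<bar>"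
      using emeasure_grid_haar_Ioc[OF d, of y] by (cases "0 \<le> y") simp_all
    finally show "(\<integral>\<^sup>+x. h x y \<partial>grid_haar d) \<le> ennreal \<bar>y\<bar>" .
  qed
  finally show ?thesis .
qed

lemma nn_integral_haar_tail':
  assumes d: "d \<ge> 0" and F: "finite_borel F"
  shows "(\<integral>\<^sup>+x. indicator {..<0} x * emeasure F {..x} \<partial>grid_haar d) \<le> (\<integral>\<^sup>+y. ennreal \<bar>y\<bar> \<partial>F)"
proof -
  note [measurable_cong] = finite_borel_sets[OF F]
  let ?F = "distr F borel uminus"
  have F': "finite_borel ?F"
    using finite_measure.finite_measure_distr[OF finite_borel_finite_measure[OF F], of uminus borel]
    by (simp add: finite_borel_def)
  interpret sigma_finite_measure F using F by (rule finite_borel_sigma_finite)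
  have [measurable]: "(\<lambda>x. emeasure F {..x}) \<in> borel_measurable borel"
  proof -
    have "(\<lambda>x. ennreal (measure F {y. y \<le> x})) \<in> borel_measurable borel"
      using measurable_emeasure_section[OF F, of "\<lambda>x y. y \<le> x"] by simp
    then show ?thesis
      by (simp add: finite_measure.emeasure_eq_measure[OF finite_borel_finite_measure[OF F]] atMost_def)
  qed
  have "(\<integral>\<^sup>+x. indicator {..<0} x * emeasure F {..x} \<partial>grid_haar d) =
      (\<integral>\<^sup>+x. indicator {..<0} (- x) * emeasure F {..- x} \<partial>grid_haar d)"
    by (rule nn_integral_grid_haar_uminus[OF d, symmetric]) measurable
  also have "\<dots> = (\<integral>\<^sup>+x. indicator {0<..} x * emeasure ?F {x..} \<partial>grid_haar d)"
  proof (rule nn_integral_cong)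
    fix x
    have "emeasure ?F {x..} = emeasure F (uminus -` {x..} \<inter> space F)"
      by (rule emeasure_distr) auto
    also have "uminus -` {x..} \<inter> space F = {..- x}" using finite_borel_space[OF F] by auto
    finally show "indicator {..<0} (- x) * emeasure F {..- x} = indicator {0<..} x * emeasure ?F {x..}"
      by (simp split: split_indicator)
  qed
  also have "\<dots> \<le> (\<integral>\<^sup>+y. ennreal \<bar>y\<bar> \<partial>?F)" by (rule nn_integral_haar_tail[OF d F'])
  also have "\<dots> = (\<integral>\<^sup>+y. ennreal \<bar>y\<bar> \<partial>F)"
    by (subst nn_integral_distr) auto
  finally show ?thesis .
qed

lemma emeasure_grid_haar_singleton: "d \<ge> 0 \<Longrightarrow> emeasure (grid_haar d) {0} < \<infinity>"
  using emeasure_grid_haar_Icc[of d 0] by simp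

text \<open>Subtraction-free substitution of m = n - p into t + n = u + p.\<close>

lemma ennreal_exchange:
  fixes m n p t u :: ennreal
  assumes "t + n = u + p" "p + m = n" "n \<noteq> \<top>"
  shows "t + m = u"
proof -
  have "n + (t + m) = (t + n) + m" by (simp add: ac_simps)
  also have "\<dots> = n + u" unfolding assms(1) by (subst assms(2)[symmetric]) (simp only: ac_simps)
  finally have "n + (t + m) = n + u" .
  then show ?thesis using assms(3) by (simp only: ennreal_add_left_cancel infinity_ennreal_def simp_thms)
qed

context switching_walk
begin

text \<open>To the right of 0 the density is at most P(A' \<ge> x), whose Haar integral is at most
  the mean of A'; to the left the same holds with D. The origin contributes a finite atom.\<close>

lemma finite_nu: "finite_borel nu_plus" "finite_borel nu_minus"
proof -
  note [measurable_cong] = sets_grid_haar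
  have meas: "(\<lambda>x. emeasure F {x..}) \<in> borel_measurable borel" "(\<lambda>x. emeasure F {..x}) \<in> borel_measurable borel"
    if F: "finite_borel F" for F
    using measurable_emeasure_section[OF F, of "\<lambda>x y. x \<le> y"] measurable_emeasure_section[OF F, of "\<lambda>x y. y \<le> x"]
    by (simp_all add: finite_measure.emeasure_eq_measure[OF finite_borel_finite_measure[OF F]] atMost_def atLeast_def)
  note [measurable] = meas[OF W.D] meas[OF W'.D]
  have pt: "ip x * ennreal (dens x) \<le> indicator {0<..} x * emeasure W'.D {x..} + ennreal (dens 0) * indicator {0} x"
    "im x * ennreal (dens x) \<le> indicator {..<0} x * emeasure W.D {..x} + ennreal (dens 0) * indicator {0} x" for x
  proof -
    interpret D: prob_space W.D by (rule W.D_prob)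
    interpret D': prob_space W'.D by (rule W'.D_prob)
    have s: "{x} \<in> D'.events" "{x<..} \<in> D'.events" "{x} \<in> D.events" "{..<x} \<in> D.events"
      using finite_borel_sets[OF W.D] finite_borel_sets[OF W'.D] by auto
    have D': "measure W'.D {x..} = measure W'.D {x} + measure W'.D {x<..}"
      unfolding ivl_disj_un_singleton(1)[of x, symmetric] by (rule D'.finite_measure_Union[OF s(1,2)]) auto
    have D: "measure W.D {..x} = measure W.D {..<x} + measure W.D {x}"
      unfolding ivl_disj_un_singleton(2)[of x, symmetric] by (rule D.finite_measure_Union[OF s(4,3)]) auto
    consider "0 < x" | "x < 0" | "x = 0" by linarith
    note cs = this
    show "ip x * ennreal (dens x) \<le> indicator {0<..} x * emeasure W'.D {x..} + ennreal (dens 0) * indicator {0} x"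
    proof (cases rule: cs)
      case 1
      have "0 \<le> a * D'.prob {x}" using a_bounds by simp
      then have "dens x \<le> measure W'.D {x..}" unfolding dens_pos[OF 1] D' using D'_compl[of x] by linarith
      then show ?thesis using 1 by (simp add: ip_def D'.emeasure_eq_measure ennreal_leI)
    next
      case 3
      have "ennreal \<alpha> * ennreal (dens 0) \<le> 1 * ennreal (dens 0)" using \<alpha> by (intro mult_right_mono) auto
      then show ?thesis using 3 by (simp add: ip_def)
    qed (simp add: ip_def)
    show "im x * ennreal (dens x) \<le> indicator {..<0} x * emeasure W.D {..x} + ennreal (dens 0) * indicator {0} x"
    proof (cases rule: cs)
      case 2
      have "0 \<le> (1 - a) * D.prob {x}" using a_bounds by simp
      then have "dens x \<le> measure W.D {..x}" unfolding dens_neg[OF 2] D using D_compl[of x] by linarith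
      then show ?thesis using 2 by (simp add: im_def D.emeasure_eq_measure ennreal_leI)
    next
      case 3
      have "ennreal (1 - \<alpha>) * ennreal (dens 0) \<le> 1 * ennreal (dens 0)" using \<alpha> by (intro mult_right_mono) auto
      then show ?thesis using 3 by (simp add: im_def)
    qed (simp add: im_def)
  qed
  have at0: "(\<integral>\<^sup>+x. ennreal (dens 0) * indicator {0} x \<partial>haar) < \<infinity>"
    using emeasure_grid_haar_singleton[OF d_nonneg] by (simp add: nn_integral_cmult_indicator ennreal_mult_less_top)
  have "(\<integral>\<^sup>+x. 1 \<partial>nu_plus) \<le> (\<integral>\<^sup>+x. indicator {0<..} x * emeasure W'.D {x..} + ennreal (dens 0) * indicator {0} x \<partial>haar)"
    by (subst nn_integral_nu_parts) (auto intro!: nn_integral_mono pt)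
  also have "\<dots> = (\<integral>\<^sup>+x. indicator {0<..} x * emeasure W'.D {x..} \<partial>haar) + (\<integral>\<^sup>+x. ennreal (dens 0) * indicator {0} x \<partial>haar)"
    by (rule nn_integral_add) measurable
  also have "\<dots> < \<infinity>"
    using at0 le_less_trans[OF nn_integral_haar_tail[OF d_nonneg W'.D] W'.D_mean] by simp
  finally show "finite_borel nu_plus" by (intro nn_integral_1_finite_borelI) simp_all
  have "(\<integral>\<^sup>+x. 1 \<partial>nu_minus) \<le> (\<integral>\<^sup>+x. indicator {..<0} x * emeasure W.D {..x} + ennreal (dens 0) * indicator {0} x \<partial>haar)"
    by (subst nn_integral_nu_parts) (auto intro!: nn_integral_mono pt)
  also have "\<dots> = (\<integral>\<^sup>+x. indicator {..<0} x * emeasure W.D {..x} \<partial>haar) + (\<integral>\<^sup>+x. ennreal (dens 0) * indicator {0} x \<partial>haar)"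
    by (rule nn_integral_add) measurable
  also have "\<dots> < \<infinity>"
    using at0 le_less_trans[OF nn_integral_haar_tail'[OF d_nonneg W.D] W.D_mean] by simp
  finally show "finite_borel nu_minus" by (intro nn_integral_1_finite_borelI) simp_all
qed

section \<open>The measure \<mu> and its splitting at the origin\<close>

definition mu where "mu = add_measure (convolution W.U nu_plus) (convolution W'.U nu_minus)"

lemma sets_mu [simp]: "sets mu = sets borel"
  by (simp add: mu_def)

lemma nn_integral_mu:
  assumes f: "f \<in> borel_measurable borel"
  shows "(\<integral>\<^sup>+x. f x \<partial>mu) = (\<integral>\<^sup>+x. transl W.U f x \<partial>nu_plus) + (\<integral>\<^sup>+x. transl W'.U f x \<partial>nu_minus)"
  unfolding mu_def
  by (subst nn_integral_add_measure)
     (simp_all add: f nn_integral_convolution_transl W.U W'.U finite_nu nn_integral_transl_commute)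

lemma finite_mu: "finite_borel mu"
proof (rule nn_integral_1_finite_borelI)
  have 1: "(\<integral>\<^sup>+x. transl W.U (\<lambda>_. 1) x \<partial>nu_plus) < \<infinity>"
    by (rule nn_integral_finite[OF finite_nu(1) transl_le_mult[OF W.U order_refl] mult_emeasure_finite[OF W.U]]) simp
  have 2: "(\<integral>\<^sup>+x. transl W'.U (\<lambda>_. 1) x \<partial>nu_minus) < \<infinity>"
    by (rule nn_integral_finite[OF finite_nu(2) transl_le_mult[OF W'.U order_refl] mult_emeasure_finite[OF W'.U]]) simp
  show "(\<integral>\<^sup>+x. 1 \<partial>mu) < \<infinity>"
    using 1 2 by (subst nn_integral_mu) simp_all
qed simp

lemma ip_eq: "0 < x \<Longrightarrow> ip x = 1" "x < 0 \<Longrightarrow> ip x = 0" "ip 0 = ennreal \<alpha>"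
  and im_eq: "0 < x \<Longrightarrow> im x = 0" "x < 0 \<Longrightarrow> im x = 1" "im 0 = ennreal (1 - \<alpha>)"
  by (simp_all add: ip_def im_def)

text \<open>By U = \<delta> + A * U, a start at x \<ge> 0 either stays at x or moves strictly to the
  right, where \<open>ip\<close> is 1 and \<open>im\<close> is 0. So only the term at x itself
  notices the weight.\<close>

lemma ip_transl:
  assumes x: "0 \<le> x" and f: "f \<in> borel_measurable borel"
  shows "transl W.U (\<lambda>x. ip x * f x) x + f x = transl W.U f x + ip x * f x"
    and "transl W.U (\<lambda>x. im x * f x) x = im x * f x"
proof -
  have 1: "transl W.A (transl W.U (\<lambda>x. ip x * f x)) x = transl W.A (transl W.U f) x"
    and 2: "transl W.A (transl W.U (\<lambda>x. im x * f x)) x = 0"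
  proof -
    have "(\<integral>\<^sup>+z. ip (x + y + z) * f (x + y + z) \<partial>W.U) = (\<integral>\<^sup>+z. f (x + y + z) \<partial>W.U)"
      and "(\<integral>\<^sup>+z. im (x + y + z) * f (x + y + z) \<partial>W.U) = 0" if "0 < 1 * y" for y
      by (rule nn_integral_cong_AE nn_integral_eq_0I, rule eventually_mono[OF W.AE_U], use x that in \<open>simp add: ip_eq im_eq\<close>)+
    note a12 = this
    show "transl W.A (transl W.U (\<lambda>x. ip x * f x)) x = transl W.A (transl W.U f) x"
      unfolding transl_def by (rule nn_integral_cong_AE, rule eventually_mono[OF W.AE_A], erule a12(1))
    show "transl W.A (transl W.U (\<lambda>x. im x * f x)) x = 0"
      unfolding transl_def by (rule nn_integral_eq_0I, rule eventually_mono[OF W.AE_A], erule a12(2))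
  qed
  have m: "(\<lambda>x. ip x * f x) \<in> borel_measurable borel" "(\<lambda>x. im x * f x) \<in> borel_measurable borel"
    using f by measurable
  show "transl W.U (\<lambda>x. ip x * f x) x + f x = transl W.U f x + ip x * f x"
    unfolding W.U_A[OF m(1), of x] W.U_A[OF f, of x] 1 by (simp add: ac_simps)
  show "transl W.U (\<lambda>x. im x * f x) x = im x * f x"
    unfolding W.U_A[OF m(2), of x] 2 by simp
qed

lemma im_transl:
  assumes x: "x \<le> 0" and f: "f \<in> borel_measurable borel"
  shows "transl W'.U (\<lambda>x. im x * f x) x + f x = transl W'.U f x + im x * f x"
    and "transl W'.U (\<lambda>x. ip x * f x) x = ip x * f x"
proof -
  have 1: "transl W'.A (transl W'.U (\<lambda>x. im x * f x)) x = transl W'.A (transl W'.U f) x"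
    and 2: "transl W'.A (transl W'.U (\<lambda>x. ip x * f x)) x = 0"
  proof -
    have "(\<integral>\<^sup>+z. im (x + y + z) * f (x + y + z) \<partial>W'.U) = (\<integral>\<^sup>+z. f (x + y + z) \<partial>W'.U)"
      and "(\<integral>\<^sup>+z. ip (x + y + z) * f (x + y + z) \<partial>W'.U) = 0" if "0 < - 1 * y" for y
      by (rule nn_integral_cong_AE nn_integral_eq_0I, rule eventually_mono[OF W'.AE_U], use x that in \<open>simp add: ip_eq im_eq\<close>)+
    note a12 = this
    show "transl W'.A (transl W'.U (\<lambda>x. im x * f x)) x = transl W'.A (transl W'.U f) x"
      unfolding transl_def by (rule nn_integral_cong_AE, rule eventually_mono[OF W'.AE_A], erule a12(1))
    show "transl W'.A (transl W'.U (\<lambda>x. ip x * f x)) x = 0"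
      unfolding transl_def by (rule nn_integral_eq_0I, rule eventually_mono[OF W'.AE_A], erule a12(2))
  qed
  have m: "(\<lambda>x. ip x * f x) \<in> borel_measurable borel" "(\<lambda>x. im x * f x) \<in> borel_measurable borel"
    using f by measurable
  show "transl W'.U (\<lambda>x. im x * f x) x + f x = transl W'.U f x + im x * f x"
    unfolding W'.U_A[OF m(2), of x] W'.U_A[OF f, of x] 1 by (simp add: ac_simps)
  show "transl W'.U (\<lambda>x. ip x * f x) x = ip x * f x"
    unfolding W'.U_A[OF m(1), of x] 2 by simp
qed

lemma AE_nu_plus: "AE x in nu_plus. 0 \<le> x \<and> x \<in> Z"
  and AE_nu_minus: "AE x in nu_minus. x \<le> 0 \<and> x \<in> Z"
proof -
  have Z: "AE x in haar. x \<in> Z" unfolding Z_def by (rule AE_grid_haar[OF d_nonneg])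
  have "(\<integral>\<^sup>+x. indicator (- {x. 0 \<le> x \<and> x \<in> Z}) x \<partial>nu_plus) = 0"
    by (subst nn_integral_nu_parts, measurable, rule nn_integral_eq_0I, rule eventually_mono[OF Z])
       (simp split: split_indicator add: ip_eq)
  then have "emeasure nu_plus (- {x. 0 \<le> x \<and> x \<in> Z}) = 0" by simp
  then show "AE x in nu_plus. 0 \<le> x \<and> x \<in> Z" by (intro AE_I[of _ _ "- {x. 0 \<le> x \<and> x \<in> Z}"]) auto
  have "(\<integral>\<^sup>+x. indicator (- {x. x \<le> 0 \<and> x \<in> Z}) x \<partial>nu_minus) = 0"
    by (subst nn_integral_nu_parts, measurable, rule nn_integral_eq_0I, rule eventually_mono[OF Z])
       (simp split: split_indicator add: im_eq)
  then have "emeasure nu_minus (- {x. x \<le> 0 \<and> x \<in> Z}) = 0" by simp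
  then show "AE x in nu_minus. x \<le> 0 \<and> x \<in> Z" by (intro AE_I[of _ _ "- {x. x \<le> 0 \<and> x \<in> Z}"]) auto
qed

lemma AE_mu: "AE x in mu. x \<in> Z"
proof -
  have "(\<integral>\<^sup>+x. transl W.U (indicator (- Z)) x \<partial>nu_plus) = 0"
    unfolding transl_def
    by (rule nn_integral_eq_0I, rule eventually_mono[OF AE_nu_plus], rule nn_integral_eq_0I, rule eventually_mono[OF U_grid]) (simp add: Z_add)
  moreover have "(\<integral>\<^sup>+x. transl W'.U (indicator (- Z)) x \<partial>nu_minus) = 0"
    unfolding transl_def
    by (rule nn_integral_eq_0I, rule eventually_mono[OF AE_nu_minus], rule nn_integral_eq_0I, rule eventually_mono[OF U'_grid]) (simp add: Z_add)
  ultimately have "(\<integral>\<^sup>+x. indicator (- Z) x \<partial>mu) = 0" by (subst nn_integral_mu) simp_all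
  then have "emeasure mu (- Z) = 0" by simp
  then show ?thesis by (intro AE_I[of _ _ "- Z"]) auto
qed

text \<open>The splitting of \<mu> at 0 recovers its two summands:
  \<open>\<mu>\<^sup>+ = U\<^sub>+ * N\<^sup>+\<close>, and similarly on the left. Strict ladder
  heights never return to 0, so the atoms of the summands at 0 are those of \<open>N\<^sup>+\<close>
  and \<open>N\<^sup>-\<close>. These add up to the atom of \<nu> and already have the proportion
  \<alpha> : 1 - \<alpha>.\<close>

lemma nn_integral_mu_parts:
  assumes f: "f \<in> borel_measurable borel" and fc: "\<And>x. f x \<le> c" "c < \<infinity>"
  shows "(\<integral>\<^sup>+x. ip x * f x \<partial>mu) = (\<integral>\<^sup>+x. transl W.U f x \<partial>nu_plus)"
    and "(\<integral>\<^sup>+x. im x * f x \<partial>mu) = (\<integral>\<^sup>+x. transl W'.U f x \<partial>nu_minus)"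
proof -
  have m[measurable]: "(\<lambda>x. ip x * f x) \<in> borel_measurable borel" "(\<lambda>x. im x * f x) \<in> borel_measurable borel"
    using f by measurable
  note f[measurable]
  have U: "transl W.U g \<in> borel_measurable nu_plus" "transl W'.U g \<in> borel_measurable nu_minus"
    "g \<in> borel_measurable nu_plus" "g \<in> borel_measurable nu_minus" "g \<in> borel_measurable nu"
    if "g \<in> borel_measurable borel" for g
    using that measurable_transl[OF W.U that] measurable_transl[OF W'.U that]
      measurable_finite_borel[OF finite_nu(1)] measurable_finite_borel[OF finite_nu(2)]
      measurable_cong_sets[OF sets_nu(1) refl] by blast+
  \<comment> \<open>Splitting \<open>N\<^sup>+\<close> and \<open>N\<^sup>-\<close> once more and
    collecting the right-hand parts gives back \<open>N\<^sup>+\<close>, because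
    \<open>ip * (ip + im) = ip\<close>.\<close>
  have split: "(\<integral>\<^sup>+x. ip x * f x \<partial>nu_plus) + (\<integral>\<^sup>+x. ip x * f x \<partial>nu_minus) = (\<integral>\<^sup>+x. f x \<partial>nu_plus)"
    "(\<integral>\<^sup>+x. im x * f x \<partial>nu_minus) + (\<integral>\<^sup>+x. im x * f x \<partial>nu_plus) = (\<integral>\<^sup>+x. f x \<partial>nu_minus)"
  proof -
    have "(\<integral>\<^sup>+x. ip x * f x \<partial>nu_plus) + (\<integral>\<^sup>+x. ip x * f x \<partial>nu_minus) = (\<integral>\<^sup>+x. ip x * (ip x * f x) + im x * (ip x * f x) \<partial>nu)"
      unfolding nu_plus_def nu_minus_def nn_integral_part[OF sets_nu(1) m(1)]
      by (rule nn_integral_add[symmetric]; rule U; measurable)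
    also have "\<dots> = (\<integral>\<^sup>+x. ip x * f x \<partial>nu)"
      by (simp add: distrib_right[symmetric] weights_sum)
    finally show "(\<integral>\<^sup>+x. ip x * f x \<partial>nu_plus) + (\<integral>\<^sup>+x. ip x * f x \<partial>nu_minus) = (\<integral>\<^sup>+x. f x \<partial>nu_plus)"
      unfolding nu_plus_def nn_integral_part(1)[OF sets_nu(1) f] .
    have "(\<integral>\<^sup>+x. im x * f x \<partial>nu_minus) + (\<integral>\<^sup>+x. im x * f x \<partial>nu_plus) = (\<integral>\<^sup>+x. im x * (im x * f x) + ip x * (im x * f x) \<partial>nu)"
      unfolding nu_plus_def nu_minus_def nn_integral_part[OF sets_nu(1) m(2)]
      by (rule nn_integral_add[symmetric]; rule U; measurable)
    also have "\<dots> = (\<integral>\<^sup>+x. im x * f x \<partial>nu)"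
      by (simp add: distrib_right[symmetric] weights_sum add.commute[of "im _"])
    finally show "(\<integral>\<^sup>+x. im x * f x \<partial>nu_minus) + (\<integral>\<^sup>+x. im x * f x \<partial>nu_plus) = (\<integral>\<^sup>+x. f x \<partial>nu_minus)"
      unfolding nu_minus_def nn_integral_part(2)[OF sets_nu(1) f] .
  qed
  have fin: "(\<integral>\<^sup>+x. f x \<partial>nu_plus) \<noteq> \<top>" "(\<integral>\<^sup>+x. f x \<partial>nu_minus) \<noteq> \<top>"
    using nn_integral_finite[where f=f, OF finite_nu(1) fc] nn_integral_finite[where f=f, OF finite_nu(2) fc] by simp_all
  have p1: "(\<integral>\<^sup>+x. transl W.U (\<lambda>x. ip x * f x) x \<partial>nu_plus) + (\<integral>\<^sup>+x. f x \<partial>nu_plus) =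
      (\<integral>\<^sup>+x. transl W.U f x \<partial>nu_plus) + (\<integral>\<^sup>+x. ip x * f x \<partial>nu_plus)"
  proof -
    have "(\<integral>\<^sup>+x. transl W.U (\<lambda>x. ip x * f x) x + f x \<partial>nu_plus) = (\<integral>\<^sup>+x. transl W.U f x + ip x * f x \<partial>nu_plus)"
      by (rule nn_integral_cong_AE, rule eventually_mono[OF AE_nu_plus]) (simp add: ip_transl f)
    then show ?thesis by (simp add: nn_integral_add U m f)
  qed
  have p2: "(\<integral>\<^sup>+x. transl W'.U (\<lambda>x. ip x * f x) x \<partial>nu_minus) = (\<integral>\<^sup>+x. ip x * f x \<partial>nu_minus)"
    by (rule nn_integral_cong_AE, rule eventually_mono[OF AE_nu_minus]) (simp add: im_transl f)
  have m1: "(\<integral>\<^sup>+x. transl W'.U (\<lambda>x. im x * f x) x \<partial>nu_minus) + (\<integral>\<^sup>+x. f x \<partial>nu_minus) =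
      (\<integral>\<^sup>+x. transl W'.U f x \<partial>nu_minus) + (\<integral>\<^sup>+x. im x * f x \<partial>nu_minus)"
  proof -
    have "(\<integral>\<^sup>+x. transl W'.U (\<lambda>x. im x * f x) x + f x \<partial>nu_minus) = (\<integral>\<^sup>+x. transl W'.U f x + im x * f x \<partial>nu_minus)"
      by (rule nn_integral_cong_AE, rule eventually_mono[OF AE_nu_minus]) (simp add: im_transl f)
    then show ?thesis by (simp add: nn_integral_add U m f)
  qed
  have m2: "(\<integral>\<^sup>+x. transl W.U (\<lambda>x. im x * f x) x \<partial>nu_plus) = (\<integral>\<^sup>+x. im x * f x \<partial>nu_plus)"
    by (rule nn_integral_cong_AE, rule eventually_mono[OF AE_nu_plus]) (simp add: ip_transl f)
  show "(\<integral>\<^sup>+x. ip x * f x \<partial>mu) = (\<integral>\<^sup>+x. transl W.U f x \<partial>nu_plus)"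
    unfolding nn_integral_mu[OF m(1)] p2 by (rule ennreal_exchange[OF p1 split(1) fin(1)])
  show "(\<integral>\<^sup>+x. im x * f x \<partial>mu) = (\<integral>\<^sup>+x. transl W'.U f x \<partial>nu_minus)"
    unfolding nn_integral_mu[OF m(2)] m2 add.commute[of "integral\<^sup>N nu_plus _"]
    by (rule ennreal_exchange[OF m1 split(2) fin(2)])
qed

section \<open>Invariance and positivity of \<mu>\<close>

definition step :: "real measure \<Rightarrow> real measure" where
  "step Q = add_measure (convolution (pos_part \<alpha> Q) L) (convolution (neg_part \<alpha> Q) L')"

lemma sets_step [simp]: "sets (step Q) = sets borel"
  by (simp add: step_def)

lemma finite_parts:
  assumes Q: "finite_borel Q"
  shows "finite_borel (pos_part \<alpha> Q)" "finite_borel (neg_part \<alpha> Q)"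
proof -
  have s: "sets Q = sets borel" using Q by (rule finite_borel_sets)
  have "ip x \<le> 1" "im x \<le> 1" for x using weights_sum(2)[of x] by (metis le_iff_add, metis le_iff_add add.commute)
  then have "(\<integral>\<^sup>+x. ip x \<partial>Q) < \<infinity>" "(\<integral>\<^sup>+x. im x \<partial>Q) < \<infinity>"
    using nn_integral_finite[OF Q, of ip 1] nn_integral_finite[OF Q, of im 1] by simp_all
  then have fin: "(\<integral>\<^sup>+x. 1 \<partial>pos_part \<alpha> Q) < \<infinity>" "(\<integral>\<^sup>+x. 1 \<partial>neg_part \<alpha> Q) < \<infinity>"
    unfolding nn_integral_part[OF s borel_measurable_const] by simp_all
  have "sets (pos_part \<alpha> Q) = sets borel" "sets (neg_part \<alpha> Q) = sets borel"
    by (simp_all add: pos_part_def neg_part_def s)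
  then show "finite_borel (pos_part \<alpha> Q)" "finite_borel (neg_part \<alpha> Q)"
    using fin nn_integral_1_finite_borelI by simp_all
qed

lemma nn_integral_step:
  assumes Q: "finite_borel Q" and f: "f \<in> borel_measurable borel"
  shows "(\<integral>\<^sup>+x. f x \<partial>step Q) = (\<integral>\<^sup>+x. ip x * transl L f x \<partial>Q) + (\<integral>\<^sup>+x. im x * transl L' f x \<partial>Q)"
  unfolding step_def
  by (subst nn_integral_add_measure)
     (simp_all add: f nn_integral_convolution_transl finite_parts Q W.L W'.L nn_integral_part finite_borel_sets[OF Q] measurable_transl)

lemma emeasure_switching_kernel:
  assumes B: "B \<in> sets borel"
  shows "emeasure (switching_kernel L L' \<alpha> x) B = ip x * transl L (indicator B) x + im x * transl L' (indicator B) x"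
proof -
  have s: "sets L = sets borel" "sets L' = sets borel" by (rule W.L_sets, rule W'.L_sets)
  have t: "transl K (indicator B) x = emeasure (distr K borel (\<lambda>y. x + y)) B" if "sets K = sets borel" for K
  proof -
    note [measurable_cong] = that
    have "emeasure (distr K borel (\<lambda>y. x + y)) B = (\<integral>\<^sup>+y. indicator B y \<partial>distr K borel (\<lambda>y. x + y))" using B by simp
    also have "\<dots> = transl K (indicator B) x" unfolding transl_def using B by (intro nn_integral_distr) auto
    finally show ?thesis by simp
  qed
  have 0: "transl K (indicator B) 0 = emeasure K B" if "sets K = sets borel" for K
    using B that by (simp add: transl_def)
  consider "0 < x" | "x < 0" | "x = 0" by linarith
  then show ?thesis
  proof cases
    case 1 then show ?thesis by (simp add: switching_kernel_def ip_eq im_eq t s)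
  next
    case 2 then show ?thesis by (simp add: switching_kernel_def ip_eq im_eq t s)
  next
    case 3 then show ?thesis using B by (simp add: switching_kernel_def ip_eq im_eq 0 s emeasure_add_measure)
  qed
qed

lemma nn_integral_switching_kernel:
  assumes Q: "finite_borel Q" and B: "B \<in> sets borel"
  shows "(\<integral>\<^sup>+x. emeasure (switching_kernel L L' \<alpha> x) B \<partial>Q) = emeasure (step Q) B"
proof -
  have iB: "indicator B \<in> borel_measurable borel" using B by simp
  have "(\<integral>\<^sup>+x. emeasure (switching_kernel L L' \<alpha> x) B \<partial>Q) = (\<integral>\<^sup>+x. ip x * transl L (indicator B) x \<partial>Q) + (\<integral>\<^sup>+x. im x * transl L' (indicator B) x \<partial>Q)"
    unfolding emeasure_switching_kernel[OF B]
    by (rule nn_integral_add; rule measurable_finite_borel[OF Q] borel_measurable_times_ennreal;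
        intro borel_measurable_times_ennreal weights_measurable measurable_transl[OF W.L iB] measurable_transl[OF W'.L iB])
  also have "\<dots> = emeasure (step Q) B"
    using nn_integral_step[OF Q iB] B by simp
  finally show ?thesis .
qed

text \<open>Integrating U + D = \<delta> + U * L over \<open>N\<^sup>+\<close> and its mirror image
  over \<open>N\<^sup>-\<close> yields \<open>N\<^sup>+ + N\<^sup>- + step \<mu> = \<mu> + N\<^sup>+
  * D + N\<^sup>- * A'\<close>. The balance equation identifies the last two terms with
  \<open>N\<^sup>+ + N\<^sup>-\<close>, a finite amount.\<close>

lemma step_mu: "step mu = mu"
proof (rule measure_eqI_bounded)
  fix B :: "real set" and r :: real
  assume B: "B \<in> sets borel"
  define f :: "real \<Rightarrow> ennreal" where "f = indicator (B \<inter> {-r..r})"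
  have f[measurable]: "f \<in> borel_measurable borel" unfolding f_def using B by measurable
  have f1: "f x \<le> 1" for x by (simp add: f_def split: split_indicator)
  have "(\<integral>\<^sup>+x. f x \<partial>haar) \<le> emeasure haar {-r..r}"
    unfolding f_def using B by (subst nn_integral_indicator) (auto intro!: emeasure_mono)
  then have haar: "(\<integral>\<^sup>+x. f x \<partial>haar) < \<infinity>"
    using emeasure_grid_haar_Icc[OF d_nonneg] by (rule le_less_trans)
  have Lf: "transl L f \<in> borel_measurable borel" "transl L' f \<in> borel_measurable borel"
    by (rule measurable_transl[OF W.L f], rule measurable_transl[OF W'.L f])
  have Lf1: "transl L f x \<le> 1" "transl L' f x \<le> 1" for x
    using transl_le_mult[OF W.L f1] transl_le_mult[OF W'.L f1] W.L1 W'.L1 by simp_all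
  have e: "(\<integral>\<^sup>+x. f x \<partial>step mu) = (\<integral>\<^sup>+x. transl W.U (transl L f) x \<partial>nu_plus) + (\<integral>\<^sup>+x. transl W'.U (transl L' f) x \<partial>nu_minus)"
    using nn_integral_mu_parts(1)[OF Lf(1) Lf1(1)] nn_integral_mu_parts(2)[OF Lf(2) Lf1(2)]
    by (simp add: nn_integral_step[OF finite_mu f])
  have U: "g \<in> borel_measurable nu_plus" "g \<in> borel_measurable nu_minus"
    if "g \<in> borel_measurable borel" for g :: "real \<Rightarrow> ennreal"
    using that measurable_finite_borel[OF finite_nu(1)] measurable_finite_borel[OF finite_nu(2)] by blast+
  have 1: "(\<integral>\<^sup>+x. transl W.U f x \<partial>nu_plus) + (\<integral>\<^sup>+x. transl W.D f x \<partial>nu_plus) =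
      (\<integral>\<^sup>+x. f x \<partial>nu_plus) + (\<integral>\<^sup>+x. transl W.U (transl L f) x \<partial>nu_plus)"
    using f Lf by (simp add: nn_integral_add[symmetric] U measurable_transl W.U W.D W.U_L)
  have 2: "(\<integral>\<^sup>+x. transl W'.U f x \<partial>nu_minus) + (\<integral>\<^sup>+x. transl W'.D f x \<partial>nu_minus) =
      (\<integral>\<^sup>+x. f x \<partial>nu_minus) + (\<integral>\<^sup>+x. transl W'.U (transl L' f) x \<partial>nu_minus)"
    using f Lf by (simp add: nn_integral_add[symmetric] U measurable_transl W'.U W'.D W'.U_L)
  let ?n = "(\<integral>\<^sup>+x. f x \<partial>nu_plus) + (\<integral>\<^sup>+x. f x \<partial>nu_minus)"
  have "?n + (\<integral>\<^sup>+x. f x \<partial>step mu) = ((\<integral>\<^sup>+x. transl W.U f x \<partial>nu_plus) + (\<integral>\<^sup>+x. transl W.D f x \<partial>nu_plus)) +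
     ((\<integral>\<^sup>+x. transl W'.U f x \<partial>nu_minus) + (\<integral>\<^sup>+x. transl W'.D f x \<partial>nu_minus))"
    unfolding e 1 2 by (simp add: ac_simps)
  also have "\<dots> = ((\<integral>\<^sup>+x. transl W.D f x \<partial>nu_plus) + (\<integral>\<^sup>+x. transl W'.D f x \<partial>nu_minus)) + (\<integral>\<^sup>+x. f x \<partial>mu)"
    unfolding nn_integral_mu[OF f] by (simp add: ac_simps)
  also have "\<dots> = ?n + (\<integral>\<^sup>+x. f x \<partial>mu)"
    unfolding nu_balance[OF f haar] ..
  finally have "?n + (\<integral>\<^sup>+x. f x \<partial>step mu) = ?n + (\<integral>\<^sup>+x. f x \<partial>mu)" .
  moreover have "(\<integral>\<^sup>+x. f x \<partial>nu_plus) \<noteq> \<top>" "(\<integral>\<^sup>+x. f x \<partial>nu_minus) \<noteq> \<top>"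
    using nn_integral_finite[where f=f, OF finite_nu(1) f1] nn_integral_finite[where f=f, OF finite_nu(2) f1] by simp_all
  then have "?n \<noteq> \<top>" by simp
  ultimately have "(\<integral>\<^sup>+x. f x \<partial>step mu) = (\<integral>\<^sup>+x. f x \<partial>mu)"
    by (simp only: ennreal_add_left_cancel infinity_ennreal_def simp_thms)
  moreover have "(\<integral>\<^sup>+x. f x \<partial>K) = emeasure K (B \<inter> {-r..r})" if "sets K = sets borel" for K
    unfolding f_def by (rule nn_integral_indicator) (use that B in simp)
  ultimately show "emeasure (step mu) (B \<inter> {-r..r}) = emeasure mu (B \<inter> {-r..r})" by simp
qed simp_all

lemma mu_pos: "0 < emeasure mu UNIV"
proof (rule ccontr)
  assume "\<not> 0 < emeasure mu UNIV"
  then have "(\<integral>\<^sup>+x. 1 \<partial>mu) = 0" unfolding nn_integral_1_UNIV[OF sets_mu] by simp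
  then have 0: "(\<integral>\<^sup>+x. transl W.U (\<lambda>_. 1) x \<partial>nu_plus) = 0" "(\<integral>\<^sup>+x. transl W'.U (\<lambda>_. 1) x \<partial>nu_minus) = 0"
    unfolding nn_integral_mu[OF borel_measurable_const] by (simp_all only: add_eq_0_iff_both_eq_0)
  have "(\<integral>\<^sup>+x. 1 \<partial>nu_plus) \<le> (\<integral>\<^sup>+x. transl W.U (\<lambda>_. 1) x \<partial>nu_plus)"
    by (intro nn_integral_mono) (simp add: W.U_A[of "\<lambda>_. 1"])
  then have plus: "(\<integral>\<^sup>+x. 1 \<partial>nu_plus) = 0" using 0 by simp
  have "(\<integral>\<^sup>+x. 1 \<partial>nu_minus) \<le> (\<integral>\<^sup>+x. transl W'.U (\<lambda>_. 1) x \<partial>nu_minus)"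
    by (intro nn_integral_mono) (simp add: W'.U_A[of "\<lambda>_. 1"])
  then have minus: "(\<integral>\<^sup>+x. 1 \<partial>nu_minus) = 0" using 0 by simp
  note [measurable_cong] = sets_grid_haar
  have "(\<integral>\<^sup>+x. ip x * ennreal (dens x) * 1 \<partial>haar) = 0" "(\<integral>\<^sup>+x. im x * ennreal (dens x) * 1 \<partial>haar) = 0"
    using plus minus by (simp_all only: nn_integral_nu_parts[OF borel_measurable_const])
  then have "(\<integral>\<^sup>+x. ip x * ennreal (dens x) + im x * ennreal (dens x) \<partial>haar) = 0"
    by (subst nn_integral_add) simp_all
  then have z: "(\<integral>\<^sup>+x. ennreal (dens x) \<partial>haar) = 0" by (simp add: distrib_right[symmetric] weights_sum)
  have dens0: "0 < dens 0"
  proof -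
    have "dens 0 = a * p' + (1 - a) * p" using dens_zero by (simp add: algebra_simps)
    then show ?thesis using a_bounds p_pos p'_pos
      by (cases "a = 0") (auto intro!: add_pos_nonneg)
  qed
  show False
  proof (cases "d = 0")
    case False
    then have d: "0 < d" using d_nonneg by simp
    have "(\<integral>\<^sup>+x. ennreal (dens 0) * indicator {0} x \<partial>haar) \<le> (\<integral>\<^sup>+x. ennreal (dens x) \<partial>haar)"
      by (intro nn_integral_mono) (simp split: split_indicator)
    then have "(\<integral>\<^sup>+k. ennreal (dens 0) * indicator {0} (d * of_int k) \<partial>count_space UNIV) = 0"
      using z d by (subst (asm) nn_integral_grid_haar) auto
    then show False using dens0 d by (simp add: nn_integral_0_iff_AE AE_count_space) (metis indicator_simps(1) insertI1 mult_zero_right not_less order_refl zero_neq_one of_int_0)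
  next
    case True
    then have hl: "haar = lborel" by (simp add: grid_haar_def)
    have "AE x in lborel. ennreal (dens x) = 0"
      using z unfolding hl by (subst (asm) nn_integral_0_iff_AE) simp_all
    then have ae: "AE x in lborel. dens x = 0"
      by (rule eventually_mono) (use dens_nonneg in \<open>simp add: ennreal_eq_0_iff antisym\<close>)
    \<comment> \<open>A' exceeds some e > 0 with positive probability, and the density is positive
      on all of \<open>{0<..<e}\<close>.\<close>
    have "\<exists>e>0. 0 < measure W'.D {e<..}"
    proof (rule ccontr)
      assume n: "\<not> ?thesis"
      interpret D': prob_space W'.D by (rule W'.D_prob)
      have "emeasure W'.D {1 / real (Suc n)<..} = 0" for n
        using n[simplified, rule_format, of "1 / real (Suc n)"] by (simp add: D'.emeasure_eq_measure measure_le_0_iff not_less)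
      then have "emeasure W'.D (\<Union>n. {1 / real (Suc n)<..}) = 0"
        using finite_borel_sets[OF W'.D] by (intro emeasure_UN_eq_0) auto
      moreover have "(\<Union>n. {1 / real (Suc n)<..}) = {0::real<..}"
      proof (intro equalityI subsetI)
        fix x :: real assume "x \<in> {0<..}"
        then obtain n where "inverse (real (Suc n)) < x" using reals_Archimedean[of x] by auto
        then show "x \<in> (\<Union>n. {1 / real (Suc n)<..})" by (intro UN_I[of n]) (simp_all add: inverse_eq_divide)
      next
        fix x assume "x \<in> (\<Union>n. {1 / real (Suc n)<..})"
        then obtain n where "1 / real (Suc n) < x" by auto
        then show "x \<in> {0<..}" by (auto intro: less_trans[of 0 "1 / real (Suc n)"])
      qed
      ultimately show False using p'_pos by (simp add: p'_def D'.emeasure_eq_measure)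
    qed
    then obtain e where e: "e > 0" "0 < measure W'.D {e<..}" by auto
    have pos: "0 < dens x" if "0 < x" "x < e" for x
    proof -
      interpret D': prob_space W'.D by (rule W'.D_prob)
      have "measure W'.D {e<..} \<le> measure W'.D {x<..}"
        using that finite_borel_sets[OF W'.D] by (intro D'.finite_measure_mono) auto
      moreover have "a * measure W'.D {x} \<le> measure W'.D {x}" using a_bounds mult_right_mono[of a 1 "measure W'.D {x}"] by simp
      ultimately show ?thesis using D'_compl[of x] e unfolding dens_pos[OF that(1)] by linarith
    qed
    have "AE x in lborel. x \<notin> {0<..<e}"
      by (rule eventually_mono[OF ae]) (use pos in force)
    then have "{0<..<e} \<in> null_sets lborel" by (subst AE_iff_null_sets) auto
    then have "emeasure lborel {0<..<e} = 0" by (rule null_setsD1)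
    then show False using e by simp
  qed
qed

end

section \<open>Bounded harmonic functions\<close>

lemma transl_sum_lessThan:
  fixes f :: "nat \<Rightarrow> real \<Rightarrow> ennreal"
  assumes A: "finite_borel A" and f: "\<And>n. f n \<in> borel_measurable borel"
  shows "transl A (\<lambda>x. \<Sum>k<n. f k x) = (\<lambda>x. \<Sum>k<n. transl A (f k) x)"
proof (induction n)
  case (Suc n)
  have "(\<lambda>x. \<Sum>k<n. f k x) \<in> borel_measurable borel" using f by (intro borel_measurable_sum)
  then show ?case using Suc by (simp add: transl_add[OF A _ f])
qed (simp add: transl_def)

text \<open>The variance identity, which contains Jensen's inequality for squares.\<close>

lemma (in prob_space) square_integral_le:
  fixes u :: "'a \<Rightarrow> real"
  assumes u[measurable]: "u \<in> borel_measurable M" and b: "\<And>x. \<bar>u x\<bar> \<le> K"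
  shows "ennreal ((\<integral>x. u x \<partial>M)\<^sup>2) + (\<integral>\<^sup>+x. ennreal ((u x - (\<integral>x. u x \<partial>M))\<^sup>2) \<partial>M) = (\<integral>\<^sup>+x. ennreal ((u x)\<^sup>2) \<partial>M)"
proof -
  define m where "m = (\<integral>x. u x \<partial>M)"
  have iu: "integrable M u" by (rule integrable_const_bound[of _ K]) (use b in auto)
  have i2: "integrable M (\<lambda>x. (u x)\<^sup>2)"
  proof (rule integrable_const_bound[of _ "K\<^sup>2"])
    have "(u x)\<^sup>2 \<le> K\<^sup>2" for x using b[of x] by (rule abs_le_square_iff[THEN iffD1, OF order_trans[OF _ abs_ge_self]])
    then show "AE x in M. norm ((u x)\<^sup>2) \<le> K\<^sup>2" by simp
  qed measurable
  have e: "(u x - m)\<^sup>2 = (u x)\<^sup>2 - 2 * m * u x + m\<^sup>2" for x by (simp add: power2_eq_square algebra_simps)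
  have "(\<integral>x. (u x - m)\<^sup>2 \<partial>M) = (\<integral>x. (u x)\<^sup>2 \<partial>M) - m\<^sup>2"
    unfolding e using iu i2 by (simp add: prob_space m_def[symmetric] power2_eq_square)
  moreover have "integrable M (\<lambda>x. (u x - m)\<^sup>2)" unfolding e using iu i2 by simp
  moreover have "0 \<le> (\<integral>x. (u x - m)\<^sup>2 \<partial>M)" by (intro integral_nonneg_AE) simp
  ultimately show ?thesis
    unfolding m_def[symmetric] using i2
    by (simp add: nn_integral_eq_integral ennreal_plus[symmetric] del: ennreal_plus)
qed

text \<open>For harmonic \<open>h\<close> the energy \<open>g x = E (h (x + Y) - h x)\<^sup>2\<close> is subharmonic, being an average of
  squares of the harmonic functions \<open>h (\<cdot> + y) - h\<close>, while the sum of \<open>E (g (x + S\<^sub>k))\<close> over \<open>k\<close>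
  telescopes to at most \<open>sup h\<^sup>2\<close>.\<close>
lemma bounded_harmonic_AE:
  fixes h :: "real \<Rightarrow> real"
  assumes L: "prob_space L" "sets L = sets borel"
    and h[measurable]: "h \<in> borel_measurable borel" and b: "\<And>x. \<bar>h x\<bar> \<le> K"
    and harm: "\<And>x. (\<integral>y. h (x + y) \<partial>L) = h x"
  shows "AE y in L. h (x + y) = h x"
proof -
  interpret prob_space L by (rule L(1))
  interpret pair_sigma_finite L L ..
  note [measurable_cong] = L(2)
  have Lf: "finite_borel L" using L(2) finite_measure_axioms by (simp add: finite_borel_def)
  have L1: "emeasure L UNIV = 1" using emeasure_space_1 finite_borel_space[OF Lf] by simp
  define g where "g x = (\<integral>\<^sup>+y. ennreal ((h (x + y) - h x)\<^sup>2) \<partial>L)" for x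
  define q where "q x = ennreal ((h x)\<^sup>2)" for x
  have [measurable]: "g \<in> borel_measurable borel" "q \<in> borel_measurable borel"
    unfolding g_def q_def by measurable
  have K: "0 \<le> K" using b[of 0] by simp
  have qK: "q x \<le> ennreal (K\<^sup>2)" for x
    unfolding q_def using abs_le_square_iff[of "h x" K] b[of x] K by (intro ennreal_leI) simp
  \<comment> \<open>By harmonicity the mean of \<open>h (x + y)\<close> is \<open>h x\<close>, so
    the variance under \<open>L\<close> is the energy \<open>g x\<close>.\<close>
  have Tq: "transl L q = (\<lambda>x. q x + g x)"
    using square_integral_le[of "\<lambda>y. h (x + y)" K for x] b harm
    by (auto simp: fun_eq_iff transl_def q_def g_def)
  have sub: "g x \<le> transl L g x" for x
  proof -
    have "ennreal ((h (x + y) - h x)\<^sup>2) \<le> (\<integral>\<^sup>+z. ennreal ((h (x + z + y) - h (x + z))\<^sup>2) \<partial>L)" for y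
    proof -
      define u where "u z = h (x + z + y) - h (x + z)" for z
      have i: "integrable L (\<lambda>z. h (w + z))" for w by (rule integrable_const_bound[of _ K]) (use b in auto)
      have "(\<integral>z. u z \<partial>L) = h (x + y) - h x"
        unfolding u_def using i[of "x + y"] i[of x] harm[of "x + y"] harm[of x] by (simp add: ac_simps)
      moreover have "\<bar>u z\<bar> \<le> 2 * K" for z
        unfolding u_def using b[of "x + z + y"] b[of "x + z"] by linarith
      moreover have "u \<in> borel_measurable L" unfolding u_def by measurable
      ultimately have "ennreal ((h (x + y) - h x)\<^sup>2) \<le> (\<integral>\<^sup>+z. ennreal ((u z)\<^sup>2) \<partial>L)"
        using square_integral_le[of u "2 * K"] by (metis le_iff_add)
      then show ?thesis by (simp only: u_def)
    qed
    then have "g x \<le> (\<integral>\<^sup>+y. \<integral>\<^sup>+z. ennreal ((h (x + z + y) - h (x + z))\<^sup>2) \<partial>L \<partial>L)"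
      unfolding g_def by (intro nn_integral_mono)
    also have "\<dots> = (\<integral>\<^sup>+z. \<integral>\<^sup>+y. ennreal ((h (x + z + y) - h (x + z))\<^sup>2) \<partial>L \<partial>L)"
      by (rule Fubini') measurable
    also have "\<dots> = transl L g x" by (simp add: transl_def g_def)
    finally show ?thesis .
  qed
  have subk: "g x \<le> (transl L ^^ k) g x" for k x
  proof (induction k arbitrary: x)
    case (Suc k)
    have "g x \<le> transl L g x" by (rule sub)
    also have "\<dots> \<le> transl L ((transl L ^^ k) g) x" using Suc by (rule transl_mono)
    finally show ?case by simp
  qed simp
  have tele: "(transl L ^^ n) q x = q x + (\<Sum>k<n. (transl L ^^ k) g x)" for n x
  proof (induction n arbitrary: x)
    case (Suc n)
    have "(transl L ^^ Suc n) q x = (transl L ^^ n) (\<lambda>x. q x + g x) x"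
      by (simp only: funpow_Suc_right comp_apply Tq)
    also have "\<dots> = (transl L ^^ n) q x + (transl L ^^ n) g x"
    proof -
      have "(transl L ^^ n) (\<lambda>x. q x + g x) = (\<lambda>x. (transl L ^^ n) q x + (transl L ^^ n) g x)"
        by (induction n) (simp_all add: transl_add[OF Lf] measurable_transl_power[OF Lf])
      then show ?thesis by simp
    qed
    finally show ?case using Suc by (simp add: ac_simps)
  qed simp
  have bq: "(transl L ^^ n) q x \<le> ennreal (K\<^sup>2)" for n x
  proof (induction n arbitrary: x)
    case (Suc n)
    then show ?case using transl_le_mult[OF Lf Suc] L1 by simp
  qed (simp add: qK)
  have "of_nat n * g x \<le> ennreal (K\<^sup>2)" for n
  proof -
    have "of_nat n * g x = (\<Sum>k<n. g x)" by simp
    also have "\<dots> \<le> (\<Sum>k<n. (transl L ^^ k) g x)" by (intro sum_mono subk)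
    also have "\<dots> \<le> (transl L ^^ n) q x" unfolding tele by simp
    also have "\<dots> \<le> ennreal (K\<^sup>2)" by (rule bq)
    finally show ?thesis .
  qed
  then have "g x = 0"
  proof (cases "g x")
    case (real r)
    have "real n * r \<le> K\<^sup>2" for n
      using \<open>of_nat n * g x \<le> ennreal (K\<^sup>2)\<close> real by (simp add: ennreal_of_nat_eq_real_of_nat ennreal_mult[symmetric] ennreal_le_iff)
    then have "r \<le> 0" using reals_Archimedean3[of r] by (meson not_le)
    then show ?thesis using real by simp
  next
    case top
    then show ?thesis using \<open>of_nat 1 * g x \<le> ennreal (K\<^sup>2)\<close> by (simp add: top_unique)
  qed
  then have "AE y in L. ennreal ((h (x + y) - h x)\<^sup>2) = 0"
    unfolding g_def by (subst (asm) nn_integral_0_iff_AE) measurable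
  then show ?thesis by eventually_elim (simp add: ennreal_eq_0_iff)
qed

section \<open>Potentials\<close>

context drifting_walk
begin

text \<open>Renewal operator of the proper law \<open>D\<close>. The underlying measure has infinite
  mass, hence the series of operators in place of a finite measure.\<close>

definition V :: "(real \<Rightarrow> ennreal) \<Rightarrow> real \<Rightarrow> ennreal" where
  "V f x = (\<Sum>k. (transl D ^^ k) f x)"

text \<open>From U * (\<delta> - L) = \<delta> - D and U * (\<delta> - A) = \<delta> one gets
  \<delta> - L = (\<delta> - A) * (\<delta> - D). Composing the two renewal operators thus inverts
  \<delta> - L and stands for the potential of the unrestricted walk.\<close>

definition pot :: "(real \<Rightarrow> ennreal) \<Rightarrow> real \<Rightarrow> ennreal" where
  "pot f = V (transl U f)"

lemma V_measurable:
  assumes "f \<in> borel_measurable borel" shows "V f \<in> borel_measurable borel"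
proof -
  note [measurable] = measurable_transl_power[OF D assms]
  show ?thesis unfolding V_def by measurable
qed

lemma V_unfold:
  assumes "f \<in> borel_measurable borel"
  shows "V f x = f x + V (transl D f) x"
  unfolding V_def by (rule suminf_transl_power(2)[OF D assms])

lemma power_transl_commute:
  assumes F: "finite_borel F" and f: "f \<in> borel_measurable borel"
  shows "transl F ((transl D ^^ k) f) = (transl D ^^ k) (transl F f)"
proof (induction k)
  case (Suc k)
  then show ?case using transl_commute[OF F D measurable_transl_power[OF D f]] by simp
qed simp

lemma transl_V:
  assumes F: "finite_borel F" and f: "f \<in> borel_measurable borel"
  shows "transl F (V f) = V (transl F f)"
  using transl_suminf[OF F measurable_transl_power[OF D f]]
  unfolding V_def[abs_def] power_transl_commute[OF F f] .

lemma V_add: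
  assumes f: "f \<in> borel_measurable borel" and g: "g \<in> borel_measurable borel"
  shows "V (\<lambda>x. f x + g x) x = V f x + V g x"
proof -
  have "(transl D ^^ k) (\<lambda>x. f x + g x) = (\<lambda>x. (transl D ^^ k) f x + (transl D ^^ k) g x)" for k
    by (induction k) (simp_all add: transl_add[OF D] measurable_transl_power[OF D] f g)
  then show ?thesis unfolding V_def by (simp add: suminf_add[OF summableI summableI])
qed

lemma V_shift: "V (\<lambda>y. f (x + y)) z = V f (x + z)"
proof -
  have "(transl D ^^ k) (\<lambda>y. f (x + y)) z = (transl D ^^ k) f (x + z)" for k z
  proof (induction k arbitrary: z)
    case (Suc k)
    then show ?case by (simp add: transl_def add.assoc)
  qed simp
  then show ?thesis by (simp add: V_def)
qed

text \<open>Steps of law \<open>D\<close> never increase \<open>s * x\<close>, so from x only points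
  at or beyond x in the direction of the drift are visited.\<close>

lemma V_cong:
  assumes "\<And>y. s * y \<le> c \<Longrightarrow> f y = g y" and "s * x \<le> c"
  shows "V f x = V g x"
proof -
  have "s * x \<le> c \<Longrightarrow> (transl D ^^ k) f x = (transl D ^^ k) g x" for k x
  proof (induction k arbitrary: x)
    case 0
    then show ?case using assms(1) by simp
  next
    case (Suc k)
    then show ?case
      unfolding funpow.simps comp_apply transl_def
      by (intro nn_integral_cong_AE eventually_mono[OF AE_D]) (simp add: distrib_left)
  qed
  then show ?thesis using assms(2) by (simp add: V_def)
qed

lemma V_zero [simp]: "V (\<lambda>_. 0) x = 0"
proof -
  have "(transl D ^^ k) (\<lambda>_. 0) = (\<lambda>_. 0)" for k by (induction k) (simp_all add: transl_def)
  then show ?thesis by (simp add: V_def)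
qed

lemma V_mono:
  assumes "\<And>x. f x \<le> g x" shows "V f x \<le> V g x"
proof -
  have "(transl D ^^ k) f x \<le> (transl D ^^ k) g x" for k x
    by (induction k arbitrary: x) (auto simp: assms intro: transl_mono)
  then show ?thesis unfolding V_def by (intro suminf_le summableI)
qed

text \<open>The clamped linear function drops by at least \<open>min \<bar>y\<bar> 1\<close> at each step \<open>y\<close> taken from \<open>[-r, r]\<close>.\<close>
lemma V_bounded: "\<exists>c<\<infinity>. \<forall>x. V (indicator {-r..r}) x \<le> c"
proof -
  note [measurable_cong] = finite_borel_sets[OF D]
  \<comment> \<open>The mean guaranteed drop; it is positive since \<open>D\<close> is not
    concentrated at 0.\<close>
  define e where "e = (\<integral>\<^sup>+y. ennreal (min \<bar>y\<bar> 1) \<partial>D)"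
  \<comment> \<open>The clamp is inactive where \<open>s * x\<close> lies between -\<bar>r\<bar> - 1
    and \<bar>r\<bar>. On \<open>{-r..r}\<close> the value is thus at least 1, enough room for a
    drop of min \<bar>y\<bar> 1. Its maximum 2 \<bar>r\<bar> + 1 divided by \<open>e\<close> is the
    final bound.\<close>
  define psi where "psi x = ennreal (min (2 * \<bar>r\<bar> + 1) (max 0 (s * x + \<bar>r\<bar> + 1)))" for x
  have [measurable]: "psi \<in> borel_measurable borel" unfolding psi_def by measurable
  have "e \<noteq> 0"
  proof
    assume "e = 0"
    then have "AE y in D. ennreal (min \<bar>y\<bar> 1) = 0" unfolding e_def by (subst (asm) nn_integral_0_iff_AE) measurable
    then have "AE y in D. y \<notin> {x. s * x < 0}" by eventually_elim (auto simp: ennreal_eq_0_iff min_le_iff_disj)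
    then have "{x. s * x < 0} \<in> null_sets D" using finite_borel_sets[OF D] by (subst AE_iff_null_sets) auto
    then show False using D_strict by (simp add: null_sets_def)
  qed
  have "e \<le> 1"
  proof -
    have "e \<le> (\<integral>\<^sup>+y. 1 \<partial>D)" unfolding e_def by (intro nn_integral_mono) simp
    then show ?thesis using D1 finite_borel_space[OF D] by simp
  qed
  define I :: "real \<Rightarrow> ennreal" where "I = indicator {-r..r}"
  have I[measurable]: "I \<in> borel_measurable borel" unfolding I_def by measurable
  have step: "transl D psi x + e * I x \<le> psi x" for x
  proof (cases "x \<in> {-r..r}")
    case True
    have "transl D psi x + e = (\<integral>\<^sup>+y. psi (x + y) + ennreal (min \<bar>y\<bar> 1) \<partial>D)"
      unfolding transl_def e_def by (rule nn_integral_add[symmetric]) measurable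
    also have "\<dots> \<le> (\<integral>\<^sup>+y. psi x \<partial>D)"
    proof (rule nn_integral_mono_AE, rule eventually_mono[OF AE_D])
      fix y assume y: "s * y \<le> 0"
      have sx: "\<bar>s * x\<bar> \<le> \<bar>r\<bar>" "s * y = - \<bar>y\<bar>" using True y s_sign by auto
      then have "min (2 * \<bar>r\<bar> + 1) (max 0 (s * (x + y) + \<bar>r\<bar> + 1)) + min \<bar>y\<bar> 1 \<le> min (2 * \<bar>r\<bar> + 1) (max 0 (s * x + \<bar>r\<bar> + 1))"
      proof -
        define p where "p = s * x + \<bar>r\<bar> + 1"
        have p: "1 \<le> p" "p \<le> 2 * \<bar>r\<bar> + 1" using sx(1) by (auto simp: p_def abs_le_iff)
        have "min (2 * \<bar>r\<bar> + 1) (max 0 (p - \<bar>y\<bar>)) + min \<bar>y\<bar> 1 \<le> max 0 (p - \<bar>y\<bar>) + min \<bar>y\<bar> 1" by simp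
        also have "\<dots> \<le> p" using p(1) by (auto simp: max_def min_def)
        also have "p = min (2 * \<bar>r\<bar> + 1) (max 0 p)" using p by simp
        finally show ?thesis unfolding distrib_left sx(2) p_def by (simp add: algebra_simps)
      qed
      then have "ennreal (min (2 * \<bar>r\<bar> + 1) (max 0 (s * (x + y) + \<bar>r\<bar> + 1)) + min \<bar>y\<bar> 1) \<le> psi x"
        unfolding psi_def by (rule ennreal_leI)
      moreover have "0 \<le> min (2 * \<bar>r\<bar> + 1) (max 0 (s * (x + y) + \<bar>r\<bar> + 1))" "0 \<le> min \<bar>y\<bar> 1"
        by (intro min.boundedI max.cobounded1; simp)+
      ultimately show "psi (x + y) + ennreal (min \<bar>y\<bar> 1) \<le> psi x"
        unfolding psi_def by (simp only: ennreal_plus)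
    qed
    also have "\<dots> = psi x" using D1 finite_borel_space[OF D] by simp
    finally show ?thesis using True by (simp add: I_def)
  next
    case False
    have "transl D psi x \<le> (\<integral>\<^sup>+y. psi x \<partial>D)"
      unfolding transl_def
      by (rule nn_integral_mono_AE, rule eventually_mono[OF AE_D]) (unfold psi_def, intro ennreal_leI min.mono max.mono, simp_all add: distrib_left)
    also have "\<dots> = psi x" using D1 finite_borel_space[OF D] by simp
    finally show ?thesis using False by (simp add: I_def)
  qed
  have iter: "(transl D ^^ n) psi x + e * (\<Sum>k<n. (transl D ^^ k) I x) \<le> psi x" for n x
  proof (induction n arbitrary: x)
    case (Suc n)
    let ?S = "\<lambda>x. \<Sum>k<n. (transl D ^^ k) I x"
    have S: "?S \<in> borel_measurable borel" by (intro borel_measurable_sum measurable_transl_power[OF D I])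
    have shift: "transl D ?S x = (\<Sum>k<n. (transl D ^^ Suc k) I x)"
      using transl_sum_lessThan[of D "\<lambda>k. (transl D ^^ k) I" n, OF D measurable_transl_power[OF D I]] by simp
    have m: "(transl D ^^ n) psi \<in> borel_measurable borel" by (rule measurable_transl_power[OF D]) measurable
    have "(transl D ^^ Suc n) psi x + e * (\<Sum>k<Suc n. (transl D ^^ k) I x) =
       (transl D ((transl D ^^ n) psi) x + e * transl D ?S x) + e * I x"
      unfolding shift sum.lessThan_Suc_shift by (simp add: distrib_left ac_simps)
    also have "transl D ((transl D ^^ n) psi) x + e * transl D ?S x = transl D (\<lambda>x. (transl D ^^ n) psi x + e * ?S x) x"
      using m S by (simp add: transl_add[OF D] transl_cmult[OF D])
    also have "\<dots> + e * I x \<le> transl D psi x + e * I x"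
      by (intro add_right_mono transl_mono Suc)
    also have "\<dots> \<le> psi x" by (rule step)
    finally show ?case .
  qed simp
  have "e * (\<Sum>k<n. (transl D ^^ k) I x) \<le> psi x" for n x
    by (rule order_trans[OF _ iter[of n x]]) simp
  then have "(\<Sum>k<n. e * (transl D ^^ k) I x) \<le> psi x" for n x by (simp add: sum_distrib_left)
  then have "(\<Sum>k. e * (transl D ^^ k) I x) \<le> psi x" for x by (rule suminf_le_const[OF summableI])
  then have le: "e * V I x \<le> ennreal (2 * \<bar>r\<bar> + 1)" for x
    unfolding V_def ennreal_suminf_cmult
    by (rule order_trans) (unfold psi_def, intro ennreal_leI min.cobounded1)
  obtain t where t: "e = ennreal t" "0 < t"
    using \<open>e \<noteq> 0\<close> \<open>e \<le> 1\<close> by (cases e) (auto simp: top_unique less_le)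
  have "V I x \<le> ennreal ((2 * \<bar>r\<bar> + 1) / t)" for x
  proof -
    have "V I x = ennreal (1 / t) * (e * V I x)"
      using t by (simp add: mult.assoc[symmetric] ennreal_mult[symmetric])
    also have "\<dots> \<le> ennreal (1 / t) * ennreal (2 * \<bar>r\<bar> + 1)" by (intro mult_left_mono le) simp
    also have "\<dots> = ennreal ((2 * \<bar>r\<bar> + 1) / t)" using t by (subst ennreal_mult[symmetric]) simp_all
    finally show ?thesis .
  qed
  then show ?thesis unfolding I_def by (intro exI[of _ "ennreal ((2 * \<bar>r\<bar> + 1) / t)"]) simp
qed

lemma pot_eq:
  assumes f: "f \<in> borel_measurable borel"
  shows "pot f = transl U (V f)"
  unfolding pot_def by (rule transl_V[OF U f, symmetric])

lemma pot_measurable: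
  assumes f: "f \<in> borel_measurable borel" shows "pot f \<in> borel_measurable borel"
  unfolding pot_def by (intro V_measurable measurable_transl[OF U f])

lemma transl_pot:
  assumes F: "finite_borel F" and f: "f \<in> borel_measurable borel"
  shows "transl F (pot f) = pot (transl F f)"
  unfolding pot_def transl_commute[OF U F f, symmetric] transl_V[OF F measurable_transl[OF U f]]
  by (simp add: transl_commute[OF F U f])

lemma pot_split:
  assumes f: "f \<in> borel_measurable borel"
  shows "pot f x = V f x + pot (transl A f) x"
proof -
  have "transl U f = (\<lambda>x. f x + transl U (transl A f) x)"
    using U_A[OF f] by (simp add: fun_eq_iff transl_commute[OF A U f])
  then show ?thesis
    unfolding pot_def using V_add[OF f measurable_transl[OF U measurable_transl[OF A f]]] by simp
qed

text \<open>Apply \<open>V\<close> to U + D = \<delta> + U * L and cancel V * D against V = \<delta>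
  + V * D. The cancellation is where finiteness of \<open>V f x\<close> enters.\<close>

lemma pot_L:
  assumes f: "f \<in> borel_measurable borel" and fin: "V f x \<noteq> \<top>"
  shows "transl L (pot f) x + f x = pot f x"
proof -
  have m: "transl L f \<in> borel_measurable borel" "transl D f \<in> borel_measurable borel" "transl U f \<in> borel_measurable borel"
    "transl U (transl L f) \<in> borel_measurable borel"
    by (intro measurable_transl L D U f)+
  have "(\<lambda>x. transl U f x + transl D f x) = (\<lambda>x. f x + transl U (transl L f) x)"
    using U_L[OF f] by (simp add: fun_eq_iff)
  then have "V (transl U f) x + V (transl D f) x = V f x + V (transl U (transl L f)) x"
    using V_add[OF m(3,2), of x] V_add[OF f m(4), of x] by simp
  moreover have "transl L (pot f) x = V (transl U (transl L f)) x" using fun_cong[OF transl_pot[OF L f], of x] unfolding pot_def .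
  ultimately have "V (transl D f) x + pot f x = V (transl D f) x + (transl L (pot f) x + f x)"
    unfolding V_unfold[OF f, of x] pot_def by (simp only: ac_simps)
  moreover have "V (transl D f) x \<noteq> \<top>" using fin unfolding V_unfold[OF f, of x] by simp
  ultimately show ?thesis by (simp only: ennreal_add_left_cancel infinity_ennreal_def simp_thms)
qed

lemma pot_bounded: "\<exists>c<\<infinity>. \<forall>x. pot (indicator {-r..r}) x \<le> c"
proof -
  obtain c where c: "c < \<infinity>" "\<And>x. V (indicator {-r..r}) x \<le> c" using V_bounded by blast
  have "pot (indicator {-r..r}) x \<le> c * emeasure U UNIV" for x
    using transl_le_mult[OF U c(2)] by (simp add: pot_eq)
  then show ?thesis using mult_emeasure_finite[OF U c(1)] by blast
qed

lemma V_le_pot: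
  assumes f: "f \<in> borel_measurable borel" shows "V f x \<le> pot f x"
  unfolding pot_split[OF f] by simp

lemma le_V:
  assumes f: "f \<in> borel_measurable borel" shows "f x \<le> V f x"
  unfolding V_unfold[OF f] by simp

end

section \<open>Periods and uniqueness of Haar measure\<close>

text \<open>Invariance is asked for open intervals only: they are exhausted by slightly smaller
  ones, which gives closedness, and rational endpoints suffice, which reduces almost sure statements
  to countably many.\<close>

definition periods :: "real measure \<Rightarrow> real set" where
  "periods N = {t. \<forall>a b. emeasure N {a + t<..<b + t} = emeasure N {a<..<b}}"

lemma emeasure_interval_le:
  fixes N :: "real measure" and a b t :: real
  assumes s: "sets N = sets borel"
    and le: "\<And>e. e > 0 \<Longrightarrow> emeasure N {a + e<..<b - e} \<le> c"
  shows "emeasure N {a<..<b} \<le> c"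
proof -
  let ?A = "\<lambda>n. {a + inverse (real (Suc n))<..<b - inverse (real (Suc n))}"
  have inc: "incseq ?A"
  proof (rule incseq_SucI)
    fix n
    have "inverse (real (Suc (Suc n))) \<le> inverse (real (Suc n))" by (rule le_imp_inverse_le) auto
    then show "?A n \<subseteq> ?A (Suc n)" unfolding subset_iff greaterThanLessThan_iff by linarith
  qed
  have un: "(\<Union>n. ?A n) = {a<..<b}"
  proof (intro equalityI subsetI)
    fix x assume x: "x \<in> {a<..<b}"
    then obtain n where "inverse (real (Suc n)) < min (x - a) (b - x)"
      using reals_Archimedean[of "min (x - a) (b - x)"] by auto
    then have "x \<in> ?A n" by auto
    then show "x \<in> (\<Union>n. ?A n)" by (rule UN_I[OF UNIV_I])
  next
    fix x assume "x \<in> (\<Union>n. ?A n)"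
    then obtain n where x: "x \<in> ?A n" by auto
    have "0 < inverse (real (Suc n))" by simp
    then show "x \<in> {a<..<b}" using x unfolding greaterThanLessThan_iff by linarith
  qed
  have "range ?A \<subseteq> sets N" unfolding s by (intro image_subsetI) simp
  then have "(SUP n. emeasure N (?A n)) = emeasure N {a<..<b}"
    using SUP_emeasure_incseq[OF _ inc] unfolding un by blast
  moreover have "(SUP n. emeasure N (?A n)) \<le> c" by (intro SUP_least le) simp
  ultimately show ?thesis by simp
qed

lemma emeasure_interval_mono:
  fixes N :: "real measure"
  assumes "sets N = sets borel" "a' \<le> a" "b \<le> b'"
  shows "emeasure N {a<..<b} \<le> emeasure N {a'<..<b'}"
  using assms by (intro emeasure_mono) auto

lemma periods_diff:
  assumes "t \<in> periods N" "u \<in> periods N" shows "t - u \<in> periods N"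
proof -
  have "emeasure N {a + (t - u)<..<b + (t - u)} = emeasure N {a<..<b}" for a b
  proof -
    have "emeasure N {a + (t - u)<..<b + (t - u)} = emeasure N {a + (t - u) + u<..<b + (t - u) + u}"
      using assms(2)[unfolded periods_def mem_Collect_eq, rule_format, symmetric] .
    also have "\<dots> = emeasure N {a + t<..<b + t}" by (simp add: add.assoc)
    finally show ?thesis using assms(1) unfolding periods_def by simp
  qed
  then show ?thesis unfolding periods_def by simp
qed

lemma zero_in_periods: "0 \<in> periods N"
  by (simp add: periods_def)

lemma periods_uminus: "t \<in> periods N \<Longrightarrow> - t \<in> periods N"
  using periods_diff[OF zero_in_periods] by force

text \<open>A nearby period moves a slightly shrunken interval into the right place and gives one
  inequality. The limit points are symmetric, so -t supplies the other.\<close>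

lemma closed_periods:
  assumes s: "sets N = sets borel" shows "closed (periods N)"
proof -
  have le: "emeasure N {a + t<..<b + t} \<le> emeasure N {a<..<b}" if t: "t \<in> closure (periods N)" for a b t
  proof (rule emeasure_interval_le[OF s])
    fix e :: real assume "e > 0"
    then obtain u where u: "u \<in> periods N" "dist u t < e" using t closure_approachable by blast
    then have "a + u \<le> a + t + e" "b + t - e \<le> b + u" by (auto simp: dist_real_def)
    then have "emeasure N {a + t + e<..<b + t - e} \<le> emeasure N {a + u<..<b + u}" by (rule emeasure_interval_mono[OF s])
    then show "emeasure N {a + t + e<..<b + t - e} \<le> emeasure N {a<..<b}"
      using u(1) unfolding periods_def by simp
  qed
  have um: "- t \<in> closure (periods N)" if t: "t \<in> closure (periods N)" for t
    unfolding closure_approachable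
  proof (intro allI impI)
    fix e :: real assume "e > 0"
    then obtain u where u: "u \<in> periods N" "dist u t < e" using t closure_approachable by blast
    then show "\<exists>y\<in>periods N. dist y (- t) < e"
      by (intro bexI[of _ "- u"]) (auto simp: dist_real_def periods_uminus)
  qed
  have "t \<in> periods N" if t: "t \<in> closure (periods N)" for t
    unfolding periods_def
  proof (intro CollectI allI antisym)
    fix a b show "emeasure N {a + t<..<b + t} \<le> emeasure N {a<..<b}" by (rule le[OF t])
    show "emeasure N {a<..<b} \<le> emeasure N {a + t<..<b + t}" using le[OF um[OF t], of "a + t" "b + t"] by simp
  qed
  then show ?thesis using closure_subset_eq by blast
qed

lemma rational_periodsI:
  fixes N :: "real measure"
  assumes s: "sets N = sets borel"
    and eq: "\<And>a b. a \<in> \<rat> \<Longrightarrow> b \<in> \<rat> \<Longrightarrow> emeasure N {a + t<..<b + t} = emeasure N {a<..<b}"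
  shows "t \<in> periods N"
proof -
  have between: "\<exists>a'\<in>\<rat>. \<exists>b'\<in>\<rat>. a < a' \<and> a' < a + e \<and> b - e < b' \<and> b' < b" if "e > 0" for a b e :: real
    using Rats_dense_in_real[of a "a + e"] Rats_dense_in_real[of "b - e" b] that by auto
  show ?thesis
    unfolding periods_def
  proof (intro CollectI allI antisym)
    fix a b
    show "emeasure N {a + t<..<b + t} \<le> emeasure N {a<..<b}"
    proof (rule emeasure_interval_le[OF s])
      fix e :: real assume "e > 0"
      then obtain a' b' where ab: "a' \<in> \<rat>" "b' \<in> \<rat>" "a < a'" "a' < a + e" "b - e < b'" "b' < b" using between[of e a b] by blast
      have "emeasure N {a + t + e<..<b + t - e} \<le> emeasure N {a' + t<..<b' + t}"
        using ab by (intro emeasure_interval_mono[OF s]) auto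
      also have "\<dots> = emeasure N {a'<..<b'}" using ab by (intro eq)
      also have "\<dots> \<le> emeasure N {a<..<b}" using ab by (intro emeasure_interval_mono[OF s]) auto
      finally show "emeasure N {a + t + e<..<b + t - e} \<le> emeasure N {a<..<b}" .
    qed
    show "emeasure N {a<..<b} \<le> emeasure N {a + t<..<b + t}"
    proof (rule emeasure_interval_le[OF s])
      fix e :: real assume "e > 0"
      then obtain a' b' where ab: "a' \<in> \<rat>" "b' \<in> \<rat>" "a < a'" "a' < a + e" "b - e < b'" "b' < b" using between[of e a b] by blast
      have "emeasure N {a + e<..<b - e} \<le> emeasure N {a'<..<b'}"
        using ab by (intro emeasure_interval_mono[OF s]) auto
      also have "\<dots> = emeasure N {a' + t<..<b' + t}" using ab by (intro eq[symmetric])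
      also have "\<dots> \<le> emeasure N {a + t<..<b + t}" using ab by (intro emeasure_interval_mono[OF s]) auto
      finally show "emeasure N {a + e<..<b - e} \<le> emeasure N {a + t<..<b + t}" .
    qed
  qed
qed

text \<open>Open intervals form an intersection-stable generator, and local finiteness provides the
  exhaustion needed to extend invariance to all Borel functions.\<close>

lemma nn_integral_periods:
  fixes N :: "real measure"
  assumes s: "sets N = sets borel" and fin: "\<And>r. emeasure N {-r..r} < \<infinity>"
    and t: "t \<in> periods N" and f[measurable]: "f \<in> borel_measurable borel"
  shows "(\<integral>\<^sup>+x. f (x + t) \<partial>N) = (\<integral>\<^sup>+x. f x \<partial>N)"
proof -
  note [measurable_cong] = s
  let ?E = "range (\<lambda>(a, b). {a<..<b::real})"
  have "distr N borel (\<lambda>x. x + t) = N"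
  proof (rule measure_eqI_generator_eq[of ?E UNIV _ _ "\<lambda>n. {- real n<..<real n}"])
    show "Int_stable ?E"
    proof (rule Int_stableI)
      fix A B assume "A \<in> ?E" "B \<in> ?E"
      then obtain a b c d where "A = {a<..<b}" "B = {c<..<d}" by auto
      then have "A \<inter> B = {max a c<..<min b d}" by auto
      then show "A \<inter> B \<in> ?E" by (auto intro: image_eqI[of _ _ "(max a c, min b d)"])
    qed
    have sb: "sets borel = sigma_sets UNIV ?E"
      using arg_cong[OF borel_eq_box[where 'a=real], of sets] by (simp add: box_real)
    show "sets (distr N borel (\<lambda>x. x + t)) = sigma_sets UNIV ?E" "sets N = sigma_sets UNIV ?E"
      using s sb by simp_all
    have eq: "emeasure (distr N borel (\<lambda>x. x + t)) {a<..<b} = emeasure N {a<..<b}" for a b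
    proof -
      have "emeasure (distr N borel (\<lambda>x. x + t)) {a<..<b} = emeasure N ((\<lambda>x. x + t) -` {a<..<b} \<inter> space N)"
        by (rule emeasure_distr) auto
      also have "(\<lambda>x. x + t) -` {a<..<b} \<inter> space N = {a + - t<..<b + - t}"
        using sets_eq_imp_space_eq[OF s] by auto
      also have "emeasure N \<dots> = emeasure N {a<..<b}"
        using periods_uminus[OF t] unfolding periods_def by blast
      finally show ?thesis .
    qed
    show "emeasure (distr N borel (\<lambda>x. x + t)) A = emeasure N A" if "A \<in> ?E" for A using that eq by auto
    show "(\<Union>n. {- real n<..<real n}) = UNIV"
    proof (intro equalityI subsetI)
      fix x :: real
      obtain n where "\<bar>x\<bar> < real n" using reals_Archimedean2 by blast
      then show "x \<in> (\<Union>n. {- real n<..<real n})" by (intro UN_I[of n]) auto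
    qed simp
    show "emeasure (distr N borel (\<lambda>x. x + t)) {- real n<..<real n} \<noteq> \<infinity>" for n
    proof -
      have "emeasure N {- real n<..<real n} \<le> emeasure N {- real n..real n}"
        using s by (intro emeasure_mono) auto
      then show ?thesis using fin[of "real n"] unfolding eq by (auto simp: top_unique)
    qed
  qed auto
  then have "(\<integral>\<^sup>+x. f x \<partial>N) = (\<integral>\<^sup>+x. f x \<partial>distr N borel (\<lambda>x. x + t))" by simp
  also have "\<dots> = (\<integral>\<^sup>+x. f (x + t) \<partial>N)" by (rule nn_integral_distr) auto
  finally show ?thesis by simp
qed

text \<open>The double integral of F(x) G(x + y) against both measures is evaluated in two orders,
  with F the indicator of a symmetric interval and G that of \<open>B\<close>. The product form
  avoids dividing by a mass that may be zero.\<close>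

lemma grid_haar_unique:
  fixes N :: "real measure"
  assumes s: "sets N = sets borel" and fin: "\<And>r. emeasure N {-r..r} < \<infinity>"
    and d: "d \<ge> 0" and NZ: "AE z in N. z \<in> grid d" and per: "grid d \<subseteq> periods N"
    and B[measurable]: "B \<in> sets borel"
  shows "emeasure (grid_haar d) {-1..1} * emeasure N B = emeasure (grid_haar d) B * emeasure N {-1..1}"
proof -
  let ?H = "grid_haar d"
  interpret N: sigma_finite_measure N using s fin by (rule sigma_finite_locally_finite)
  interpret H: sigma_finite_measure ?H using d by (rule sigma_finite_grid_haar)
  interpret pair_sigma_finite N ?H ..
  note [measurable_cong] = s sets_grid_haar
  define F :: "real \<Rightarrow> ennreal" where "F = indicator {-1..1}"
  define G :: "real \<Rightarrow> ennreal" where "G = indicator B"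
  have F[measurable]: "F \<in> borel_measurable borel" and G[measurable]: "G \<in> borel_measurable borel"
    by (simp_all add: F_def G_def)
  have sym: "F (- x) = F x" for x by (auto simp: F_def split: split_indicator)
  note shift = nn_integral_periods[OF s fin]
  have NG: "(\<integral>\<^sup>+y. G (y + x) \<partial>N) = emeasure N B" if "x \<in> grid d" for x
    using shift[OF _ G, of x] per that s by (auto simp: G_def)
  have NF: "(\<integral>\<^sup>+y. F (x - y) \<partial>N) = emeasure N {-1..1}" if "x \<in> grid d" for x
  proof -
    have "(\<integral>\<^sup>+y. F (x - y) \<partial>N) = (\<integral>\<^sup>+y. F (y + - x) \<partial>N)"
      using sym by (intro nn_integral_cong) (metis minus_diff_eq diff_conv_add_uminus)
    also have "\<dots> = (\<integral>\<^sup>+y. F y \<partial>N)" using per grid_minus[OF that] by (intro shift F) auto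
    finally show ?thesis using s by (simp add: F_def)
  qed
  have "emeasure ?H {-1..1} * emeasure N B = (\<integral>\<^sup>+x. F x * emeasure N B \<partial>?H)"
    by (simp add: nn_integral_multc F_def)
  also have "\<dots> = (\<integral>\<^sup>+x. \<integral>\<^sup>+y. F x * G (y + x) \<partial>N \<partial>?H)"
    by (rule nn_integral_cong_AE, rule eventually_mono[OF AE_grid_haar[OF d]]) (simp add: nn_integral_cmult NG)
  also have "\<dots> = (\<integral>\<^sup>+y. \<integral>\<^sup>+x. F x * G (y + x) \<partial>?H \<partial>N)"
    by (rule Fubini') measurable
  also have "\<dots> = (\<integral>\<^sup>+y. \<integral>\<^sup>+x. F (x - y) * G x \<partial>?H \<partial>N)"
  proof (rule nn_integral_cong_AE, rule eventually_mono[OF NZ])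
    fix y assume "y \<in> grid d"
    from nn_integral_grid_haar_shift[OF d _ this, of "\<lambda>x. F (x - y) * G x"]
    show "(\<integral>\<^sup>+x. F x * G (y + x) \<partial>?H) = (\<integral>\<^sup>+x. F (x - y) * G x \<partial>?H)"
      by (simp add: add.commute)
  qed
  also have "\<dots> = (\<integral>\<^sup>+x. \<integral>\<^sup>+y. F (x - y) * G x \<partial>N \<partial>?H)"
    by (rule Fubini'[symmetric]) measurable
  also have "\<dots> = (\<integral>\<^sup>+x. G x * emeasure N {-1..1} \<partial>?H)"
    by (rule nn_integral_cong_AE, rule eventually_mono[OF AE_grid_haar[OF d]]) (simp add: nn_integral_multc NF mult.commute[of "G _"])
  also have "\<dots> = emeasure ?H B * emeasure N {-1..1}"
    by (simp add: nn_integral_multc G_def)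
  finally show ?thesis .
qed

section \<open>Uniqueness\<close>

lemma transl_vanishes_on:
  assumes FS: "AE x in F. x \<in> S" and add: "\<And>x y. x \<in> S \<Longrightarrow> y \<in> S \<Longrightarrow> x + y \<in> S"
    and f: "\<And>x. x \<in> S \<Longrightarrow> f x = 0" and x: "x \<in> S"
  shows "transl F f x = 0"
  unfolding transl_def
  by (rule nn_integral_eq_0I, rule eventually_mono[OF FS]) (simp add: f add x)

lemma (in drifting_walk) pot_vanishes_on:
  assumes US: "AE x in U. x \<in> S" and DS: "AE x in D. x \<in> S" and add: "\<And>x y. x \<in> S \<Longrightarrow> y \<in> S \<Longrightarrow> x + y \<in> S"
    and f: "\<And>x. x \<in> S \<Longrightarrow> f x = 0" and x: "x \<in> S"
  shows "pot f x = 0"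
proof -
  have "(transl D ^^ k) (transl U f) x = 0" if "x \<in> S" for k x
    using that
  proof (induction k arbitrary: x)
    case 0
    then show ?case using transl_vanishes_on[OF US add f] by simp
  next
    case (Suc k)
    then show ?case using transl_vanishes_on[OF DS add Suc.IH] by simp
  qed
  then show ?thesis using x by (simp add: pot_def V_def)
qed

context switching_walk
begin

text \<open>The measure \<open>Q\<^sup>+ * \<Sum>\<^sub>n L'\<^sup>*\<^sup>n + Q\<^sup>- * \<Sum>\<^sub>n L\<^sup>*\<^sup>n\<close>, in ladder height form. For invariant \<open>Q\<close> it is
  harmonic for both walks, hence a multiple of Haar measure.\<close>
definition W_measure :: "real measure \<Rightarrow> real measure" where
  "W_measure Q = suminf_measure (\<lambda>n. add_measure
     (convolution (convolution (pos_part \<alpha> Q) W'.U) (conv_power W'.D n))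
     (convolution (convolution (neg_part \<alpha> Q) W.U) (conv_power W.D n)))"

lemma sets_W_measure [simp]: "sets (W_measure Q) = sets borel"
  by (simp add: W_measure_def)

lemma nn_integral_W:
  assumes Q: "finite_borel Q" and f: "f \<in> borel_measurable borel"
  shows "(\<integral>\<^sup>+x. f x \<partial>W_measure Q) = (\<integral>\<^sup>+x. W'.pot f x \<partial>pos_part \<alpha> Q) + (\<integral>\<^sup>+x. W.pot f x \<partial>neg_part \<alpha> Q)"
proof -
  note fin = finite_parts[OF Q]
  have one: "(\<integral>\<^sup>+x. f x \<partial>convolution (convolution P U) (conv_power D n)) = (\<integral>\<^sup>+x. (transl D ^^ n) (transl U f) x \<partial>P)"
    if P: "finite_borel P" and U: "finite_borel U" and D: "finite_borel D" for P U D n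
  proof -
    have m: "transl (conv_power D n) f \<in> borel_measurable borel"
      by (rule measurable_transl[OF finite_borel_conv_power[OF D] f])
    have c: "transl U (transl (conv_power D n) f) = (transl D ^^ n) (transl U f)"
      using transl_commute[OF U finite_borel_conv_power[OF D] f] transl_conv_power[OF D measurable_transl[OF U f], of n]
      by simp
    show ?thesis
      unfolding nn_integral_convolution_transl[OF finite_borel_convolution[OF P U] finite_borel_conv_power[OF D] f]
        nn_integral_convolution_transl[OF P U m] c ..
  qed
  have meas: "(transl D ^^ n) (transl U f) \<in> borel_measurable P"
    if "finite_borel P" "finite_borel U" "finite_borel D" for P U D n
    by (rule measurable_finite_borel[OF that(1)], rule measurable_transl_power[OF that(3)], rule measurable_transl[OF that(2) f])
  have "(\<integral>\<^sup>+x. f x \<partial>W_measure Q) = (\<Sum>n. \<integral>\<^sup>+x. f x \<partial>add_measure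
     (convolution (convolution (pos_part \<alpha> Q) W'.U) (conv_power W'.D n))
     (convolution (convolution (neg_part \<alpha> Q) W.U) (conv_power W.D n)))"
    unfolding W_measure_def
  proof (rule nn_integral_suminf_measure)
    show "f \<in> borel_measurable (add_measure
     (convolution (convolution (pos_part \<alpha> Q) W'.U) (conv_power W'.D 0))
     (convolution (convolution (neg_part \<alpha> Q) W.U) (conv_power W.D 0)))"
      using f by (simp cong: measurable_cong_sets)
  qed simp
  also have "\<dots> = (\<Sum>n. (\<integral>\<^sup>+x. (transl W'.D ^^ n) (transl W'.U f) x \<partial>pos_part \<alpha> Q) + (\<integral>\<^sup>+x. (transl W.D ^^ n) (transl W.U f) x \<partial>neg_part \<alpha> Q))"
    by (rule suminf_cong, subst nn_integral_add_measure) (simp_all add: f one fin W.U W.D W'.U W'.D)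
  also have "\<dots> = (\<Sum>n. \<integral>\<^sup>+x. (transl W'.D ^^ n) (transl W'.U f) x \<partial>pos_part \<alpha> Q) + (\<Sum>n. \<integral>\<^sup>+x. (transl W.D ^^ n) (transl W.U f) x \<partial>neg_part \<alpha> Q)"
    by (rule suminf_add[OF summableI summableI, symmetric])
  also have "\<dots> = (\<integral>\<^sup>+x. W'.pot f x \<partial>pos_part \<alpha> Q) + (\<integral>\<^sup>+x. W.pot f x \<partial>neg_part \<alpha> Q)"
    unfolding W.pot_def W'.pot_def W.V_def W'.V_def
    by (subst (1 2) nn_integral_suminf) (simp_all add: meas fin W.U W.D W'.U W'.D)
  finally show ?thesis .
qed

text \<open>The test functions against which \<open>W\<close> can be used: bounded potentials for
  both walks make every integral occurring below finite. The class contains indicators of bounded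
  Borel sets and is stable under finite translation operators.\<close>

definition tame :: "(real \<Rightarrow> ennreal) \<Rightarrow> bool" where
  "tame f \<longleftrightarrow> f \<in> borel_measurable borel \<and> (\<exists>c<\<infinity>. \<forall>x. W.pot f x \<le> c) \<and> (\<exists>c<\<infinity>. \<forall>x. W'.pot f x \<le> c)"

lemma tameD: "tame f \<Longrightarrow> f \<in> borel_measurable borel"
  by (simp add: tame_def)

lemma tame_mono:
  assumes f: "tame f" and g: "g \<in> borel_measurable borel" and le: "\<And>x. g x \<le> f x"
  shows "tame g"
proof -
  have "W.pot g x \<le> W.pot f x" "W'.pot g x \<le> W'.pot f x" for x
    unfolding W.pot_def W'.pot_def by (intro W.V_mono W'.V_mono transl_mono le)+
  then show ?thesis using f g unfolding tame_def by (meson order_trans)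
qed

lemma tame_indicator:
  assumes B: "B \<in> sets borel" "B \<subseteq> {-r..r}"
  shows "tame (indicator B)"
proof -
  have "tame (indicator {-r..r})"
    using W.pot_bounded[of r] W'.pot_bounded[of r] by (simp add: tame_def)
  then show ?thesis
    by (rule tame_mono) (use B in \<open>auto split: split_indicator\<close>)
qed

lemma tame_transl:
  assumes F: "finite_borel F" and f: "tame f"
  shows "tame (transl F f)"
proof -
  have m: "f \<in> borel_measurable borel" by (rule tameD[OF f])
  obtain c c' where c: "c < \<infinity>" "\<And>x. W.pot f x \<le> c" "c' < \<infinity>" "\<And>x. W'.pot f x \<le> c'"
    using f unfolding tame_def by blast
  have "W.pot (transl F f) x \<le> c * emeasure F UNIV" "W'.pot (transl F f) x \<le> c' * emeasure F UNIV" for x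
    unfolding W.transl_pot[OF F m, symmetric] W'.transl_pot[OF F m, symmetric]
    by (rule transl_le_mult[OF F c(2)], rule transl_le_mult[OF F c(4)])
  then show ?thesis
    unfolding tame_def using measurable_transl[OF F m] mult_emeasure_finite[OF F c(1)] mult_emeasure_finite[OF F c(3)] by blast
qed

lemma tame_finite:
  assumes f: "tame f" and P: "finite_borel P"
  shows "(\<integral>\<^sup>+x. W.pot f x \<partial>P) \<noteq> \<top>" "(\<integral>\<^sup>+x. W'.pot f x \<partial>P) \<noteq> \<top>"
    "(\<integral>\<^sup>+x. W.V f x \<partial>P) \<noteq> \<top>" "(\<integral>\<^sup>+x. W'.V f x \<partial>P) \<noteq> \<top>"
    "W.V f x \<noteq> \<top>" "W'.V f x \<noteq> \<top>" "(\<integral>\<^sup>+x. f x \<partial>P) \<noteq> \<top>"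
proof -
  have m: "f \<in> borel_measurable borel" by (rule tameD[OF f])
  obtain c c' where c: "c < \<infinity>" "\<And>x. W.pot f x \<le> c" "c' < \<infinity>" "\<And>x. W'.pot f x \<le> c'"
    using f unfolding tame_def by blast
  have V: "W.V f x \<le> c" "W'.V f x \<le> c'" for x
    using W.V_le_pot[OF m, of x] W'.V_le_pot[OF m, of x] c(2)[of x] c(4)[of x] by (auto intro: order_trans)
  have f': "f x \<le> c" for x using W.le_V[OF m, of x] V(1)[of x] by (rule order_trans)
  have ne: "(\<integral>\<^sup>+x. g x \<partial>P) \<noteq> \<top>" if "\<And>x. g x \<le> c''" "c'' < \<infinity>" for g :: "real \<Rightarrow> ennreal" and c''
    using nn_integral_finite[where f=g, OF P that] by simp
  show "(\<integral>\<^sup>+x. W.pot f x \<partial>P) \<noteq> \<top>" by (rule ne[OF c(2,1)])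
  show "(\<integral>\<^sup>+x. W'.pot f x \<partial>P) \<noteq> \<top>" by (rule ne[OF c(4,3)])
  show "(\<integral>\<^sup>+x. W.V f x \<partial>P) \<noteq> \<top>" by (rule ne[OF V(1) c(1)])
  show "(\<integral>\<^sup>+x. W'.V f x \<partial>P) \<noteq> \<top>" by (rule ne[OF V(2) c(3)])
  show "(\<integral>\<^sup>+x. f x \<partial>P) \<noteq> \<top>" by (rule ne[OF f' c(1)])
  show "W.V f x \<noteq> \<top>" using V(1)[of x] c(1) by (auto simp: top_unique)
  show "W'.V f x \<noteq> \<top>" using V(2)[of x] c(3) by (auto simp: top_unique)
qed

lemma W_finite:
  assumes Q: "finite_borel Q" and f: "tame f"
  shows "(\<integral>\<^sup>+x. f x \<partial>W_measure Q) \<noteq> \<top>"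
  unfolding nn_integral_W[OF Q tameD[OF f]] using tame_finite[OF f] finite_parts[OF Q] by simp

lemma tame_shift:
  assumes f: "tame f" shows "tame (\<lambda>y. f (x + y))"
proof -
  have [measurable]: "f \<in> borel_measurable borel" by (rule tameD[OF f])
  have "transl (return borel x) f = (\<lambda>y. f (x + y))"
    unfolding transl_def by (rule ext, subst nn_integral_return) (simp_all add: add.commute)
  then show ?thesis using tame_transl[OF finite_borel_return f, of x] by simp
qed

section \<open>Harmonicity and translation invariance of \<open>W\<close>\<close>

lemma nn_integral_parts_split:
  assumes Q: "finite_borel Q" and f[measurable]: "f \<in> borel_measurable borel"
  shows "(\<integral>\<^sup>+x. f x \<partial>pos_part \<alpha> Q) + (\<integral>\<^sup>+x. f x \<partial>neg_part \<alpha> Q) = (\<integral>\<^sup>+x. f x \<partial>Q)"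
proof -
  note [measurable_cong] = finite_borel_sets[OF Q]
  show ?thesis
    unfolding nn_integral_part[OF finite_borel_sets[OF Q] f]
    by (subst nn_integral_add[symmetric]) (auto simp: distrib_right[symmetric] weights_sum)
qed

lemma nn_integral_invariant:
  assumes Q: "finite_borel Q" and inv: "step Q = Q" and f: "f \<in> borel_measurable borel"
  shows "(\<integral>\<^sup>+x. transl L f x \<partial>pos_part \<alpha> Q) + (\<integral>\<^sup>+x. transl L' f x \<partial>neg_part \<alpha> Q)
    = (\<integral>\<^sup>+x. f x \<partial>pos_part \<alpha> Q) + (\<integral>\<^sup>+x. f x \<partial>neg_part \<alpha> Q)"
  using nn_integral_step[OF Q f] measurable_transl[OF W.L f] measurable_transl[OF W'.L f]
  by (simp add: nn_integral_parts_split[OF Q f] inv nn_integral_part[OF finite_borel_sets[OF Q]])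

lemma W_harmonic:
  assumes Q: "finite_borel Q" and inv: "step Q = Q" and f: "tame f"
  shows "(\<integral>\<^sup>+x. transl L f x \<partial>W_measure Q) = (\<integral>\<^sup>+x. f x \<partial>W_measure Q)"
    and "(\<integral>\<^sup>+x. transl L' f x \<partial>W_measure Q) = (\<integral>\<^sup>+x. f x \<partial>W_measure Q)"
proof -
  let ?P = "pos_part \<alpha> Q" and ?M = "neg_part \<alpha> Q"
  note fin = finite_parts[OF Q]
  have m: "f \<in> borel_measurable borel" by (rule tameD[OF f])
  have mp: "W.pot f \<in> borel_measurable borel" "W'.pot f \<in> borel_measurable borel"
    by (rule W.pot_measurable[OF m], rule W'.pot_measurable[OF m])
  have mF: "g \<in> borel_measurable F" if "finite_borel F" "g \<in> borel_measurable borel" for g :: "real \<Rightarrow> ennreal" and F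
    by (rule measurable_finite_borel[OF that])
  have potL: "(\<integral>\<^sup>+x. W.pot f x \<partial>F) = (\<integral>\<^sup>+x. transl L (W.pot f) x \<partial>F) + (\<integral>\<^sup>+x. f x \<partial>F)"
    and potL': "(\<integral>\<^sup>+x. W'.pot f x \<partial>F) = (\<integral>\<^sup>+x. transl L' (W'.pot f) x \<partial>F) + (\<integral>\<^sup>+x. f x \<partial>F)"
    if F: "finite_borel F" for F
    using W.pot_L[OF m tame_finite(5)[OF f F]] W'.pot_L[OF m tame_finite(6)[OF f F]]
    by (simp_all add: nn_integral_add[symmetric] mF[OF F] m measurable_transl W.L W'.L mp)
  have ne: "(\<integral>\<^sup>+x. transl K (W.pot f) x \<partial>F) \<noteq> \<top>" "(\<integral>\<^sup>+x. transl K (W'.pot f) x \<partial>F) \<noteq> \<top>"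
    if "finite_borel K" "finite_borel F" for K F
    using tame_finite(1,2)[OF tame_transl[OF that(1) f] that(2)]
    unfolding W.transl_pot[OF that(1) m] W'.transl_pot[OF that(1) m] .
  have nf: "(\<integral>\<^sup>+x. f x \<partial>?P) \<noteq> \<top>" "(\<integral>\<^sup>+x. f x \<partial>?M) \<noteq> \<top>"
    using tame_finite(7)[OF f fin(1)] tame_finite(7)[OF f fin(2)] .
  \<comment> \<open>Invariance is tested on the potential \<open>W'.pot f\<close>, and
    \<open>L'\<close> is then removed by \<open>pot_L\<close>. In signed form the outcome is
    \<open>Q\<^sup>+ * G' * (\<delta> - L) = - Q\<^sup>-\<close>, with G' the Green measure of
    \<open>L'\<close>.\<close>
  have "(\<integral>\<^sup>+x. transl L' (W'.pot f) x \<partial>?M) + (\<integral>\<^sup>+x. transl L (W'.pot f) x \<partial>?P) =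
      (\<integral>\<^sup>+x. transl L' (W'.pot f) x \<partial>?M) + ((\<integral>\<^sup>+x. W'.pot f x \<partial>?P) + (\<integral>\<^sup>+x. f x \<partial>?M))"
    using nn_integral_invariant[OF Q inv mp(2)] unfolding potL'[OF fin(2)] by (simp only: ac_simps)
  then have 1: "(\<integral>\<^sup>+x. transl L (W'.pot f) x \<partial>?P) = (\<integral>\<^sup>+x. W'.pot f x \<partial>?P) + (\<integral>\<^sup>+x. f x \<partial>?M)"
    using ne(2)[OF W'.L fin(2)] by (simp only: ennreal_add_left_cancel infinity_ennreal_def simp_thms)
  have "(\<integral>\<^sup>+x. f x \<partial>?M) + (\<integral>\<^sup>+x. transl L f x \<partial>W_measure Q) = (\<integral>\<^sup>+x. f x \<partial>?M) + (\<integral>\<^sup>+x. f x \<partial>W_measure Q)"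
    unfolding nn_integral_W[OF Q m] nn_integral_W[OF Q measurable_transl[OF W.L m]]
      W.transl_pot[OF W.L m, symmetric] W'.transl_pot[OF W.L m, symmetric] 1 potL[OF fin(2)]
    by (simp only: ac_simps)
  then show "(\<integral>\<^sup>+x. transl L f x \<partial>W_measure Q) = (\<integral>\<^sup>+x. f x \<partial>W_measure Q)"
    using nf(2) by (simp only: ennreal_add_left_cancel infinity_ennreal_def simp_thms)
  have "(\<integral>\<^sup>+x. transl L (W.pot f) x \<partial>?P) + (\<integral>\<^sup>+x. transl L' (W.pot f) x \<partial>?M) =
      (\<integral>\<^sup>+x. transl L (W.pot f) x \<partial>?P) + ((\<integral>\<^sup>+x. W.pot f x \<partial>?M) + (\<integral>\<^sup>+x. f x \<partial>?P))"
    using nn_integral_invariant[OF Q inv mp(1)] unfolding potL[OF fin(1)] by (simp only: ac_simps)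
  then have 2: "(\<integral>\<^sup>+x. transl L' (W.pot f) x \<partial>?M) = (\<integral>\<^sup>+x. W.pot f x \<partial>?M) + (\<integral>\<^sup>+x. f x \<partial>?P)"
    using ne(1)[OF W.L fin(1)] by (simp only: ennreal_add_left_cancel infinity_ennreal_def simp_thms)
  have "(\<integral>\<^sup>+x. f x \<partial>?P) + (\<integral>\<^sup>+x. transl L' f x \<partial>W_measure Q) = (\<integral>\<^sup>+x. f x \<partial>?P) + (\<integral>\<^sup>+x. f x \<partial>W_measure Q)"
    unfolding nn_integral_W[OF Q m] nn_integral_W[OF Q measurable_transl[OF W'.L m]]
      W.transl_pot[OF W'.L m, symmetric] W'.transl_pot[OF W'.L m, symmetric] 2 potL'[OF fin(1)]
    by (simp only: ac_simps)
  then show "(\<integral>\<^sup>+x. transl L' f x \<partial>W_measure Q) = (\<integral>\<^sup>+x. f x \<partial>W_measure Q)"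
    using nf(1) by (simp only: ennreal_add_left_cancel infinity_ennreal_def simp_thms)
qed

lemma W_locally_finite:
  assumes Q: "finite_borel Q" shows "emeasure (W_measure Q) {-r..r} < \<infinity>"
  using W_finite[OF Q tame_indicator[of "{-r..r}" r]] by (simp add: less_top[symmetric])

text \<open>The potentials of \<open>f\<close> are bounded uniformly in the starting point, so
  translating \<open>f\<close> does not change the bound. This makes x \<mapsto>
  \<open>transl (W_measure Q) f x\<close> a bounded harmonic function.\<close>

lemma W_bounded:
  assumes Q: "finite_borel Q" and f: "tame f"
  shows "\<exists>c<\<infinity>. \<forall>x. transl (W_measure Q) f x \<le> c"
proof -
  have m: "f \<in> borel_measurable borel" by (rule tameD[OF f])
  note fin = finite_parts[OF Q]
  obtain c c' where c: "c < \<infinity>" "\<And>x. W.pot f x \<le> c" "c' < \<infinity>" "\<And>x. W'.pot f x \<le> c'"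
    using f unfolding tame_def by blast
  have sh: "W.pot (\<lambda>y. f (x + y)) = (\<lambda>z. W.pot f (x + z))" "W'.pot (\<lambda>y. f (x + y)) = (\<lambda>z. W'.pot f (x + z))" for x
  proof -
    have tf: "transl F (\<lambda>y. f (x + y)) = (\<lambda>y. transl F f (x + y))" for F
      by (rule ext) (simp add: transl_def add.assoc)
    show "W.pot (\<lambda>y. f (x + y)) = (\<lambda>z. W.pot f (x + z))"
      by (rule ext) (simp only: W.pot_def tf W.V_shift)
    show "W'.pot (\<lambda>y. f (x + y)) = (\<lambda>z. W'.pot f (x + z))"
      by (rule ext) (simp only: W'.pot_def tf W'.V_shift)
  qed
  have "transl (W_measure Q) f x \<le> c' * emeasure (pos_part \<alpha> Q) UNIV + c * emeasure (neg_part \<alpha> Q) UNIV" for x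
  proof -
    have "(\<lambda>y. f (x + y)) \<in> borel_measurable borel" using m by measurable
    then have "transl (W_measure Q) f x = transl (pos_part \<alpha> Q) (W'.pot f) x + transl (neg_part \<alpha> Q) (W.pot f) x"
      unfolding transl_def[of "W_measure Q"] by (subst nn_integral_W[OF Q]) (simp_all add: sh transl_def)
    also have "\<dots> \<le> c' * emeasure (pos_part \<alpha> Q) UNIV + c * emeasure (neg_part \<alpha> Q) UNIV"
      by (intro add_mono transl_le_mult fin c)
    finally show ?thesis .
  qed
  moreover have "c' * emeasure (pos_part \<alpha> Q) UNIV + c * emeasure (neg_part \<alpha> Q) UNIV < \<infinity>"
    using mult_emeasure_finite[OF fin(1) c(3)] mult_emeasure_finite[OF fin(2) c(1)] by simp
  ultimately show ?thesis by blast
qed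

lemma W_AE_shift:
  assumes Q: "finite_borel Q" and inv: "step Q = Q" and f: "tame f"
    and K: "K = L \<or> K = L'"
  shows "AE y in K. transl (W_measure Q) f y = transl (W_measure Q) f 0"
proof -
  let ?W = "W_measure Q"
  have m[measurable]: "f \<in> borel_measurable borel" by (rule tameD[OF f])
  have Kp: "prob_space K" "sets K = sets borel" "finite_borel K"
    using K W.L_prob W'.L_prob W.L_sets W'.L_sets W.L W'.L by auto
  interpret W: sigma_finite_measure ?W by (rule sigma_finite_locally_finite[OF sets_W_measure W_locally_finite[OF Q]])
  interpret K: prob_space K by (rule Kp(1))
  interpret pair_sigma_finite ?W K ..
  note [measurable_cong] = Kp(2) sets_W_measure
  have meas[measurable]: "transl ?W f \<in> borel_measurable borel" unfolding transl_def by measurable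
  obtain c where c: "c < \<infinity>" "\<And>x. transl ?W f x \<le> c" using W_bounded[OF Q f] by blast
  define h where "h x = enn2real (transl ?W f x)" for x
  have h: "ennreal (h x) = transl ?W f x" for x
    unfolding h_def using c(1) c(2)[of x] by (intro ennreal_enn2real) (auto simp: less_top[symmetric] top_unique)
  have harm: "transl K (transl ?W f) x = transl ?W f x" for x
  proof -
    have "transl K (transl ?W f) x = (\<integral>\<^sup>+y. \<integral>\<^sup>+z. f (x + y + z) \<partial>?W \<partial>K)" by (simp add: transl_def)
    also have "\<dots> = (\<integral>\<^sup>+z. \<integral>\<^sup>+y. f (x + y + z) \<partial>K \<partial>?W)" by (rule Fubini') measurable
    also have "\<dots> = (\<integral>\<^sup>+z. transl K (\<lambda>y. f (x + y)) z \<partial>?W)" by (simp add: transl_def ac_simps)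
    also have "\<dots> = transl ?W f x"
      using W_harmonic[OF Q inv tame_shift[OF f]] K by (auto simp: transl_def[of ?W])
    finally show ?thesis .
  qed
  have "AE y in K. h (0 + y) = h 0"
  proof (rule bounded_harmonic_AE[OF Kp(1,2)])
    show "h \<in> borel_measurable borel" unfolding h_def by measurable
    show "\<bar>h x\<bar> \<le> enn2real c" for x
      unfolding h_def using c(1) c(2)[of x] by (simp add: enn2real_mono)
    show "(\<integral>y. h (x + y) \<partial>K) = h x" for x
    proof -
      have "(\<integral>y. h (x + y) \<partial>K) = enn2real (\<integral>\<^sup>+y. ennreal (h (x + y)) \<partial>K)"
        by (rule integral_eq_nn_integral) (auto simp: h_def)
      also have "(\<integral>\<^sup>+y. ennreal (h (x + y)) \<partial>K) = transl K (transl ?W f) x"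
        by (simp add: h transl_def[of K])
      finally show ?thesis unfolding harm h_def .
    qed
  qed
  then show ?thesis
    by (rule eventually_mono) (metis h add_0)
qed

text \<open>The periods inside \<open>Z\<close> form a closed subgroup that carries both step laws,
  and it is nontrivial as \<open>L\<close> is not the point mass at 0. Maximality of
  \<open>d\<close> leaves nothing smaller than \<open>Z\<close>.\<close>

lemma W_periods:
  assumes Q: "finite_borel Q" and inv: "step Q = Q"
  shows "Z \<subseteq> periods (W_measure Q)"
proof -
  let ?W = "W_measure Q" and ?T = "periods (W_measure Q)"
  have T: "AE y in K. y \<in> ?T" if K: "K = L \<or> K = L'" for K
  proof -
    have 1: "AE y in K. emeasure ?W {a + - y<..<b + - y} = emeasure ?W {a<..<b}" for a b
    proof -
      have tr: "transl ?W (indicator {a<..<b}) y = emeasure ?W {a + - y<..<b + - y}" for y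
      proof -
        have "transl ?W (indicator {a<..<b}) y = (\<integral>\<^sup>+z. indicator {a + - y<..<b + - y} z \<partial>?W)"
          unfolding transl_def by (intro nn_integral_cong) (auto split: split_indicator)
        then show ?thesis by simp
      qed
      have "tame (indicator {a<..<b})"
        by (rule tame_indicator[of _ "max \<bar>a\<bar> \<bar>b\<bar>"]) auto
      from W_AE_shift[OF Q inv this K] show ?thesis unfolding tr by simp
    qed
    \<comment> \<open>One exceptional null set now serves all intervals with rational
      endpoints.\<close>
    have "AE y in K. \<forall>p\<in>\<rat> \<times> \<rat>. emeasure ?W {fst p + - y<..<snd p + - y} = emeasure ?W {fst p<..<snd p}"
      using 1 by (subst AE_ball_countable) (auto intro: countable_rat)
    then show ?thesis
    proof eventually_elim
      case (elim y)
      have "- y \<in> ?T" by (rule rational_periodsI) (use elim in auto)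
      then show "y \<in> ?T" using periods_uminus by force
    qed
  qed
  let ?S = "?T \<inter> Z"
  have cl: "closed ?S" unfolding Z_def by (intro closed_Int closed_periods closed_grid sets_W_measure)
  have diff: "x - y \<in> ?S" if "x \<in> ?S" "y \<in> ?S" for x y
    using that periods_diff grid_diff unfolding Z_def by auto
  have LS: "AE x in L. x \<in> ?S" using T[of L] L_grid by auto
  have L'S: "AE x in L'. x \<in> ?S" using T[of L'] L'_grid by auto
  obtain t where t: "t \<in> ?S" "t \<noteq> 0"
  proof (rule ccontr)
    assume "\<not> thesis"
    then have "x \<in> ?S \<Longrightarrow> x = 0" for x using that by blast
    then have "AE x in L. x = 0" by (rule eventually_mono[OF LS])
    then show False using L_nonzero by simp
  qed
  from closed_subgroup_real[OF cl diff t] show ?thesis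
  proof
    assume "?S = UNIV" then show ?thesis by blast
  next
    assume "\<exists>u>0. ?S = grid u"
    then obtain u where u: "u > 0" "?S = grid u" by auto
    \<comment> \<open>Maximality of the span gives u \<le> d, while u \<in> Z makes u a positive
      multiple of d.\<close>
    have "u \<le> d" using u LS L'S by (intro d_max) simp_all
    then have d: "d > 0" using u by simp
    have "u \<in> grid u" using u by (auto simp: grid_pos intro: image_eqI[of _ _ 1])
    then have "u \<in> Z" using u by blast
    then obtain k :: int where k: "u = d * of_int k" using d by (auto simp: Z_def grid_pos)
    then have "0 < k" using u d by (simp add: zero_less_mult_iff)
    then have "1 \<le> (of_int k :: real)" by simp
    then have "d * 1 \<le> d * of_int k" using d by (intro mult_left_mono) auto
    then have "u = d" using k \<open>u \<le> d\<close> by simp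
    then show ?thesis using u by (simp add: Z_def) blast
  qed
qed

lemma AE_parts:
  assumes Q: "finite_borel Q" and S: "S \<in> sets borel" and QS: "AE x in Q. x \<in> S"
  shows "AE x in pos_part \<alpha> Q. 0 \<le> x \<and> x \<in> S" "AE x in neg_part \<alpha> Q. x \<le> 0 \<and> x \<in> S"
proof -
  note s = finite_borel_sets[OF Q]
  have [measurable]: "(\<lambda>x. ennreal (indicator {0<..} x + \<alpha> * indicator {0} x)) \<in> borel_measurable Q"
    "(\<lambda>x. ennreal (indicator {..<0} x + (1 - \<alpha>) * indicator {0} x)) \<in> borel_measurable Q"
    using measurable_finite_borel[OF Q weights_measurable(3)] measurable_finite_borel[OF Q weights_measurable(4)]
    unfolding ip_def[abs_def] im_def[abs_def] .
  show "AE x in pos_part \<alpha> Q. 0 \<le> x \<and> x \<in> S"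
    unfolding pos_part_def
    by (subst AE_density, measurable, rule eventually_mono[OF QS]) (auto simp: indicator_def split: if_splits)
  show "AE x in neg_part \<alpha> Q. x \<le> 0 \<and> x \<in> S"
    unfolding neg_part_def
    by (subst AE_density, measurable, rule eventually_mono[OF QS]) (auto simp: indicator_def split: if_splits)
qed

lemma AE_W:
  assumes Q: "finite_borel Q" and QZ: "AE x in Q. x \<in> Z"
  shows "AE x in W_measure Q. x \<in> Z"
proof -
  note parts = AE_parts[OF Q Z_borel QZ]
  have "(\<integral>\<^sup>+x. W'.pot (indicator (- Z)) x \<partial>pos_part \<alpha> Q) = 0"
    by (rule nn_integral_eq_0I, rule eventually_mono[OF parts(1)], rule W'.pot_vanishes_on[OF U'_grid D'_grid Z_add]) simp_all
  moreover have "(\<integral>\<^sup>+x. W.pot (indicator (- Z)) x \<partial>neg_part \<alpha> Q) = 0"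
    by (rule nn_integral_eq_0I, rule eventually_mono[OF parts(2)], rule W.pot_vanishes_on[OF U_grid D_grid Z_add]) simp_all
  ultimately have "(\<integral>\<^sup>+x. indicator (- Z) x \<partial>W_measure Q) = 0" by (subst nn_integral_W[OF Q]) simp_all
  then have "emeasure (W_measure Q) (- Z) = 0" by simp
  then show ?thesis by (intro AE_I[of _ _ "- Z"]) auto
qed

lemma W_haar:
  assumes Q: "finite_borel Q" and inv: "step Q = Q" and QZ: "AE x in Q. x \<in> Z" and B: "B \<in> sets borel"
  shows "emeasure haar {-1..1} * emeasure (W_measure Q) B = emeasure haar B * emeasure (W_measure Q) {-1..1}"
  by (rule grid_haar_unique[OF sets_W_measure W_locally_finite[OF Q] d_nonneg
        AE_W[OF Q QZ, unfolded Z_def] W_periods[OF Q inv, unfolded Z_def] B])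

section \<open>Recovering \<open>Q\<close> from \<open>W\<close>\<close>

lemma W_exchange:
  assumes R1: "finite_borel R1" and R2: "finite_borel R2"
    and eq: "W_measure R1 = W_measure R2" and f: "tame f"
  shows "((\<integral>\<^sup>+x. W'.V (transl W.A f) x \<partial>pos_part \<alpha> R1) + (\<integral>\<^sup>+x. W.V (transl W'.A f) x \<partial>neg_part \<alpha> R1))
      + ((\<integral>\<^sup>+x. W'.V f x \<partial>pos_part \<alpha> R2) + (\<integral>\<^sup>+x. W.V f x \<partial>neg_part \<alpha> R2))
    = ((\<integral>\<^sup>+x. W'.V (transl W.A f) x \<partial>pos_part \<alpha> R2) + (\<integral>\<^sup>+x. W.V (transl W'.A f) x \<partial>neg_part \<alpha> R2))
      + ((\<integral>\<^sup>+x. W'.V f x \<partial>pos_part \<alpha> R1) + (\<integral>\<^sup>+x. W.V f x \<partial>neg_part \<alpha> R1))"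
proof -
  let ?w = "\<lambda>R g. \<integral>\<^sup>+x. g x \<partial>W_measure R"
  have tA: "tame (transl W.A f)" "tame (transl W'.A f)" "tame (transl W.A (transl W'.A f))"
    by (intro tame_transl W.A W'.A f)+
  note mf = tameD[OF f] and mA = tameD[OF tA(1)] tameD[OF tA(2)] tameD[OF tA(3)]
  define l where "l R = (\<integral>\<^sup>+x. W'.V (transl W.A f) x \<partial>pos_part \<alpha> R) + (\<integral>\<^sup>+x. W.V (transl W'.A f) x \<partial>neg_part \<alpha> R)" for R
  define r where "r R = (\<integral>\<^sup>+x. W'.V f x \<partial>pos_part \<alpha> R) + (\<integral>\<^sup>+x. W.V f x \<partial>neg_part \<alpha> R)" for R
  define u where "u R = ?w R f + ?w R (transl W.A (transl W'.A f))" for R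
  define v where "v R = ?w R (transl W'.A f) + ?w R (transl W.A f)" for R
  \<comment> \<open>Convolving \<open>W\<close> with (\<delta> - A) * (\<delta> - A'), for A =
    \<open>W.A\<close> and A' = \<open>W'.A\<close>, removes the factors \<open>W.U\<close> and
    \<open>W'.U\<close>. Signed, the claim is u - v = r - l, where u and v depend on
    \<open>W\<close> alone and hence agree for \<open>R1\<close> and \<open>R2\<close>.\<close>
  have key: "u R + l R = v R + r R" if R: "finite_borel R" for R
  proof -
    note fin = finite_parts[OF R]
    let ?P = "pos_part \<alpha> R" and ?M = "neg_part \<alpha> R"
    have p: "(\<integral>\<^sup>+x. W'.pot g x \<partial>?P) = (\<integral>\<^sup>+x. W'.V g x \<partial>?P) + (\<integral>\<^sup>+x. W'.pot (transl W'.A g) x \<partial>?P)"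
      and m: "(\<integral>\<^sup>+x. W.pot g x \<partial>?M) = (\<integral>\<^sup>+x. W.V g x \<partial>?M) + (\<integral>\<^sup>+x. W.pot (transl W.A g) x \<partial>?M)"
      if g: "g \<in> borel_measurable borel" for g
    proof -
      have "(\<integral>\<^sup>+x. W'.V g x + W'.pot (transl W'.A g) x \<partial>?P) = (\<integral>\<^sup>+x. W'.V g x \<partial>?P) + (\<integral>\<^sup>+x. W'.pot (transl W'.A g) x \<partial>?P)"
        by (rule nn_integral_add; rule measurable_finite_borel[OF fin(1)];
            intro W'.V_measurable W'.pot_measurable g measurable_transl[OF W'.A g])
      then show "(\<integral>\<^sup>+x. W'.pot g x \<partial>?P) = (\<integral>\<^sup>+x. W'.V g x \<partial>?P) + (\<integral>\<^sup>+x. W'.pot (transl W'.A g) x \<partial>?P)"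
        unfolding W'.pot_split[OF g, symmetric] .
      have "(\<integral>\<^sup>+x. W.V g x + W.pot (transl W.A g) x \<partial>?M) = (\<integral>\<^sup>+x. W.V g x \<partial>?M) + (\<integral>\<^sup>+x. W.pot (transl W.A g) x \<partial>?M)"
        by (rule nn_integral_add; rule measurable_finite_borel[OF fin(2)];
            intro W.V_measurable W.pot_measurable g measurable_transl[OF W.A g])
      then show "(\<integral>\<^sup>+x. W.pot g x \<partial>?M) = (\<integral>\<^sup>+x. W.V g x \<partial>?M) + (\<integral>\<^sup>+x. W.pot (transl W.A g) x \<partial>?M)"
        unfolding W.pot_split[OF g, symmetric] .
    qed
    have c: "transl W'.A (transl W.A f) = transl W.A (transl W'.A f)" by (rule transl_commute[OF W'.A W.A mf])
    show ?thesis
      unfolding u_def v_def l_def r_def nn_integral_W[OF R mf] nn_integral_W[OF R mA(1)] nn_integral_W[OF R mA(2)] nn_integral_W[OF R mA(3)]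
        p[OF mf] p[OF mA(1), unfolded c] m[OF mf] m[OF mA(2)]
      by (simp only: ac_simps)
  qed
  have ne: "u R1 + v R1 \<noteq> \<top>"
    unfolding u_def v_def using W_finite[OF R1 f] W_finite[OF R1 tA(1)] W_finite[OF R1 tA(2)] W_finite[OF R1 tA(3)] by simp
  have e2: "u R2 = u R1" "v R2 = v R1" unfolding u_def v_def eq by simp_all
  have "(u R1 + v R1) + (l R1 + r R2) = (u R1 + l R1) + (v R1 + r R2)" by (simp only: ac_simps)
  also have "\<dots> = (v R1 + r R1) + (u R1 + l R2)" unfolding key[OF R1] key[OF R2, unfolded e2] ..
  also have "\<dots> = (u R1 + v R1) + (l R2 + r R1)" by (simp only: ac_simps)
  finally have "l R1 + r R2 = l R2 + r R1"
    using ne by (simp only: ennreal_add_left_cancel infinity_ennreal_def simp_thms)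
  then show ?thesis unfolding l_def r_def .
qed

text \<open>\<open>Q\<^sup>+\<close> charges only \<open>{0..}\<close> and the steps of
  \<open>W'.D\<close> are nonnegative, so values of \<open>f\<close> left of 0 are never seen; the
  other case is the mirror image.\<close>

lemma V_cong_pos:
  assumes Q: "finite_borel Q"
  shows "(\<And>y. 0 \<le> y \<Longrightarrow> f y = g y) \<Longrightarrow> (\<integral>\<^sup>+x. W'.V f x \<partial>pos_part \<alpha> Q) = (\<integral>\<^sup>+x. W'.V g x \<partial>pos_part \<alpha> Q)"
    and "(\<And>y. y \<le> 0 \<Longrightarrow> f y = g y) \<Longrightarrow> (\<integral>\<^sup>+x. W.V f x \<partial>neg_part \<alpha> Q) = (\<integral>\<^sup>+x. W.V g x \<partial>neg_part \<alpha> Q)"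
proof -
  note parts = AE_parts[OF Q sets.top, simplified]
  assume fg: "\<And>y. 0 \<le> y \<Longrightarrow> f y = g y"
  show "(\<integral>\<^sup>+x. W'.V f x \<partial>pos_part \<alpha> Q) = (\<integral>\<^sup>+x. W'.V g x \<partial>pos_part \<alpha> Q)"
    by (rule nn_integral_cong_AE, rule eventually_mono[OF parts(1)], rule W'.V_cong[of 0]) (simp_all add: fg)
next
  note parts = AE_parts[OF Q sets.top, simplified]
  assume fg: "\<And>y. y \<le> 0 \<Longrightarrow> f y = g y"
  show "(\<integral>\<^sup>+x. W.V f x \<partial>neg_part \<alpha> Q) = (\<integral>\<^sup>+x. W.V g x \<partial>neg_part \<alpha> Q)"
    by (rule nn_integral_cong_AE, rule eventually_mono[OF parts(2)], rule W.V_cong[of 0]) (simp_all add: fg)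
qed

lemma transl_A_cong:
  shows "(\<And>y. 0 < y \<Longrightarrow> f y = g y) \<Longrightarrow> 0 \<le> x \<Longrightarrow> transl W.A f x = transl W.A g x"
    and "(\<And>y. y < 0 \<Longrightarrow> f y = g y) \<Longrightarrow> x \<le> 0 \<Longrightarrow> transl W'.A f x = transl W'.A g x"
  unfolding transl_def
  by (rule nn_integral_cong_AE, rule eventually_mono[OF W.AE_A], simp)
     (rule nn_integral_cong_AE, rule eventually_mono[OF W'.AE_A], simp)

text \<open>Moving weakly to the right from x \<ge> 0, the origin is reached only if x = 0;
  symmetrically on the left.\<close>

lemma V_at_zero:
  assumes k: "\<And>y. y \<noteq> 0 \<Longrightarrow> k y = 0"
  shows "0 \<le> x \<Longrightarrow> W'.V k x = W'.V k 0 * indicator {0} x"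
    and "x \<le> 0 \<Longrightarrow> W.V k x = W.V k 0 * indicator {0} x"
proof -
  assume x: "0 \<le> x"
  show "W'.V k x = W'.V k 0 * indicator {0} x"
  proof (cases "x = 0")
    case False
    have "W'.V k x = W'.V (\<lambda>_. 0) x"
      using x False by (intro W'.V_cong[of "- x"]) (auto intro!: k)
    then show ?thesis using False by simp
  qed simp
next
  assume x: "x \<le> 0"
  show "W.V k x = W.V k 0 * indicator {0} x"
  proof (cases "x = 0")
    case False
    have "W.V k x = W.V (\<lambda>_. 0) x"
      using x False by (intro W.V_cong[of x]) (auto intro!: k)
    then show ?thesis using False by simp
  qed simp
qed

lemma nn_integral_V_at_zero:
  assumes Q: "finite_borel Q" and k: "\<And>y. y \<noteq> 0 \<Longrightarrow> k y = 0"
  shows "(\<integral>\<^sup>+x. W'.V k x \<partial>pos_part \<alpha> Q) = W'.V k 0 * (ennreal \<alpha> * emeasure Q {0})"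
    and "(\<integral>\<^sup>+x. W.V k x \<partial>neg_part \<alpha> Q) = W.V k 0 * (ennreal (1 - \<alpha>) * emeasure Q {0})"
proof -
  note s = finite_borel_sets[OF Q]
  have at: "(\<integral>\<^sup>+x. w x * (c * indicator {0} x) \<partial>Q) = c * (w 0 * emeasure Q {0})" for w :: "real \<Rightarrow> ennreal" and c
  proof -
    have "(\<integral>\<^sup>+x. w x * (c * indicator {0} x) \<partial>Q) = (\<integral>\<^sup>+x. (c * w 0) * indicator {0} x \<partial>Q)"
      by (intro nn_integral_cong) (simp split: split_indicator add: mult_ac)
    also have "\<dots> = (c * w 0) * emeasure Q {0}"
      by (rule nn_integral_cmult_indicator) (simp add: s)
    finally show ?thesis by (simp only: mult.assoc)
  qed
  note parts = AE_parts[OF Q sets.top, simplified]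
  have "(\<integral>\<^sup>+x. W'.V k x \<partial>pos_part \<alpha> Q) = (\<integral>\<^sup>+x. W'.V k 0 * indicator {0} x \<partial>pos_part \<alpha> Q)"
    by (rule nn_integral_cong_AE, rule eventually_mono[OF parts(1)]) (rule V_at_zero(1), rule k)
  then show "(\<integral>\<^sup>+x. W'.V k x \<partial>pos_part \<alpha> Q) = W'.V k 0 * (ennreal \<alpha> * emeasure Q {0})"
    by (subst (asm) nn_integral_part[OF s]) (simp_all add: at ip_eq)
  have "(\<integral>\<^sup>+x. W.V k x \<partial>neg_part \<alpha> Q) = (\<integral>\<^sup>+x. W.V k 0 * indicator {0} x \<partial>neg_part \<alpha> Q)"
    by (rule nn_integral_cong_AE, rule eventually_mono[OF parts(2)]) (rule V_at_zero(2), rule k)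
  then show "(\<integral>\<^sup>+x. W.V k x \<partial>neg_part \<alpha> Q) = W.V k 0 * (ennreal (1 - \<alpha>) * emeasure Q {0})"
    by (subst (asm) nn_integral_part[OF s]) (simp_all add: at im_eq)
qed

text \<open>Test with the indicator of 0. The strict ladder heights point away from the origin, so
  their terms vanish and a multiple of the atom of \<open>Q\<close> remains.\<close>

lemma W_atom:
  assumes R1: "finite_borel R1" and R2: "finite_borel R2" and eq: "W_measure R1 = W_measure R2"
  shows "emeasure R1 {0} = emeasure R2 {0}"
proof -
  define k :: "real \<Rightarrow> ennreal" where "k = indicator {0}"
  have k: "tame k" unfolding k_def by (rule tame_indicator[of _ 0]) auto
  have mk: "k \<in> borel_measurable borel" by (rule tameD[OF k])
  have k0: "\<And>y. y \<noteq> 0 \<Longrightarrow> k y = 0" by (simp add: k_def)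
  have z: "(\<integral>\<^sup>+x. W'.V (transl W.A k) x \<partial>pos_part \<alpha> R) = 0" "(\<integral>\<^sup>+x. W.V (transl W'.A k) x \<partial>neg_part \<alpha> R) = 0"
    if R: "finite_borel R" for R
  proof -
    have t0: "transl F (\<lambda>_. 0) x = 0" for F x by (simp add: transl_def)
    have "transl W.A k y = 0" if "0 \<le> y" for y using transl_A_cong(1)[of k "\<lambda>_. 0" y] that by (simp add: k_def t0)
    then show "(\<integral>\<^sup>+x. W'.V (transl W.A k) x \<partial>pos_part \<alpha> R) = 0"
      using V_cong_pos(1)[OF R, of "transl W.A k" "\<lambda>_. 0"] by simp
    have "transl W'.A k y = 0" if "y \<le> 0" for y using transl_A_cong(2)[of k "\<lambda>_. 0" y] that by (simp add: k_def t0)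
    then show "(\<integral>\<^sup>+x. W.V (transl W'.A k) x \<partial>neg_part \<alpha> R) = 0"
      using V_cong_pos(2)[OF R, of "transl W'.A k" "\<lambda>_. 0"] by simp
  qed
  let ?c = "W'.V k 0 * ennreal \<alpha> + W.V k 0 * ennreal (1 - \<alpha>)"
  have "?c * emeasure R2 {0} = ?c * emeasure R1 {0}"
    using W_exchange[OF R1 R2 eq k] by (simp add: z R1 R2 nn_integral_V_at_zero[where k=k, OF _ k0] distrib_right mult.assoc)
  moreover have "?c \<noteq> \<top>"
    using tame_finite(5)[OF k R1, of 0] tame_finite(6)[OF k R1, of 0] by (simp add: ennreal_mult_eq_top_iff)
  moreover have "?c \<noteq> 0"
  \<comment> \<open>Both renewal values at 0 include the starting point and are at least 1, so the
    factor is at least \<alpha> + (1 - \<alpha>) = 1.\<close>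
  proof -
    have "1 \<le> W'.V k 0" "1 \<le> W.V k 0" using W'.le_V[OF mk, of 0] W.le_V[OF mk, of 0] by (simp_all add: k_def)
    then have "1 * ennreal \<alpha> + 1 * ennreal (1 - \<alpha>) \<le> ?c" by (intro add_mono mult_right_mono) auto
    moreover have "1 * ennreal \<alpha> + 1 * ennreal (1 - \<alpha>) = 1" using \<alpha> by (simp add: ennreal_plus[symmetric] del: ennreal_plus)
    ultimately show ?thesis by auto
  qed
  ultimately show ?thesis unfolding ennreal_mult_cancel_left by metis
qed

text \<open>For a function supported in \<open>{0<..}\<close> the terms of \<open>Q\<^sup>-\<close>
  vanish. Allowing the value at 0 adds only a multiple of the atom, already known to agree, and
  values left of 0 are invisible from \<open>Q\<^sup>+\<close>.\<close>

lemma W_exchange_pos: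
  assumes R1: "finite_borel R1" and R2: "finite_borel R2" and eq: "W_measure R1 = W_measure R2" and f: "tame f"
  shows "(\<integral>\<^sup>+x. W'.V (transl W.A f) x \<partial>pos_part \<alpha> R1) + (\<integral>\<^sup>+x. W'.V f x \<partial>pos_part \<alpha> R2)
    = (\<integral>\<^sup>+x. W'.V (transl W.A f) x \<partial>pos_part \<alpha> R2) + (\<integral>\<^sup>+x. W'.V f x \<partial>pos_part \<alpha> R1)"
proof -
  have mf[measurable]: "f \<in> borel_measurable borel" by (rule tameD[OF f])
  define g where "g x = indicator {0<..} x * f x" for x
  define k where "k x = indicator {0} x * f x" for x
  have m: "g \<in> borel_measurable borel" "k \<in> borel_measurable borel" unfolding g_def k_def by measurable
  have g: "tame g" by (rule tame_mono[OF f m(1)]) (simp add: g_def split: split_indicator)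
  have k0: "\<And>y. y \<noteq> 0 \<Longrightarrow> k y = 0" by (simp add: k_def)
  have V: "(\<integral>\<^sup>+x. W'.V f x \<partial>pos_part \<alpha> R) = (\<integral>\<^sup>+x. W'.V g x \<partial>pos_part \<alpha> R) + W'.V k 0 * (ennreal \<alpha> * emeasure R {0})"
    if R: "finite_borel R" for R
  proof -
    have "(\<integral>\<^sup>+x. W'.V f x \<partial>pos_part \<alpha> R) = (\<integral>\<^sup>+x. W'.V (\<lambda>x. g x + k x) x \<partial>pos_part \<alpha> R)"
      by (rule V_cong_pos(1)[OF R]) (simp add: g_def k_def split: split_indicator)
    also have "\<dots> = (\<integral>\<^sup>+x. W'.V g x \<partial>pos_part \<alpha> R) + (\<integral>\<^sup>+x. W'.V k x \<partial>pos_part \<alpha> R)"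
      unfolding W'.V_add[OF m]
      by (rule nn_integral_add; rule measurable_finite_borel[OF finite_parts(1)[OF R]]; rule W'.V_measurable; rule m)
    also have "(\<integral>\<^sup>+x. W'.V k x \<partial>pos_part \<alpha> R) = W'.V k 0 * (ennreal \<alpha> * emeasure R {0})"
      by (rule nn_integral_V_at_zero(1)[OF R]) (rule k0)
    finally show ?thesis .
  qed
  have VA: "(\<integral>\<^sup>+x. W'.V (transl W.A f) x \<partial>pos_part \<alpha> R) = (\<integral>\<^sup>+x. W'.V (transl W.A g) x \<partial>pos_part \<alpha> R)"
    if R: "finite_borel R" for R
    by (rule V_cong_pos(1)[OF R], rule transl_A_cong(1)) (simp_all add: g_def)
  have z: "(\<integral>\<^sup>+x. W.V g x \<partial>neg_part \<alpha> R) = 0" "(\<integral>\<^sup>+x. W.V (transl W'.A g) x \<partial>neg_part \<alpha> R) = 0"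
    if R: "finite_borel R" for R
  proof -
    show "(\<integral>\<^sup>+x. W.V g x \<partial>neg_part \<alpha> R) = 0"
      using V_cong_pos(2)[OF R, of g "\<lambda>_. 0"] by (simp add: g_def)
    have "transl W'.A g y = 0" if "y \<le> 0" for y
      using transl_A_cong(2)[of g "\<lambda>_. 0" y] that by (simp add: g_def transl_def[of _ "\<lambda>_. 0"])
    then show "(\<integral>\<^sup>+x. W.V (transl W'.A g) x \<partial>neg_part \<alpha> R) = 0"
      using V_cong_pos(2)[OF R, of "transl W'.A g" "\<lambda>_. 0"] by simp
  qed
  show ?thesis
    using W_exchange[OF R1 R2 eq g] W_atom[OF R1 R2 eq]
    by (simp add: z R1 R2 V VA add.assoc[symmetric])
qed

lemma ennreal_double_cancel:
  fixes x y x' y' u v u' v' :: ennreal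
  assumes "(u + x') + (v' + y) = (u' + x) + (v + y')" "x' + y = x + y'" "x' + y \<noteq> \<top>"
  shows "u + v' = u' + v"
proof -
  have "(x' + y) + (u + v') = (x' + y) + (u' + v)"
    using assms(1) unfolding assms(2) using assms(2) by (simp only: ac_simps)
  then show ?thesis using assms(3) by (simp only: ennreal_add_left_cancel infinity_ennreal_def simp_thms)
qed

text \<open>The one-sided identity says that \<open>Q\<^sup>+ * V' * (\<delta> - A)\<close> is
  determined, with A = \<open>W.A\<close> and V' the renewal measure of \<open>W'.D\<close>. Both
  factors are invertible, so \<open>Q\<^sup>+\<close> is determined. Subtracting its share from
  \<open>W\<close> leaves the potential of \<open>Q\<^sup>-\<close>, which \<delta> - L
  inverts.\<close>

lemma W_injective:
  assumes R1: "finite_borel R1" and R2: "finite_borel R2" and eq: "W_measure R1 = W_measure R2"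
  shows "R1 = R2"
proof -
  let ?P1 = "pos_part \<alpha> R1" and ?P2 = "pos_part \<alpha> R2" and ?M1 = "neg_part \<alpha> R1" and ?M2 = "neg_part \<alpha> R2"
  note fin1 = finite_parts[OF R1] and fin2 = finite_parts[OF R2]
  have mP: "g \<in> borel_measurable borel \<Longrightarrow> g \<in> borel_measurable ?P1" "g \<in> borel_measurable borel \<Longrightarrow> g \<in> borel_measurable ?P2"
    for g :: "real \<Rightarrow> ennreal"
    using measurable_finite_borel[OF fin1(1)] measurable_finite_borel[OF fin2(1)] by blast+
  have A: "(\<integral>\<^sup>+x. transl W.A f x \<partial>?P1) + (\<integral>\<^sup>+x. f x \<partial>?P2) = (\<integral>\<^sup>+x. transl W.A f x \<partial>?P2) + (\<integral>\<^sup>+x. f x \<partial>?P1)"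
    if f: "tame f" for f
  proof -
    have mf: "f \<in> borel_measurable borel" by (rule tameD[OF f])
    have t: "tame (transl W'.D f)" "tame (transl W.A f)" "tame (transl W'.D (transl W.A f))"
      by (intro tame_transl W'.D W.A f)+
    note mt = tameD[OF t(1)] tameD[OF t(2)] tameD[OF t(3)]
    have c: "transl W.A (transl W'.D f) = transl W'.D (transl W.A f)" by (rule transl_commute[OF W.A W'.D mf])
    have V: "(\<integral>\<^sup>+x. W'.V g x \<partial>P) = (\<integral>\<^sup>+x. g x \<partial>P) + (\<integral>\<^sup>+x. W'.V (transl W'.D g) x \<partial>P)"
      if P: "finite_borel P" and g: "g \<in> borel_measurable borel" for P g
    proof -
      have "(\<integral>\<^sup>+x. g x + W'.V (transl W'.D g) x \<partial>P) = (\<integral>\<^sup>+x. g x \<partial>P) + (\<integral>\<^sup>+x. W'.V (transl W'.D g) x \<partial>P)"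
        by (rule nn_integral_add; rule measurable_finite_borel[OF P]) (rule g, rule W'.V_measurable, rule measurable_transl[OF W'.D g])
      then show ?thesis unfolding W'.V_unfold[OF g, symmetric] .
    qed
    \<comment> \<open>The difference of the identities for \<open>f\<close> and for
      \<open>transl W'.D f\<close> strips off the renewal operator \<open>W'.V\<close>.\<close>
    show ?thesis
      by (rule ennreal_double_cancel[OF
          W_exchange_pos[OF R1 R2 eq f, unfolded V[OF fin1(1) mf] V[OF fin2(1) mf] V[OF fin1(1) mt(2)] V[OF fin2(1) mt(2)]]
          W_exchange_pos[OF R1 R2 eq t(1), unfolded c]])
         (use tame_finite(4)[OF t(3) fin1(1)] tame_finite(4)[OF t(1) fin2(1)] in simp)
  qed
  have P: "(\<integral>\<^sup>+x. f x \<partial>?P1) = (\<integral>\<^sup>+x. f x \<partial>?P2)" if f: "tame f" for f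
  proof -
    have mf: "f \<in> borel_measurable borel" by (rule tameD[OF f])
    have t: "tame (transl W.U f)" "tame (transl W.A (transl W.U f))" by (intro tame_transl W.U W.A f)+
    have U: "(\<integral>\<^sup>+x. transl W.U f x \<partial>Q) = (\<integral>\<^sup>+x. f x \<partial>Q) + (\<integral>\<^sup>+x. transl W.A (transl W.U f) x \<partial>Q)"
      if Q: "finite_borel Q" for Q
    proof -
      have "(\<integral>\<^sup>+x. f x + transl W.A (transl W.U f) x \<partial>Q) = (\<integral>\<^sup>+x. f x \<partial>Q) + (\<integral>\<^sup>+x. transl W.A (transl W.U f) x \<partial>Q)"
        by (rule nn_integral_add; rule measurable_finite_borel[OF Q]) (rule mf, rule tameD[OF t(2)])
      then show ?thesis unfolding W.U_A[OF mf, symmetric] .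
    qed
    let ?a1 = "\<integral>\<^sup>+x. transl W.A (transl W.U f) x \<partial>?P1" and ?a2 = "\<integral>\<^sup>+x. transl W.A (transl W.U f) x \<partial>?P2"
    \<comment> \<open>Testing with \<open>transl W.U f\<close> undoes \<delta> - A.\<close>
    have "(?a1 + ?a2) + (\<integral>\<^sup>+x. f x \<partial>?P2) = (?a1 + ?a2) + (\<integral>\<^sup>+x. f x \<partial>?P1)"
      using A[OF t(1)] unfolding U[OF fin1(1)] U[OF fin2(1)] by (simp only: ac_simps)
    moreover have "?a1 + ?a2 \<noteq> \<top>" using tame_finite(7)[OF t(2) fin1(1)] tame_finite(7)[OF t(2) fin2(1)] by simp
    ultimately show ?thesis by (simp only: ennreal_add_left_cancel infinity_ennreal_def simp_thms)
  qed
  have P_eq: "?P1 = ?P2"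
  proof (rule measure_eqI_bounded)
    show s: "sets ?P1 = sets borel" "sets ?P2 = sets borel" using finite_borel_sets fin1 fin2 by auto
    fix B :: "real set" and r :: real assume B: "B \<in> sets borel"
    have "tame (indicator (B \<inter> {-r..r}))" using B by (intro tame_indicator) auto
    from P[OF this] show "emeasure ?P1 (B \<inter> {-r..r}) = emeasure ?P2 (B \<inter> {-r..r})" using B s by simp
  qed
  have Mpot: "(\<integral>\<^sup>+x. W.pot f x \<partial>?M1) = (\<integral>\<^sup>+x. W.pot f x \<partial>?M2)" if f: "tame f" for f
  proof -
    have mf: "f \<in> borel_measurable borel" by (rule tameD[OF f])
    have "(\<integral>\<^sup>+x. W'.pot f x \<partial>?P2) + (\<integral>\<^sup>+x. W.pot f x \<partial>?M1) = (\<integral>\<^sup>+x. W'.pot f x \<partial>?P2) + (\<integral>\<^sup>+x. W.pot f x \<partial>?M2)"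
      by (rule trans[OF sym[OF nn_integral_W[OF R1 mf, unfolded eq P_eq]] nn_integral_W[OF R2 mf]])
    then show ?thesis using tame_finite(2)[OF f fin2(1)]
      by (simp only: ennreal_add_left_cancel infinity_ennreal_def simp_thms)
  qed
  have M: "(\<integral>\<^sup>+x. f x \<partial>?M1) = (\<integral>\<^sup>+x. f x \<partial>?M2)" if f: "tame f" for f
  proof -
    have mf: "f \<in> borel_measurable borel" by (rule tameD[OF f])
    have t: "tame (transl L f)" by (rule tame_transl[OF W.L f])
    have pot: "(\<integral>\<^sup>+x. W.pot f x \<partial>Q) = (\<integral>\<^sup>+x. W.pot (transl L f) x \<partial>Q) + (\<integral>\<^sup>+x. f x \<partial>Q)" if Q: "finite_borel Q" for Q
    proof -
      have "(\<integral>\<^sup>+x. W.pot (transl L f) x + f x \<partial>Q) = (\<integral>\<^sup>+x. W.pot (transl L f) x \<partial>Q) + (\<integral>\<^sup>+x. f x \<partial>Q)"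
        by (rule nn_integral_add; rule measurable_finite_borel[OF Q]) (rule W.pot_measurable[OF tameD[OF t]], rule mf)
      then show ?thesis
        using W.pot_L[OF mf tame_finite(5)[OF f Q]] unfolding W.transl_pot[OF W.L mf] by simp
    qed
    have "(\<integral>\<^sup>+x. W.pot (transl L f) x \<partial>?M2) + (\<integral>\<^sup>+x. f x \<partial>?M1) = (\<integral>\<^sup>+x. W.pot (transl L f) x \<partial>?M2) + (\<integral>\<^sup>+x. f x \<partial>?M2)"
      using Mpot[OF f] unfolding pot[OF fin1(2)] pot[OF fin2(2)] Mpot[OF t] .
    then show ?thesis using tame_finite(1)[OF t fin2(2)]
      by (simp only: ennreal_add_left_cancel infinity_ennreal_def simp_thms)
  qed
  show ?thesis
  proof (rule measure_eqI_bounded)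
    show s: "sets R1 = sets borel" "sets R2 = sets borel" using finite_borel_sets R1 R2 by auto
    fix B :: "real set" and r :: real assume B: "B \<in> sets borel"
    have t: "tame (indicator (B \<inter> {-r..r}))" using B by (intro tame_indicator) auto
    have "(\<integral>\<^sup>+x. indicator (B \<inter> {-r..r}) x \<partial>R1) = (\<integral>\<^sup>+x. indicator (B \<inter> {-r..r}) x \<partial>R2)"
      unfolding nn_integral_parts_split[OF R1 tameD[OF t], symmetric] nn_integral_parts_split[OF R2 tameD[OF t], symmetric] P_eq M[OF t] ..
    then show "emeasure R1 (B \<inter> {-r..r}) = emeasure R2 (B \<inter> {-r..r})" using B s by simp
  qed
qed

section \<open>Uniqueness of the invariant law\<close>

lemma W_scale:
  assumes Q: "finite_borel Q" and c: "c < \<infinity>"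
  shows "finite_borel (scale_measure c Q)" "B \<in> sets borel \<Longrightarrow> emeasure (W_measure (scale_measure c Q)) B = c * emeasure (W_measure Q) B"
proof -
  note s = finite_borel_sets[OF Q]
  show fin: "finite_borel (scale_measure c Q)"
    using mult_emeasure_finite[OF Q c] s sets_eq_imp_space_eq[of "scale_measure c Q" borel]
    by (auto simp: finite_borel_def intro!: finite_measureI)
  assume B: "B \<in> sets borel"
  have iB: "indicator B \<in> borel_measurable borel" using B by simp
  have p: "(\<integral>\<^sup>+x. g x \<partial>pos_part \<alpha> (scale_measure c Q)) = c * (\<integral>\<^sup>+x. g x \<partial>pos_part \<alpha> Q)"
    "(\<integral>\<^sup>+x. g x \<partial>neg_part \<alpha> (scale_measure c Q)) = c * (\<integral>\<^sup>+x. g x \<partial>neg_part \<alpha> Q)"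
    if [measurable]: "g \<in> borel_measurable borel" for g
  proof -
    have "(\<lambda>x. ip x * g x) \<in> borel_measurable borel" "(\<lambda>x. im x * g x) \<in> borel_measurable borel" by measurable
    then have "(\<lambda>x. ip x * g x) \<in> borel_measurable Q" "(\<lambda>x. im x * g x) \<in> borel_measurable Q"
      using measurable_finite_borel[OF Q] by blast+
    then show "(\<integral>\<^sup>+x. g x \<partial>pos_part \<alpha> (scale_measure c Q)) = c * (\<integral>\<^sup>+x. g x \<partial>pos_part \<alpha> Q)"
      "(\<integral>\<^sup>+x. g x \<partial>neg_part \<alpha> (scale_measure c Q)) = c * (\<integral>\<^sup>+x. g x \<partial>neg_part \<alpha> Q)"
      using s that by (simp_all add: nn_integral_part nn_integral_scale_measure)
  qed
  show "emeasure (W_measure (scale_measure c Q)) B = c * emeasure (W_measure Q) B"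
    using nn_integral_W[OF fin iB] nn_integral_W[OF Q iB] W.pot_measurable[OF iB] W'.pot_measurable[OF iB] B
    by (simp add: p distrib_left)
qed

text \<open>Both measures \<open>W\<close> are multiples of Haar measure, so cross-scaling
  \<open>Q1\<close> and \<open>Q2\<close> by each other's constants makes them equal. Injectivity
  carries this over to the scaled laws, and comparing total masses shows that the constants
  coincide.\<close>

lemma invariant_unique:
  assumes Q1: "finite_borel Q1" "emeasure Q1 UNIV = 1" "AE x in Q1. x \<in> Z" "step Q1 = Q1"
    and Q2: "finite_borel Q2" "emeasure Q2 UNIV = 1" "AE x in Q2. x \<in> Z" "step Q2 = Q2"
  shows "Q1 = Q2"
proof -
  let ?h = "emeasure haar {-1..1}"
  let ?k1 = "emeasure (W_measure Q1) {-1..1}" and ?k2 = "emeasure (W_measure Q2) {-1..1}"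
  have h: "?h \<noteq> 0" "?h \<noteq> \<top>"
    using emeasure_grid_haar_Icc_pos[OF d_nonneg, of 1] emeasure_grid_haar_Icc[OF d_nonneg, of 1] by auto
  have fin: "?k1 < \<infinity>" "?k2 < \<infinity>" by (rule W_locally_finite[OF Q1(1)], rule W_locally_finite[OF Q2(1)])
  have "W_measure (scale_measure ?k2 Q1) = W_measure (scale_measure ?k1 Q2)"
  proof (rule measure_eqI)
    fix B assume "B \<in> sets (W_measure (scale_measure ?k2 Q1))"
    then have B: "B \<in> sets borel" by simp
    have "?h * (?k2 * emeasure (W_measure Q1) B) = ?k2 * (?h * emeasure (W_measure Q1) B)" by (simp only: ac_simps)
    also have "\<dots> = ?k1 * (?h * emeasure (W_measure Q2) B)"
      unfolding W_haar[OF Q1(1,4,3) B] W_haar[OF Q2(1,4,3) B] by (simp only: ac_simps)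
    also have "\<dots> = ?h * (?k1 * emeasure (W_measure Q2) B)" by (simp only: ac_simps)
    finally have "?k2 * emeasure (W_measure Q1) B = ?k1 * emeasure (W_measure Q2) B"
      using h unfolding ennreal_mult_cancel_left by blast
    then show "emeasure (W_measure (scale_measure ?k2 Q1)) B = emeasure (W_measure (scale_measure ?k1 Q2)) B"
      unfolding W_scale(2)[OF Q1(1) fin(2) B] W_scale(2)[OF Q2(1) fin(1) B] .
  qed simp
  then have R: "scale_measure ?k2 Q1 = scale_measure ?k1 Q2"
    by (rule W_injective[OF W_scale(1)[OF Q1(1) fin(2)] W_scale(1)[OF Q2(1) fin(1)]])
  have k: "?k2 = ?k1" using arg_cong[OF R, of "\<lambda>N. emeasure N UNIV"] Q1(2) Q2(2) by simp
  have UNIV_borel: "(UNIV :: real set) \<in> sets borel" by simp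
  \<comment> \<open>\<open>W\<close> dominates \<open>Q2\<close>, since every potential of the
    constant 1 is at least 1; a vanishing constant would make \<open>Q2\<close> zero.\<close>
  have "?k2 \<noteq> 0"
  proof
    assume z: "?k2 = 0"
    have "?h * emeasure (W_measure Q2) UNIV = 0" unfolding W_haar[OF Q2(1,4,3) UNIV_borel] z by simp
    then have "emeasure (W_measure Q2) UNIV = 0" using h by simp
    then have "(\<integral>\<^sup>+x. 1 \<partial>W_measure Q2) = 0" unfolding nn_integral_1_UNIV[OF sets_W_measure] .
    moreover have "(\<integral>\<^sup>+x. 1 \<partial>Q2) \<le> (\<integral>\<^sup>+x. 1 \<partial>W_measure Q2)"
    proof -
      have "1 \<le> W.pot (\<lambda>_. 1) x" "1 \<le> W'.pot (\<lambda>_. 1) x" for x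
        using W.le_V[of "\<lambda>_. 1" x] W.V_le_pot[of "\<lambda>_. 1" x] W'.le_V[of "\<lambda>_. 1" x] W'.V_le_pot[of "\<lambda>_. 1" x]
        by (auto intro: order_trans)
      then show ?thesis
        unfolding nn_integral_W[OF Q2(1) borel_measurable_const] nn_integral_parts_split[OF Q2(1) borel_measurable_const, symmetric]
        by (intro add_mono nn_integral_mono)
    qed
    ultimately show False using Q2(2) nn_integral_1_UNIV[OF finite_borel_sets[OF Q2(1)]] by simp
  qed
  show ?thesis
  proof (rule measure_eqI)
    show "sets Q1 = sets Q2" using finite_borel_sets Q1 Q2 by auto
    fix B
    have "?k1 * emeasure Q1 B = ?k1 * emeasure Q2 B"
      using arg_cong[OF R, of "\<lambda>N. emeasure N B"] k by simp
    then show "emeasure Q1 B = emeasure Q2 B"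
      using \<open>?k2 \<noteq> 0\<close> k fin(1) unfolding ennreal_mult_cancel_left by auto
  qed
qed

lemma invariant_for_iff:
  assumes Q: "finite_borel Q"
  shows "invariant_for (switching_kernel L L' \<alpha>) Q \<longleftrightarrow> step Q = Q"
proof -
  have "invariant_for (switching_kernel L L' \<alpha>) Q \<longleftrightarrow> (\<forall>B\<in>sets borel. emeasure (step Q) B = emeasure Q B)"
    unfolding invariant_for_def using nn_integral_switching_kernel[OF Q] by simp
  also have "\<dots> \<longleftrightarrow> step Q = Q"
    using finite_borel_sets[OF Q] by (auto intro!: measure_eqI)
  finally show ?thesis .
qed

lemma step_scale:
  assumes Q: "finite_borel Q" and c: "c < \<infinity>" and inv: "step Q = Q"
  shows "step (scale_measure c Q) = scale_measure c Q"
proof (rule measure_eqI)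
  have fin: "finite_borel (scale_measure c Q)" by (rule W_scale(1)[OF Q c])
  show "sets (step (scale_measure c Q)) = sets (scale_measure c Q)" using finite_borel_sets[OF Q] by simp
  fix B assume "B \<in> sets (step (scale_measure c Q))"
  then have B: "B \<in> sets borel" by simp
  have "emeasure (step (scale_measure c Q)) B = (\<integral>\<^sup>+x. emeasure (switching_kernel L L' \<alpha> x) B \<partial>scale_measure c Q)"
    by (rule nn_integral_switching_kernel[OF fin B, symmetric])
  also have "\<dots> = c * (\<integral>\<^sup>+x. emeasure (switching_kernel L L' \<alpha> x) B \<partial>Q)"
  proof (rule nn_integral_scale_measure)
    have iB: "indicator B \<in> borel_measurable borel" using B by simp
    show "(\<lambda>x. emeasure (switching_kernel L L' \<alpha> x) B) \<in> borel_measurable Q"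
      unfolding emeasure_switching_kernel[OF B]
      by (rule measurable_finite_borel[OF Q]) (intro borel_measurable_add borel_measurable_times_ennreal
          weights_measurable measurable_transl[OF W.L iB] measurable_transl[OF W'.L iB])
  qed
  also have "\<dots> = c * emeasure Q B" unfolding nn_integral_switching_kernel[OF Q B] inv ..
  finally show "emeasure (step (scale_measure c Q)) B = emeasure (scale_measure c Q) B" by simp
qed

lemma emeasure_mu_Z: "emeasure mu Z = emeasure mu UNIV"
  using AE_mu by (intro emeasure_eq_AE) (auto elim!: eventually_mono)

lemma prob_measure_on_iff:
  "prob_measure_on Z Q \<longleftrightarrow> finite_borel Q \<and> emeasure Q UNIV = 1 \<and> (AE x in Q. x \<in> Z)"
proof -
  have "prob_space Q \<and> emeasure Q Z = 1 \<longleftrightarrow> finite_measure Q \<and> emeasure Q UNIV = 1 \<and> (AE x in Q. x \<in> Z)"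
    if s: "sets Q = sets borel"
  proof
    assume *: "prob_space Q \<and> emeasure Q Z = 1"
    then interpret prob_space Q by simp
    have "prob Z = 1" using * by (simp add: emeasure_eq_measure)
    then have "AE x in Q. x \<in> Z" using s by (subst (asm) prob_eq_1) simp_all
    then show "finite_measure Q \<and> emeasure Q UNIV = 1 \<and> (AE x in Q. x \<in> Z)"
      using emeasure_space_1 sets_eq_imp_space_eq[OF s] by (simp add: finite_measure_axioms)
  next
    assume *: "finite_measure Q \<and> emeasure Q UNIV = 1 \<and> (AE x in Q. x \<in> Z)"
    have "emeasure Q Z = emeasure Q UNIV"
      using * s by (intro emeasure_eq_AE) (auto elim!: eventually_mono)
    then show "prob_space Q \<and> emeasure Q Z = 1"
      using * sets_eq_imp_space_eq[OF s] by (auto intro!: prob_spaceI)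
  qed
  then show ?thesis unfolding prob_measure_on_def finite_borel_def by blast
qed

lemma stationary_law:
  defines "stat \<equiv> scale_measure (1 / emeasure mu Z) mu"
  shows "prob_measure_on Z stat \<and> invariant_for (switching_kernel L L' \<alpha>) stat
    \<and> (\<forall>Q. prob_measure_on Z Q \<and> invariant_for (switching_kernel L L' \<alpha>) Q \<longrightarrow> Q = stat)"
proof -
  let ?m = "emeasure mu Z"
  have m: "?m \<noteq> 0" "?m \<noteq> \<top>"
    unfolding emeasure_mu_Z using mu_pos finite_borel_emeasure[OF finite_mu] by auto
  have c: "1 / ?m < \<infinity>" using m by (simp add: ennreal_divide_eq_top_iff less_top[symmetric])
  have fin: "finite_borel stat" unfolding stat_def by (rule W_scale(1)[OF finite_mu c])
  obtain r where r: "?m = ennreal r" "0 < r" using m by (cases ?m) (auto simp: less_le)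
  have "?m / ?m = 1" unfolding r using r(2) by (simp add: divide_ennreal)
  then have one: "emeasure stat UNIV = 1"
    unfolding stat_def using m by (simp add: emeasure_mu_Z[symmetric] ennreal_divide_times del: ennreal_times_divide)
  have "emeasure mu (- Z) = 0"
    using AE_mu by (subst AE_iff_null_sets[symmetric, THEN iffD1, THEN null_setsD1]) auto
  then have "emeasure stat (- Z) = 0" unfolding stat_def by simp
  then have Z: "AE x in stat. x \<in> Z"
    using finite_borel_sets[OF fin] by (intro AE_I[of _ _ "- Z"]) auto
  have inv: "step stat = stat" unfolding stat_def by (rule step_scale[OF finite_mu c step_mu])
  have "Q = stat" if "prob_measure_on Z Q" "invariant_for (switching_kernel L L' \<alpha>) Q" for Q
  proof -
    have Q: "finite_borel Q" "emeasure Q UNIV = 1" "AE x in Q. x \<in> Z" using that(1) unfolding prob_measure_on_iff by blast+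
    show ?thesis
      using that(2) unfolding invariant_for_iff[OF Q(1)] by (rule invariant_unique[OF Q _ fin one Z inv])
  qed
  then show ?thesis
    using fin one Z inv unfolding prob_measure_on_iff[of stat] invariant_for_iff[OF fin] by blast
qed

end

section \<open>From step laws back to the random variables\<close>

lemma (in prob_space) drifting_walk_distr:
  assumes "X \<in> borel_measurable M" "integrable M X" "s = 1 \<or> s = -1" "s * expectation X < 0"
  shows "drifting_walk (distr M borel X) s"
proof (rule drifting_walk.intro)
  show "prob_space (distr M borel X)" using assms(1) by (rule prob_space_distr)
  show "integrable (distr M borel X) (\<lambda>x. x)" using assms(1,2) by (simp add: integrable_distr_eq)
  show "s * (\<integral>x. x \<partial>distr M borel X) < 0" using assms(1,4) by (simp add: integral_distr)
qed (use assms(3) in simp_all)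

theorem corollary2:
  fixes M :: "'a measure" and X X' :: "nat \<Rightarrow> 'a \<Rightarrow> real" and \<alpha> :: real
  assumes "prob_space M"
    and "0 \<le> \<alpha>" and "\<alpha> \<le> 1"
    and "prob_space.indep_vars M (\<lambda>_. borel) (case_sum X X') ({1..} <+> {1..})"
    and "\<And>n. n \<ge> 1 \<Longrightarrow> distr M borel (X n) = distr M borel (X 1)"
    and "\<And>n. n \<ge> 1 \<Longrightarrow> distr M borel (X' n) = distr M borel (X' 1)"
    and "integrable M (X 1)" and "integral\<^sup>L M (X 1) < 0"
    and "integrable M (X' 1)" and "0 < integral\<^sup>L M (X' 1)"
  shows "let L = distr M borel (X 1); L' = distr M borel (X' 1);
             d = grid_span L L'; Z = grid d;
             P = switching_kernel L L' \<alpha>;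
             \<mu> = mu_measure M X X' \<alpha> d;
             \<pi> = scale_measure (1 / emeasure \<mu> Z) \<mu>
         in prob_measure_on Z \<pi> \<and> invariant_for P \<pi>
            \<and> (\<forall>Q. prob_measure_on Z Q \<and> invariant_for P Q \<longrightarrow> Q = \<pi>)"
proof -
  interpret prob_space M by fact
  let ?L = "distr M borel (X 1)" and ?L' = "distr M borel (X' 1)"
  have "indep_vars (\<lambda>_. borel) (case_sum X X') (Inl ` {1..})" "indep_vars (\<lambda>_. borel) (case_sum X X') (Inr ` {1..})"
    by (rule indep_vars_subset[OF assms(4)]; auto)+
  then have indep: "indep_vars (\<lambda>_. borel) X {1..}" "indep_vars (\<lambda>_. borel) X' {1..}"
    using indep_vars_comp_inj[of borel "case_sum X X'" Inl "{1..}"] indep_vars_comp_inj[of borel "case_sum X X'" Inr "{1..}"]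
    by simp_all
  interpret X: iid_walk M X ?L by unfold_locales (rule indep(1), erule assms(5))
  interpret X': iid_walk M X' ?L' by unfold_locales (rule indep(2), erule assms(6))
  interpret W: drifting_walk ?L 1
    by (rule drifting_walk_distr) (use X.X_measurable[of 1] assms(7,8) in simp_all)
  interpret W': drifting_walk ?L' "- 1"
    by (rule drifting_walk_distr) (use X'.X_measurable[of 1] assms(9,10) in simp_all)
  interpret switching_walk ?L ?L' \<alpha> by unfold_locales (rule assms(2), rule assms(3))
  have compl: "- {..0::real} = {0<..}" "- {0::real..} = {..<0}" "- {..<0::real} = {0..}" "- {0::real<..} = {..0}"
    by auto
  have C: "W.C = {0<..}" "W'.C = {..<0}" by (auto simp: W.C_def W'.C_def)
  \<comment> \<open>Entering \<open>{..0}\<close> is leaving \<open>W.C\<close>, and entering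
    \<open>{0<..}\<close> is leaving its complement; for the second walk the half-lines are
    reflected.\<close>
  have laws: "ladder_law M X {..0} = W.D" "ladder_law M X {0<..} = W.A"
    "ladder_law M X' {0..} = W'.D" "ladder_law M X' {..<0} = W'.A"
    by (simp_all add: X.ladder_law_eq_exit_law X'.ladder_law_eq_exit_law W.D_def W.A_def W'.D_def W'.A_def C compl del: One_nat_def)
  have "mu_measure M X X' \<alpha> d = mu"
    by (simp add: mu_measure_def Let_def laws mu_def nu_plus_def nu_minus_def nu_def W.U_def W'.U_def del: One_nat_def)
  then show ?thesis
    using stationary_law unfolding Let_def d_def[symmetric] Z_def[symmetric] by (simp del: One_nat_def)
qed

end
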